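(* Let $n\ge2$, $\lambda\in(1,\infty)$, $\theta=\frac{\lambda-1}{\lambda+1}$, and for $\varepsilon>0$ let $F_\varepsilon(x,y)=|y|-\frac{\langle x,y\rangle(|x|+2\varepsilon)\theta}{(|x|+\varepsilon)^2}$ on $\mathbb{R}^n\times\mathbb{R}^n$, $\mathsf{m}_\varepsilon$ its Busemann--Hausdorff measure, and $\rho_\varepsilon=d_{F_\varepsilon}(0,\cdot)$. Let $p>1$, $p'=\frac p{p-1}$, $R\in(0,+\infty]$, and $\Omega_\varepsilon=\{x\in\mathbb{R}^n:\rho_\varepsilon(x)<R\}$. Let $L,W\colon(0,R)\to(0,\infty)$ be continuous with $L(t)\le\frac{n-1}{t}$ for all $t\in(0,R)$, let $w\colon(0,R)\to(0,\infty)$ be $C^1$, and let $G\colon(0,R)\to(0,\infty)$ be $C^1$ with \[(G(t)w(t))'+G(t)w(t)L(t)-(p-1)G(t)^{p'}w(t)=W(t)w(t)\quad\forall t\in(0,R).\] Let $v\colon(0,R)\to(0,\infty)$ be a $C^1$ function with $-v'(t)/v(t)=G(t)^{1/(p-1)}$, and for continuous $f$ and $0<a<b<R$ put $\mathcal{I}(f;a,b)=\int_a^bf(t)t^{n-1}\,dt$. Fix $\delta_0>0$ and let $t_1,t_2,t_3,t_4$ be continuous functions of $\delta\in(\delta_0,\infty)$, each having a (possibly infinite) limit as $\delta\to\infty$, with $0<t_1<t_2<t_3<t_4<R$ for all $\delta>\delta_0$. Assume \[\lim_{\delta\to\infty}\Big(\frac{v(t_2)^p\,\mathcal{I}(w;t_1,t_2)}{(t_2-t_1)^p\,\mathcal{I}(wWv^p;t_2,t_3)}+\frac{v(t_3)^p\,\mathcal{I}(w;t_3,t_4)}{(t_4-t_3)^p\,\mathcal{I}(wWv^p;t_2,t_3)}\Big)=0,\qquad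 \lim_{\delta\to\infty}\max_{t\in[t_2,t_3]}\frac{G(t)^{p'}}{W(t)}=1.\] Then the inequality \[\lambda^p\int_{\Omega_\varepsilon}w(\rho_\varepsilon)F^*_\varepsilon(Du)^p\,\mathrm{d}\mathsf{m}_\varepsilon\ge\int_{\Omega_\varepsilon}w(\rho_\varepsilon)W(\rho_\varepsilon)|u|^p\,\mathrm{d}\mathsf{m}_\varepsilon\quad(u\in C_0^\infty(\Omega_\varepsilon))\] is sharp on the family $\{(\mathbb{R}^n,F_\varepsilon,\mathsf{m}_\varepsilon)\}_{\varepsilon>0}$: for every constant $c>1$, the inequality with its right-hand side multiplied by $c$ fails for some $\varepsilon>0$ and some $u\in C_0^\infty(\Omega_\varepsilon)$.
   Context: $|\cdot|,\langle\cdot,\cdot\rangle$ are Euclidean. $d_F(x_0,x_1)$ is the infimum of $\int_0^1F(c,\dot c)\,dt$ over Lipschitz curves from $x_0$ to $x_1$. Busemann--Hausdorff measure of $F$: density $\sigma_F(x)=\mathrm{vol}(\mathbb{B}^n)/\mathrm{vol}\{y:F(x,y)<1\}$ w.r.t. Lebesgue measure. $F^*_\varepsilon(x,\xi)=\sup_{y\ne0}\xi(y)/F_\varepsilon(x,y)$ is the dual metric and $Du$ the differential of $u$. *)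

theory Defs
  imports "HOL-Analysis.Analysis"
begin

definition theta :: "real \<Rightarrow> real" where
  "theta lam = (lam - 1) / (lam + 1)"

definition Feps :: "real \<Rightarrow> real \<Rightarrow> 'a::euclidean_space \<Rightarrow> 'a \<Rightarrow> real" where
  "Feps lam \<epsilon> x y = norm y - inner x y * (norm x + 2 * \<epsilon>) * theta lam / (norm x + \<epsilon>)\<^sup>2"

definition finsler_dist :: "('a::euclidean_space \<Rightarrow> 'a \<Rightarrow> real) \<Rightarrow> 'a \<Rightarrow> 'a \<Rightarrow> real" where
  "finsler_dist F x0 x1 = Inf {integral {0..1} (\<lambda>t. F (c t) (vector_derivative c (at t))) | c.
      c 0 = x0 \<and> c 1 = x1 \<and> (\<exists>K. K-lipschitz_on {0..1} c)}"

definition rho_eps :: "real \<Rightarrow> real \<Rightarrow> 'a::euclidean_space \<Rightarrow> real" where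
  "rho_eps lam \<epsilon> x = finsler_dist (Feps lam \<epsilon>) 0 x"

definition Omega_eps :: "real \<Rightarrow> real \<Rightarrow> ereal \<Rightarrow> 'a::euclidean_space set" where
  "Omega_eps lam \<epsilon> R = {x. ereal (rho_eps lam \<epsilon> x) < R}"

definition BH_density :: "('a::euclidean_space \<Rightarrow> 'a \<Rightarrow> real) \<Rightarrow> 'a \<Rightarrow> real" where
  "BH_density F x = measure lebesgue (ball (0::'a) 1) / measure lebesgue {y. F x y < 1}"

definition BH_measure :: "('a::euclidean_space \<Rightarrow> 'a \<Rightarrow> real) \<Rightarrow> 'a measure" where
  "BH_measure F = density lebesgue (\<lambda>x. ennreal (BH_density F x))"

definition dual_metric :: "('a::euclidean_space \<Rightarrow> 'a \<Rightarrow> real) \<Rightarrow> 'a \<Rightarrow> ('a \<Rightarrow> real) \<Rightarrow> real" where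
  "dual_metric F x \<xi> = Sup {\<xi> y / F x y | y. y \<noteq> 0}"

text \<open>Iterated partial derivatives along basis directions; smoothness = all of them exist
  and are differentiable everywhere (equivalently C^infinity)\<close>
fun iter_pd :: "'a::euclidean_space list \<Rightarrow> ('a \<Rightarrow> real) \<Rightarrow> 'a \<Rightarrow> real" where
  "iter_pd [] u = u"
| "iter_pd (e # es) u = (\<lambda>x. frechet_derivative (iter_pd es u) (at x) e)"

definition smooth_fun :: "('a::euclidean_space \<Rightarrow> real) \<Rightarrow> bool" where
  "smooth_fun u \<longleftrightarrow> (\<forall>es. set es \<subseteq> Basis \<longrightarrow> iter_pd es u differentiable_on UNIV)"

definition test_functions :: "'a::euclidean_space set \<Rightarrow> ('a \<Rightarrow> real) set" where
  "test_functions \<Omega> = {u. smooth_fun u \<and> compact (closure {x. u x \<noteq> 0})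
                          \<and> closure {x. u x \<noteq> 0} \<subseteq> \<Omega>}"

definition Jint :: "ereal \<Rightarrow> real set" where
  "Jint R = {t. 0 < t \<and> ereal t < R}"

definition C1_on :: "real set \<Rightarrow> (real \<Rightarrow> real) \<Rightarrow> bool" where
  "C1_on S f \<longleftrightarrow> (\<forall>t\<in>S. f field_differentiable (at t)) \<and> continuous_on S (deriv f)"

definition radI :: "nat \<Rightarrow> (real \<Rightarrow> real) \<Rightarrow> real \<Rightarrow> real \<Rightarrow> real" where
  "radI n f a b = integral {a..b} (\<lambda>t. f t * t ^ (n - 1))"

end

theory Submission
  imports Defs
begin

text \<open>
  Writing \<open>F\<^sub>\<epsilon>(x,y) = |y| - \<theta> Dh(x)y\<close> with \<open>h(x) = |x|\<^sup>2 / (|x| + \<epsilon>)\<close>, the distance from the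
  origin is \<open>\<rho>\<^sub>\<epsilon>(x) = |x| - \<theta> h(x)\<close>. For a radial function the dual norm of an outward
  gradient of size \<open>\<kappa>\<close> is \<open>\<kappa> / (1 - b)\<close> and that of an inward one is \<open>\<kappa> / (1 + b)\<close>, where
  \<open>b = b(|x|) \<rightarrow> \<theta>\<close> as \<open>\<epsilon> \<rightarrow> 0\<close>. Since \<open>\<rho>\<^sub>\<epsilon> \<rightarrow> (1 - \<theta>)|x|\<close> and
  \<open>\<lambda> = (1 + \<theta>) / (1 - \<theta>)\<close>, the factor \<open>\<lambda>\<^sup>p\<close> is exactly compensated where a function of
  \<open>\<rho>\<close> decreases, and both sides become one-dimensional integrals with weight \<open>t\<^sup>n\<^sup>-\<^sup>1\<close> in the
  limit \<open>\<epsilon> \<rightarrow> 0\<close>. Take the profile that equals \<open>v\<close> on \<open>[t\<^sub>2, t\<^sub>3]\<close>, where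
  \<open>|v'|\<^sup>p = G\<^sup>p\<^sup>' v\<^sup>p\<close>, and is linear on \<open>[t\<^sub>1, t\<^sub>2]\<close> and \<open>[t\<^sub>3, t\<^sub>4]\<close>. By the two limit
  hypotheses its energy quotient is at most \<open>1 + o(1)\<close> as \<open>\<delta> \<rightarrow> \<infinity>\<close>. The profile is approximated by smooth
  ones, with \<open>\<epsilon> \<rightarrow> 0\<close> along the approximation, and dominated convergence applies.
\<close>

section \<open>Almost everywhere differentiability of Lipschitz functions of a real variable\<close>

text \<open>The drift term is exact: along any curve from the origin it integrates to \<theta> h at
  the endpoint, so only the Euclidean length is left to minimise and radial segments win. For
  Lipschitz curves this rests on almost everywhere differentiability combined with the fundamental
  theorem of calculus. For each \<epsilon> the function b stays below \<theta>, and where a function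
  of \<rho> decreases the left side carries the factor \<lambda> (1 - b) / (1 + b), which exceeds 1
  and is driven to 1 by shrinking \<epsilon>. The rising ramp pays the full \<lambda>^p, which is
  harmless because the first limit hypothesis makes both ramps negligible against the middle part.
  Test functions depend on (1 - \<theta>) |x| instead of \<rho>, so their formula is free of
  \<epsilon>. Their supports lie in one compact shell on which the weights, given only on (0, R),
  are bounded. The volume density is at most 2^n for every \<epsilon>, and its limit is homogeneous
  of degree 0, so polar integration gives both sides the same constant. A strict inequality between
  the limit integrals then persists at some finite stage.\<close>

lemma indefinite_integral_ae_deriv:
  fixes D g :: "real \<Rightarrow> real"
  assumes D: "\<And>a b. a \<le> b \<Longrightarrow> (D has_integral g b - g a) {a..b}"
  obtains N where "negligible N" "\<And>x. x \<notin> N \<Longrightarrow> (g has_real_derivative D x) (at x)"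
proof -
  have int: "D integrable_on cbox a b" for a b :: real
    using D[of a b] by (cases "a \<le> b") (auto simp: integrable_on_def)
  \<comment> \<open>The differentiation theorem used below averages over boxes with lower corner
    \<open>x\<close>, hence yields right derivatives. Applied to the reflected function it yields
    the left ones.\<close>
  have int': "(\<lambda>x. D (- x)) integrable_on cbox a b" for a b :: real
    using integrable_reflect[of D "-a" "-b"] int by simp
  obtain N1 where N1: "negligible N1"
    "\<And>x e. \<lbrakk>x \<notin> N1; 0 < e\<rbrakk> \<Longrightarrow> \<exists>d>0. \<forall>h. 0 < h \<and> h < d \<longrightarrow>
        norm (integral (cbox x (x + h *\<^sub>R One)) D /\<^sub>R h ^ DIM(real) - D x) < e"
    using integrable_ccontinuous_explicit[OF int] by blast
  obtain N2 where N2: "negligible N2"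
    "\<And>x e. \<lbrakk>x \<notin> N2; 0 < e\<rbrakk> \<Longrightarrow> \<exists>d>0. \<forall>h. 0 < h \<and> h < d \<longrightarrow>
        norm (integral (cbox x (x + h *\<^sub>R One)) (\<lambda>x. D (- x)) /\<^sub>R h ^ DIM(real) - D (- x)) < e"
    using integrable_ccontinuous_explicit[OF int'] by blast
  have val: "integral {a..b} D = g b - g a" if "a \<le> b" for a b
    using D[OF that] by (rule integral_unique)
  have neg: "negligible (uminus ` N2)"
    proof (rule negligible_locally_Lipschitz_image[OF _ N2(1)])
    show "\<exists>T B. open T \<and> x \<in> T \<and> (\<forall>y\<in>N2 \<inter> T. norm (- y - - x) \<le> B * norm (y - x))" for x
      by (rule exI[of _ UNIV], rule exI[of _ 1]) (simp add: abs_minus_commute)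
  qed simp
  show ?thesis
  proof (rule that)
    show "negligible (N1 \<union> uminus ` N2)" using N1(1) neg by simp
    fix x assume x: "x \<notin> N1 \<union> uminus ` N2"
    then have x1: "x \<notin> N1" and x2: "- x \<notin> N2" by (auto simp: image_iff) 
    have "\<exists>s>0. \<forall>y. y \<noteq> x \<and> dist y x < s \<longrightarrow> dist ((g y - g x) / (y - x)) (D x) < e" if e: "e > 0" for e
    proof -
      obtain d1 where d1: "d1 > 0" "\<And>h. 0 < h \<Longrightarrow> h < d1 \<Longrightarrow> \<bar>(g (x + h) - g x) / h - D x\<bar> < e"
        using N1(2)[OF x1 e] val by (auto simp: divide_inverse mult.commute)
      have refl: "integral {- x..- x + h} (\<lambda>x. D (- x)) = g x - g (x - h)" if "h > 0" for h
        using Henstock_Kurzweil_Integration.integral_reflect_real[of x "x - h" D] val[of "x - h" x] that by simp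
      obtain d2 where d2: "d2 > 0" "\<And>h. 0 < h \<Longrightarrow> h < d2 \<Longrightarrow> \<bar>(g x - g (x - h)) / h - D x\<bar> < e"
        using N2(2)[OF x2 e] refl by (auto simp: divide_inverse mult.commute)
      have "\<bar>(g y - g x) / (y - x) - D x\<bar> < e" if y: "y \<noteq> x" "\<bar>y - x\<bar> < min d1 d2" for y
      proof (cases "y > x")
        case True then show ?thesis using d1(2)[of "y - x"] y by auto
      next
        case False
        then have "(g x - g (x - (x - y))) / (x - y) = (g y - g x) / (y - x)"
          using y by (simp add: field_simps)
        then show ?thesis using d2(2)[of "x - y"] y False by auto
      qed
      then show ?thesis using d1(1) d2(1)
        by (intro exI[of _ "min d1 d2"]) (auto simp: dist_real_def)
    qed
    then show "(g has_real_derivative D x) (at x)"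
      unfolding has_field_derivative_iff LIM_def by blast
  qed
qed

text \<open>\<open>D\<close> is the Radon-Nikodym density of the image of Lebesgue measure under the inverse of \<open>g\<close>.\<close>

lemma bilipschitz_real_ae_deriv:
  fixes g :: "real \<Rightarrow> real"
  assumes lower: "\<And>x y. x \<le> y \<Longrightarrow> y - x \<le> g y - g x"
    and upper: "\<And>x y. x \<le> y \<Longrightarrow> g y - g x \<le> C * (y - x)"
  obtains D where "D \<in> borel_measurable borel" "\<And>x. 0 \<le> D x"
    "\<And>a b. a \<le> b \<Longrightarrow> (D has_integral g b - g a) {a..b}"
proof -
  have lip: "\<bar>g y - g x\<bar> \<le> C * \<bar>y - x\<bar>" for x y
    using lower[of x y] upper[of x y] lower[of y x] upper[of y x] by (cases "x \<le> y") auto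
  have "0 \<le> C" using lower[of 0 1] upper[of 0 1] by simp
  then have Clip: "C-lipschitz_on UNIV g"
    using lip by (intro lipschitz_onI) (auto simp: dist_real_def)
  have cont: "continuous_on A g" for A
    using lipschitz_on_continuous_on[OF Clip] continuous_on_subset by blast
  have mono: "strict_mono g"
  proof (rule strict_monoI)
    fix x y :: real assume "x < y" then show "g x < g y" using lower[of x y] by simp
  qed
  then have inj: "inj g" by (rule strict_mono_imp_inj_on)
  have surj: "surj g"
    unfolding surj_def
  proof
    fix z :: real
    define M where "M = \<bar>z - g 0\<bar>"
    have "g (- M) \<le> z" "z \<le> g M" using lower[of 0 M] lower[of "- M" 0] by (auto simp: M_def)
    then show "\<exists>x. z = g x" using IVT'[of g "-M" z M] cont by (force simp: M_def)
  qed
  define h where "h = inv g"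
  have gh: "g (h z) = z" for z using surj by (simp add: h_def surj_f_inv_f)
  have hg: "h (g z) = z" for z using inj by (simp add: h_def)
  have vim: "h -` A = g ` A" for A
    using gh hg by (metis (no_types, opaque_lifting) h_def inj inj_imp_bij_betw_inv surj bij_vimage_eq_inv_image bij_def inv_inv_eq)
  have "\<bar>h x - h y\<bar> \<le> \<bar>x - y\<bar>" for x y
    using lower[of "h x" "h y"] lower[of "h y" "h x"] gh by (cases "h x \<le> h y") auto
  then have "1-lipschitz_on UNIV h" by (intro lipschitz_onI) (auto simp: dist_real_def)
  then have "continuous_on UNIV h" by (rule lipschitz_on_continuous_on)
  then have hm: "h \<in> borel_measurable borel" by (rule borel_measurable_continuous_onI)
  \<comment> \<open>Since \<open>h -\<close> A = g \<open>A\<close>, this measure gives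
    \<open>A\<close> the length of its image under \<open>g\<close>. The upper bound on increments
    makes \<open>g\<close> map null sets to null sets, hence absolute continuity.\<close>
  define \<nu> where "\<nu> = distr lborel borel h"
  have sets: "sets \<nu> = sets lborel" by (simp add: \<nu>_def)
  have \<nu>A: "emeasure \<nu> A = emeasure lborel (h -` A)" if "A \<in> sets borel" for A
    using that hm by (simp add: \<nu>_def emeasure_distr)
  have ac: "absolutely_continuous lborel \<nu>"
    unfolding absolutely_continuous_def
  proof
    fix A assume A: "A \<in> null_sets (lborel :: real measure)"
    then have Ab: "A \<in> sets borel" by auto
    have "negligible A" using A by (simp add: negligible_iff_null_sets null_sets_completionI)
    then have "negligible (g ` A)"
      by (intro negligible_locally_Lipschitz_image) (use lip in \<open>auto intro!: exI[of _ UNIV] exI[of _ C]\<close>)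
    then have "h -` A \<in> null_sets lebesgue" by (simp add: negligible_iff_null_sets vim)
    moreover have "h -` A \<in> sets lborel" using measurable_sets_borel[OF hm Ab] by simp
    ultimately have "h -` A \<in> null_sets lborel" by (simp add: null_sets_completion_iff)
    then show "A \<in> null_sets \<nu>" using \<nu>A[OF Ab] Ab by (simp add: null_sets_def sets)
  qed
  obtain D0 where D0: "D0 \<in> borel_measurable lborel" "density lborel D0 = \<nu>"
    using sigma_finite_measure.Radon_Nikodym[OF _ ac sets] sigma_finite_lborel by blast
  have D0m: "D0 \<in> borel_measurable borel" using D0(1) by simp
  have I0: "(\<integral>\<^sup>+x. D0 x * indicator {a..b} x \<partial>lborel) = ennreal (g b - g a)" if ab: "a \<le> b" for a b
  proof -
    have "g ` {a..b} = {g a..g b}"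
    proof safe
      fix x assume "x \<in> {g a..g b}"
      then show "x \<in> g ` {a..b}" using IVT'[of g a x b] cont ab by force
    qed (use strict_mono_less_eq[OF mono] in auto)
    moreover have "g a \<le> g b" using lower[of a b] ab by simp
    ultimately have "emeasure \<nu> {a..b} = ennreal (g b - g a)"
      by (subst \<nu>A) (auto simp: vim)
    moreover have "emeasure (density lborel D0) {a..b} = (\<integral>\<^sup>+x. D0 x * indicator {a..b} x \<partial>lborel)"
      using D0(1) by (rule emeasure_density) simp
    ultimately show ?thesis by (simp add: D0(2))
  qed
  \<comment> \<open>Finiteness almost everywhere comes from the finite mass of each bounded
    interval. It matters because \<open>enn2real\<close> sends infinity to 0.\<close>
  have "AE x in lborel. D0 x * indicator {- real n..real n} x \<noteq> \<infinity>" for n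
    by (rule nn_integral_PInf_AE) (use D0m I0[of "- real n" "real n"] in auto)
  then have "AE x in lborel. \<forall>n. D0 x * indicator {- real n..real n} x \<noteq> \<infinity>"
    by (simp add: AE_all_countable)
  then have fin: "AE x in lborel. D0 x \<noteq> \<infinity>"
  proof (rule AE_mp, intro AE_I2 impI)
    fix x assume *: "\<forall>n. D0 x * indicator {- real n..real n} x \<noteq> \<infinity>"
    obtain n where "\<bar>x\<bar> \<le> real n" using real_arch_simple by blast
    then have "x \<in> {- real n..real n}" by auto
    then show "D0 x \<noteq> \<infinity>" using *[rule_format, of n] by simp
  qed
  define D where "D x = enn2real (D0 x)" for x
  have Dm: "D \<in> borel_measurable borel" using D0m unfolding D_def by measurable
  have D0pos: "0 \<le> D x" for x by (simp add: D_def)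
  show ?thesis
  proof (rule that[OF Dm D0pos])
    fix a b :: real assume ab: "a \<le> b"
    have "(\<integral>\<^sup>+x. ennreal (D x * indicator {a..b} x) \<partial>lborel) = (\<integral>\<^sup>+x. D0 x * indicator {a..b} x \<partial>lborel)"
      by (rule nn_integral_cong_AE, use fin in eventually_elim)
         (auto simp: D_def indicator_def less_top[symmetric])
    moreover have "(\<lambda>x. D x * indicator {a..b} x) \<in> borel_measurable borel"
      using Dm by measurable
    ultimately have "((\<lambda>x. D x * indicator {a..b} x) has_integral g b - g a) UNIV"
      using I0[OF ab] lower[OF ab] ab D0pos
      by (intro nn_integral_has_integral) auto
    then have "((\<lambda>x. if x \<in> {a..b} then D x else 0) has_integral g b - g a) UNIV"
      by (rule has_integral_eq[rotated]) auto
    then show "(D has_integral g b - g a) {a..b}"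
      by (simp only: has_integral_restrict_UNIV)
  qed
qed

text \<open>Adding \<open>(K + 1) * t\<close> raises all difference quotients into
  \<open>[1, 2 * K + 1]\<close>, where the bilipschitz case applies; the linear term is subtracted
  again at the end. Absolute integrability is inherited from the nonnegative density of the shifted
  function.\<close>

lemma lipschitz_real_ae_deriv:
  fixes f :: "real \<Rightarrow> real"
  assumes "K-lipschitz_on UNIV f"
  obtains D N where "D \<in> borel_measurable borel" "negligible N"
    "\<And>x. x \<notin> N \<Longrightarrow> (f has_real_derivative D x) (at x)"
    "\<And>a b. D absolutely_integrable_on {a..b}"
    "\<And>a b. a \<le> b \<Longrightarrow> (D has_integral f b - f a) {a..b}"
proof -
  have K: "\<bar>f x - f y\<bar> \<le> K * \<bar>x - y\<bar>" for x y
    using lipschitz_onD[OF assms, of x y] by (simp add: dist_real_def)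
  define g where "g t = f t + (K + 1) * t" for t
  have "y - x \<le> g y - g x" "g y - g x \<le> (2 * K + 1) * (y - x)" if "x \<le> y" for x y
    using K[of y x] that by (auto simp: g_def algebra_simps)
  then obtain D where D: "D \<in> borel_measurable borel" "\<And>x. 0 \<le> D x"
      "\<And>a b. a \<le> b \<Longrightarrow> (D has_integral g b - g a) {a..b}"
    using bilipschitz_real_ae_deriv[of g "2 * K + 1"] by blast
  obtain N where N: "negligible N" "\<And>x. x \<notin> N \<Longrightarrow> (g has_real_derivative D x) (at x)"
    using indefinite_integral_ae_deriv[OF D(3)] by blast
  have f: "f = (\<lambda>t. g t - (K + 1) * t)" by (auto simp: g_def)
  show ?thesis
  proof (rule that[of "\<lambda>x. D x - (K + 1)" N])
    show "(\<lambda>x. D x - (K + 1)) \<in> borel_measurable borel" using D(1) by measurable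
    show "(f has_real_derivative D x - (K + 1)) (at x)" if "x \<notin> N" for x
      unfolding f by (auto intro!: derivative_eq_intros N(2) that)
    have "D integrable_on {a..b}" for a b
      using D(3)[of a b] by (cases "a \<le> b") (auto simp: integrable_on_def)
    then have "D absolutely_integrable_on {a..b}" for a b
      using D(2) by (intro nonnegative_absolutely_integrable_1) auto
    then show "(\<lambda>x. D x - (K + 1)) absolutely_integrable_on {a..b}" for a b
      by (intro set_integral_diff) (auto intro: absolutely_integrable_on_const)
    fix a b :: real assume "a \<le> b"
    then show "((\<lambda>x. D x - (K + 1)) has_integral f b - f a) {a..b}"
      using has_integral_diff[OF D(3)[of a b] has_integral_const_real[of "K + 1" a b]]
      by (simp add: g_def algebra_simps)
  qed (rule N(1))
qed

section \<open>The distance from the origin\<close>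

lemma theta_bounds:
  assumes "lam > 1" shows "0 < theta lam" "theta lam < 1"
  using assms by (auto simp: theta_def)

definition radial_dist :: "real \<Rightarrow> real \<Rightarrow> real \<Rightarrow> real" where
  "radial_dist lam \<epsilon> r = r - theta lam * r\<^sup>2 / (r + \<epsilon>)"

text \<open>This is \<theta> h'(r). As \<open>r * (r + 2 * \<epsilon>) = (r + \<epsilon>)\<^sup>2 -
  \<epsilon>\<^sup>2\<close>, it lies below \<theta>, and it tends to \<theta> as \<epsilon> tends
  to 0 at fixed r > 0.\<close>

definition drift :: "real \<Rightarrow> real \<Rightarrow> real \<Rightarrow> real" where
  "drift lam \<epsilon> r = theta lam * r * (r + 2 * \<epsilon>) / (r + \<epsilon>)\<^sup>2"

lemma drift_bounds:
  assumes "lam > 1" "\<epsilon> > 0" "r \<ge> 0"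
  shows "0 \<le> drift lam \<epsilon> r" "drift lam \<epsilon> r \<le> theta lam"
proof -
  have "r * (r + 2 * \<epsilon>) \<le> (r + \<epsilon>)\<^sup>2" by (simp add: power2_eq_square algebra_simps)
  moreover have "0 < (r + \<epsilon>)\<^sup>2" using assms by simp
  ultimately have "r * (r + 2 * \<epsilon>) / (r + \<epsilon>)\<^sup>2 \<le> 1" by (simp add: divide_le_eq_1)
  moreover have "drift lam \<epsilon> r = theta lam * (r * (r + 2 * \<epsilon>) / (r + \<epsilon>)\<^sup>2)" by (simp add: drift_def)
  ultimately show "drift lam \<epsilon> r \<le> theta lam"
    using theta_bounds[OF assms(1)] by (simp only: mult_left_le less_imp_le)
  show "0 \<le> drift lam \<epsilon> r"
    using theta_bounds[OF assms(1)] assms by (simp add: drift_def)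
qed

text \<open>Writing \<open>r\<^sup>2 / (r + \<epsilon>) = r - \<epsilon> + \<epsilon>\<^sup>2 / (r +
  \<epsilon>)\<close> gives an exact difference quotient. Its value lies in [0, 1], which is the
  Lipschitz bound that follows.\<close>

lemma radial_dist_diff:
  assumes "\<epsilon> > 0" "a \<ge> 0" "b \<ge> 0"
  shows "radial_dist lam \<epsilon> a - radial_dist lam \<epsilon> b
    = (a - b) * (1 - theta lam * (1 - \<epsilon>\<^sup>2 / ((a + \<epsilon>) * (b + \<epsilon>))))"
proof -
  have "r\<^sup>2 / (r + \<epsilon>) = r - \<epsilon> + \<epsilon>\<^sup>2 / (r + \<epsilon>)" if "r \<ge> 0" for r
    using that assms(1) by (simp add: field_simps power2_eq_square)
  then have *: "radial_dist lam \<epsilon> r = r - theta lam * (r - \<epsilon> + \<epsilon>\<^sup>2 / (r + \<epsilon>))" if "r \<ge> 0" for r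
    using that by (simp add: radial_dist_def flip: times_divide_eq_right)
  have "\<epsilon>\<^sup>2 / (a + \<epsilon>) - \<epsilon>\<^sup>2 / (b + \<epsilon>) = - (a - b) * (\<epsilon>\<^sup>2 / ((a + \<epsilon>) * (b + \<epsilon>)))"
    using assms by (simp add: field_simps)
  then have "a - b - theta lam * (a - b + (\<epsilon>\<^sup>2 / (a + \<epsilon>) - \<epsilon>\<^sup>2 / (b + \<epsilon>)))
      = (a - b) * (1 - theta lam * (1 - \<epsilon>\<^sup>2 / ((a + \<epsilon>) * (b + \<epsilon>))))"
    by (simp only:) (simp only: ring_distribs mult_1_right minus_mult_left[symmetric] minus_mult_right[symmetric] ac_simps diff_conv_add_uminus minus_add_distrib minus_minus)
  then show ?thesis using assms by (simp only: *) (simp add: algebra_simps)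
qed

lemma radial_dist_lipschitz:
  assumes "lam > 1" "\<epsilon> > 0" "a \<ge> 0" "b \<ge> 0"
  shows "\<bar>radial_dist lam \<epsilon> a - radial_dist lam \<epsilon> b\<bar> \<le> \<bar>a - b\<bar>"
proof -
  have "\<epsilon>\<^sup>2 \<le> (a + \<epsilon>) * (b + \<epsilon>)" using assms by (simp add: power2_eq_square algebra_simps)
  moreover have "0 < (a + \<epsilon>) * (b + \<epsilon>)" using assms by simp
  ultimately have "\<epsilon>\<^sup>2 / ((a + \<epsilon>) * (b + \<epsilon>)) \<le> 1" by (simp add: divide_le_eq_1)
  moreover have "0 \<le> \<epsilon>\<^sup>2 / ((a + \<epsilon>) * (b + \<epsilon>))" using assms by simp
  ultimately have "0 \<le> theta lam * (1 - \<epsilon>\<^sup>2 / ((a + \<epsilon>) * (b + \<epsilon>)))"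
      "theta lam * (1 - \<epsilon>\<^sup>2 / ((a + \<epsilon>) * (b + \<epsilon>))) \<le> 1"
    using theta_bounds[OF assms(1)] by (auto intro!: mult_le_one)
  then have "\<bar>1 - theta lam * (1 - \<epsilon>\<^sup>2 / ((a + \<epsilon>) * (b + \<epsilon>)))\<bar> \<le> 1" by linarith
  then show ?thesis
    using radial_dist_diff[of \<epsilon> a b lam] assms by (simp add: abs_mult mult_left_le)
qed

lemma radial_dist_deriv:
  assumes "\<epsilon> > 0" "r \<ge> 0"
  shows "(radial_dist lam \<epsilon> has_real_derivative 1 - drift lam \<epsilon> r) (at r)"
proof -
  have "r + \<epsilon> \<noteq> 0" using assms by linarith
  then show ?thesis
    unfolding radial_dist_def drift_def
    by (auto intro!: derivative_eq_intros simp: field_simps power2_eq_square)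
qed

lemma Feps_eq_drift:
  assumes "x \<noteq> 0"
  shows "Feps lam \<epsilon> x y = norm y - drift lam \<epsilon> (norm x) * (inner x y / norm x)"
  using assms by (simp add: Feps_def drift_def)

lemma Feps_bounds:
  assumes "lam > 1" "\<epsilon> > 0"
  shows "0 \<le> Feps lam \<epsilon> x y" "Feps lam \<epsilon> x y \<le> 2 * norm y" "(1 - theta lam) * norm y \<le> Feps lam \<epsilon> x y"
proof -
  have "\<bar>Feps lam \<epsilon> x y - norm y\<bar> \<le> theta lam * norm y"
  proof (cases "x = 0")
    case False
    have "\<bar>inner x y / norm x\<bar> \<le> norm y"
      using Cauchy_Schwarz_ineq2[of x y] False by (simp add: divide_le_eq mult.commute)
    then have "drift lam \<epsilon> (norm x) * \<bar>inner x y / norm x\<bar> \<le> theta lam * norm y"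
      using drift_bounds[OF assms, of "norm x"] theta_bounds[OF assms(1)] by (intro mult_mono) auto
    then show ?thesis
      using False drift_bounds(1)[OF assms, of "norm x"] by (simp add: Feps_eq_drift abs_mult)
  qed (use theta_bounds[OF assms(1)] in \<open>simp add: Feps_def\<close>)
  moreover have "theta lam * norm y \<le> norm y"
    using theta_bounds[OF assms(1)] by (simp add: mult_left_le_one_le)
  ultimately show "0 \<le> Feps lam \<epsilon> x y" "Feps lam \<epsilon> x y \<le> 2 * norm y"
    "(1 - theta lam) * norm y \<le> Feps lam \<epsilon> x y" by (auto simp: algebra_simps)
qed

text \<open>With s = <x,y>/|x| the two sides are (1 - b) s and |y| - b s. The drift contributes -b s
  to both, so Cauchy-Schwarz, s <= |y|, suffices. Integrated along a curve this is the lower bound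
  for the distance.\<close>

lemma radial_dist_rate_le_Feps:
  assumes lam: "lam > 1" and \<epsilon>: "\<epsilon> > 0"
    and e: "(e has_vector_derivative y) (at t)"
    and S: "((\<lambda>t. radial_dist lam \<epsilon> (norm (e t))) has_real_derivative D) (at t)"
  shows "D \<le> Feps lam \<epsilon> (e t) y"
proof (cases "e t = 0")
  \<comment> \<open>The norm is not differentiable at the origin, but the composite has a minimum
    there, so a derivative that exists must vanish.\<close>
  case True
  have "radial_dist lam \<epsilon> 0 \<le> radial_dist lam \<epsilon> (norm z)" for z :: 'a
    using drift_bounds[OF lam \<epsilon>] theta_bounds[OF lam] \<epsilon>
      DERIV_nonneg_imp_nondecreasing[of 0 "norm z" "radial_dist lam \<epsilon>"] radial_dist_deriv[OF \<epsilon>]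
    by (metis diff_ge_0_iff_ge norm_ge_zero order.trans less_imp_le)
  then have "D = 0" using DERIV_local_min[OF S, of 1] True by simp
  then show ?thesis using Feps_bounds(1)[OF lam \<epsilon>] by simp
next
  case False
  let ?b = "drift lam \<epsilon> (norm (e t))"
  have "((\<lambda>t. norm (e t)) has_real_derivative inner (e t) y / norm (e t)) (at t)"
    using vector_derivative_diff_chain_within[OF e has_derivative_at_withinI[OF has_derivative_norm[OF False]]]
    by (simp add: has_real_derivative_iff_has_vector_derivative o_def sgn_div_norm inner_commute divide_inverse mult.commute)
  from DERIV_chain2[OF radial_dist_deriv[OF \<epsilon> norm_ge_zero] this]
  have "D = (1 - ?b) * (inner (e t) y / norm (e t))"
    using DERIV_unique[OF S] by blast
  moreover have "inner (e t) y / norm (e t) \<le> norm y"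
    using Cauchy_Schwarz_ineq2[of "e t" y] False by (simp add: divide_le_eq mult.commute)
  ultimately have "D \<le> norm y - ?b * (inner (e t) y / norm (e t))" by (simp only: left_diff_distrib)
  then show ?thesis using False by (simp add: Feps_eq_drift)
qed

text \<open>
  The integrand must be shown integrable, since \<^const>\<open>integral\<close> is 0 otherwise, and the vector
  derivative is an arbitrary vector where the curve is not differentiable.
\<close>

lemma lipschitz_curve_length_ge:
  fixes c :: "real \<Rightarrow> 'a::euclidean_space"
  assumes lam: "lam > 1" and \<epsilon>: "\<epsilon> > 0"
    and c0: "c 0 = 0" and lip: "K-lipschitz_on {0..1} c"
  shows "radial_dist lam \<epsilon> (norm (c 1))
    \<le> integral {0..1} (\<lambda>t. Feps lam \<epsilon> (c t) (vector_derivative c (at t)))"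
proof -
  \<comment> \<open>The constant extension is Lipschitz on the whole line and agrees with
    \<open>c\<close> on the interval.\<close>
  define e where "e t = c (max 0 (min 1 t))" for t
  have K0: "0 \<le> K" using lip by (rule lipschitz_on_nonneg)
  have elip: "K-lipschitz_on UNIV e"
  proof (rule lipschitz_onI[OF _ K0])
    fix s t :: real
    have "dist (e s) (e t) \<le> K * dist (max 0 (min 1 s)) (max 0 (min 1 t))"
      unfolding e_def by (rule lipschitz_onD[OF lip]) auto
    also have "\<dots> \<le> K * dist s t" by (rule mult_left_mono[OF _ K0]) (auto simp: dist_real_def)
    finally show "dist (e s) (e t) \<le> K * dist s t" .
  qed
  have econt: "continuous_on UNIV e" using elip by (rule lipschitz_on_continuous_on)
  have "K-lipschitz_on UNIV (\<lambda>t. inner (e t) i)" if "i \<in> Basis" for i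
  proof (rule lipschitz_onI[OF _ K0])
    fix s t
    have "dist (inner (e s) i) (inner (e t) i) \<le> norm (e s - e t)"
      using Basis_le_norm[OF that, of "e s - e t"] by (simp add: dist_real_def inner_diff_left)
    then show "dist (inner (e s) i) (inner (e t) i) \<le> K * dist s t"
      using lipschitz_onD[OF elip, of s t] by (simp add: dist_norm)
  qed
  then have "\<forall>i\<in>Basis. \<exists>D N. D \<in> borel_measurable borel \<and> negligible N
      \<and> (\<forall>x. x \<notin> N \<longrightarrow> ((\<lambda>t. inner (e t) i) has_real_derivative D x) (at x))
      \<and> (\<forall>a b. D absolutely_integrable_on {a..b})"
    using lipschitz_real_ae_deriv by metis
  then obtain D N where D: "\<And>i. i \<in> Basis \<Longrightarrow> D i \<in> borel_measurable borel"
    and N: "\<And>i. i \<in> Basis \<Longrightarrow> negligible (N i)"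
    and deriv: "\<And>i x. i \<in> Basis \<Longrightarrow> x \<notin> N i \<Longrightarrow> ((\<lambda>t. inner (e t) i) has_real_derivative D i x) (at x)"
    and abs_int: "\<And>i a b. i \<in> Basis \<Longrightarrow> D i absolutely_integrable_on {a..b}"
    by metis
  \<comment> \<open>A Borel function on the whole line, equal to the velocity off the sets
    \<open>N i\<close>; it makes the integrand \<open>q\<close> measurable.\<close>
  define d where "d t = (\<Sum>i\<in>Basis. D i t *\<^sub>R i)" for t
  have dm: "d \<in> borel_measurable borel" unfolding d_def using D by measurable
  have ed: "(e has_vector_derivative d t) (at t)" if "t \<notin> (\<Union>i\<in>Basis. N i)" for t
  proof -
    have "((\<lambda>t. \<Sum>i\<in>Basis. inner (e t) i *\<^sub>R i) has_vector_derivative d t) (at t)"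
      unfolding d_def using that
      by (auto intro!: derivative_eq_intros deriv)
    then show ?thesis by (simp add: euclidean_representation)
  qed
  define S where "S t = radial_dist lam \<epsilon> (norm (e t))" for t
  have "K-lipschitz_on UNIV S"
  proof (rule lipschitz_onI[OF _ K0])
    fix s t
    have "dist (S s) (S t) \<le> \<bar>norm (e s) - norm (e t)\<bar>"
      unfolding S_def dist_real_def by (rule radial_dist_lipschitz[OF lam \<epsilon>]) auto
    also have "\<dots> \<le> norm (e s - e t)" by (rule norm_triangle_ineq3)
    finally show "dist (S s) (S t) \<le> K * dist s t"
      using lipschitz_onD[OF elip, of s t] by (simp add: dist_norm)
  qed
  then obtain DS NS where DS: "negligible NS" "\<And>t. t \<notin> NS \<Longrightarrow> (S has_real_derivative DS t) (at t)"
      "\<And>a b. a \<le> b \<Longrightarrow> (DS has_integral S b - S a) {a..b}"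
    using lipschitz_real_ae_deriv by metis
  \<comment> \<open>The endpoints are discarded as well: the two-sided derivative of
    \<open>c\<close> there depends on values of \<open>c\<close> outside the interval.\<close>
  define Z where "Z = (\<Union>i\<in>Basis. N i) \<union> NS \<union> {0, 1}"
  have Z: "negligible Z" unfolding Z_def using N DS(1) by (auto )
  define q where "q t = Feps lam \<epsilon> (e t) (d t)" for t
  have em: "e \<in> borel_measurable borel" using econt by (rule borel_measurable_continuous_onI)
  have "q \<in> borel_measurable borel" unfolding q_def Feps_def using em dm by measurable
  then have qm: "q \<in> borel_measurable (lebesgue_on {0..1})"
    by (intro measurable_restrict_space1 measurable_completion) simp
  have Dint: "(\<lambda>t. 2 * (\<Sum>i\<in>Basis. \<bar>D i t\<bar>)) integrable_on {0..1}"
    using abs_int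
    by (intro integrable_on_mult_right integrable_sum) (auto simp: absolutely_integrable_on_def)
  have qb: "norm (q t) \<le> 2 * (\<Sum>i\<in>Basis. \<bar>D i t\<bar>)" for t
  proof -
    have "norm (d t) \<le> (\<Sum>i\<in>Basis. \<bar>D i t\<bar>)"
      unfolding d_def by (rule sum_norm_le) simp
    then show ?thesis
      unfolding q_def using Feps_bounds[OF lam \<epsilon>, of "e t" "d t"] by simp
  qed
  have "q absolutely_integrable_on {0..1}"
    by (rule measurable_bounded_by_integrable_imp_absolutely_integrable[OF qm _ Dint qb]) simp
  then have qi: "q integrable_on {0..1}" by (rule set_lebesgue_integral_eq_integral)
  \<comment> \<open>The comparison of integrals asks for the inequality at every point, so the
    integrand is replaced by \<open>DS\<close> on the null set.\<close>
  define q' where "q' t = (if t \<in> Z then DS t else q t)" for t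
  have q'i: "q' integrable_on {0..1}" by (rule integrable_spike[OF qi Z]) (auto simp: q'_def)
  have "integral {0..1} DS \<le> integral {0..1} q'"
  proof (rule integral_le[OF _ q'i])
    show "DS integrable_on {0..1}" using DS(3)[of 0 1] by (auto simp: integrable_on_def)
    show "DS t \<le> q' t" for t
      using radial_dist_rate_le_Feps[OF lam \<epsilon> ed] DS(2)[of t]
      unfolding S_def[abs_def] by (auto simp: q'_def q_def Z_def)
  qed
  moreover have "integral {0..1} DS = radial_dist lam \<epsilon> (norm (c 1))"
    using integral_unique[OF DS(3)[of 0 1]] c0 by (simp add: S_def e_def radial_dist_def)
  moreover have "integral {0..1} q' = integral {0..1} (\<lambda>t. Feps lam \<epsilon> (c t) (vector_derivative c (at t)))"
  proof (rule integral_spike[OF Z])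
    fix t :: real assume t: "t \<in> {0..1} - Z"
    then have "t \<in> {0<..<1}" by (auto simp: Z_def)
    then have "(c has_vector_derivative d t) (at t)"
      using t by (intro has_vector_derivative_transform_within_open[OF ed, where S = "{0<..<1}"])
        (auto simp: Z_def e_def)
    moreover have "e t = c t" using t by (auto simp: e_def)
    ultimately show "Feps lam \<epsilon> (c t) (vector_derivative c (at t)) = q' t"
      using t by (simp add: q'_def q_def vector_derivative_at)
  qed
  ultimately show ?thesis by simp
qed

lemma segment_length:
  fixes x :: "'a::euclidean_space"
  assumes \<epsilon>: "\<epsilon> > 0"
  shows "integral {0..1} (\<lambda>t. Feps lam \<epsilon> (t *\<^sub>R x) (vector_derivative (\<lambda>t. t *\<^sub>R x) (at t)))
    = radial_dist lam \<epsilon> (norm x)"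
proof (rule integral_unique)
  have vd: "vector_derivative (\<lambda>t. t *\<^sub>R x) (at t) = x" for t
    by (rule vector_derivative_at) (auto intro!: derivative_eq_intros)
  have "((\<lambda>t. Feps lam \<epsilon> (t *\<^sub>R x) x) has_integral radial_dist lam \<epsilon> (1 * norm x) - radial_dist lam \<epsilon> (0 * norm x)) {0..1}"
  proof (rule fundamental_theorem_of_calculus)
    fix t :: real assume t: "t \<in> {0..1}"
    have "((\<lambda>t. radial_dist lam \<epsilon> (t * norm x)) has_real_derivative (1 - drift lam \<epsilon> (t * norm x)) * norm x) (at t)"
      using t by (intro DERIV_chain2[OF radial_dist_deriv[OF \<epsilon>]]) (auto intro!: derivative_eq_intros)
    moreover have "(1 - drift lam \<epsilon> (t * norm x)) * norm x = Feps lam \<epsilon> (t *\<^sub>R x) x"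
      using t by (simp add: drift_def Feps_def power2_norm_eq_inner[symmetric] algebra_simps power2_eq_square)
    ultimately show "((\<lambda>t. radial_dist lam \<epsilon> (t * norm x)) has_vector_derivative Feps lam \<epsilon> (t *\<^sub>R x) x) (at t within {0..1})"
      by (simp add: has_real_derivative_iff_has_vector_derivative has_vector_derivative_at_within)
  qed simp
  then show "((\<lambda>t. Feps lam \<epsilon> (t *\<^sub>R x) (vector_derivative (\<lambda>t. t *\<^sub>R x) (at t))) has_integral
      radial_dist lam \<epsilon> (norm x)) {0..1}"
    by (simp add: vd radial_dist_def)
qed

lemma rho_eps_eq:
  fixes x :: "'a::euclidean_space"
  assumes lam: "lam > 1" and \<epsilon>: "\<epsilon> > 0"
  shows "rho_eps lam \<epsilon> x = radial_dist lam \<epsilon> (norm x)"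
  unfolding rho_eps_def finsler_dist_def
proof (rule cInf_eq_minimum)
  have "(norm x)-lipschitz_on {0..1} (\<lambda>t. t *\<^sub>R x)"
    by (rule lipschitz_onI) (auto simp: dist_norm scaleR_diff_left[symmetric] mult.commute)
  then show "radial_dist lam \<epsilon> (norm x) \<in> {integral {0..1} (\<lambda>t. Feps lam \<epsilon> (c t) (vector_derivative c (at t))) |c.
      c 0 = 0 \<and> c 1 = x \<and> (\<exists>K. K-lipschitz_on {0..1} c)}"
    using segment_length[OF \<epsilon>, of lam x, symmetric] by (auto intro!: exI[of _ "\<lambda>t. t *\<^sub>R x"])
qed (use lipschitz_curve_length_ge[OF lam \<epsilon>] in blast)

section \<open>The Busemann--Hausdorff density\<close>

definition randers_ball :: "'a::euclidean_space \<Rightarrow> 'a set" where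
  "randers_ball B = {y. norm y - inner B y < 1}"

text \<open>The vector B with \<open>Feps lam \<epsilon> x y = norm y - inner B y\<close>. Nothing
  is divided by \<open>norm x\<close>, so it is continuous at the origin too.\<close>

definition drift_vec :: "real \<Rightarrow> real \<Rightarrow> 'a::euclidean_space \<Rightarrow> 'a" where
  "drift_vec lam \<epsilon> x = (theta lam * (norm x + 2 * \<epsilon>) / (norm x + \<epsilon>)\<^sup>2) *\<^sub>R x"

lemma BH_density_eq:
  "BH_density (Feps lam \<epsilon>) (x::'a::euclidean_space)
    = measure lebesgue (ball (0::'a) 1) / measure lebesgue (randers_ball (drift_vec lam \<epsilon> x))"
  by (simp add: BH_density_def randers_ball_def drift_vec_def Feps_def mult_ac)

lemma norm_drift_vec:
  assumes "\<epsilon> > 0"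
  shows "norm (drift_vec lam \<epsilon> x) = \<bar>drift lam \<epsilon> (norm x)\<bar>"
  using assms by (simp add: drift_vec_def drift_def abs_mult)

lemma randers_norm_ge:
  "(1 - norm B) * norm y \<le> norm y - inner B y"
  using Cauchy_Schwarz_ineq2[of B y] by (simp add: algebra_simps)

lemma open_randers_ball: "open (randers_ball B)"
  unfolding randers_ball_def by (intro open_Collect_less continuous_intros)

lemma bounded_randers_ball:
  assumes "norm B < 1"
  shows "bounded (randers_ball B)"
proof -
  have "norm y \<le> 1 / (1 - norm B)" if "y \<in> randers_ball B" for y
    using randers_norm_ge[of B y] that assms
    by (simp add: randers_ball_def le_divide_eq mult.commute)
  then show ?thesis unfolding bounded_iff by blast
qed

lemma lmeasurable_randers_ball: "norm B < 1 \<Longrightarrow> randers_ball B \<in> lmeasurable"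
  by (intro lmeasurable_open bounded_randers_ball open_randers_ball)

lemma ball_subset_randers_ball:
  assumes "norm B < 1"
  shows "ball 0 (1 / 2) \<subseteq> randers_ball B"
proof
  fix y :: 'a assume y: "y \<in> ball 0 (1 / 2)"
  have "norm y - inner B y \<le> norm y + norm B * norm y"
    using Cauchy_Schwarz_ineq2[of B y] by simp
  also have "\<dots> \<le> 2 * norm y" using assms by (simp add: mult_left_le_one_le)
  also have "\<dots> < 1" using y by simp
  finally show "y \<in> randers_ball B" by (simp add: randers_ball_def)
qed

lemma measure_lebesgue_scaleR_image:
  "measure lebesgue ((*\<^sub>R) r ` S) = \<bar>r\<bar> ^ DIM('a) * measure lebesgue (S :: 'a::euclidean_space set)"
  using measure_lebesgue_affine[of r 0 S] by simp

text \<open>\<open>norm y - inner B y <= 2 * norm y\<close> puts the ball of radius 1/2 inside. The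
  bound is independent of \<open>B\<close>, which gives the density the upper bound
  \<open>2 ^ DIM('a)\<close> uniformly in \<epsilon>, as dominated convergence requires.\<close>

lemma measure_randers_ball_ge:
  assumes "norm (B::'a::euclidean_space) < 1"
  shows "measure lebesgue (ball (0::'a) 1) / 2 ^ DIM('a) \<le> measure lebesgue (randers_ball B)"
proof -
  have "(*\<^sub>R) (1/2) ` ball (0::'a) 1 = ball 0 (1/2)" using ball_scale[of "1/2" "0::'a" 1] by simp
  then have "measure lebesgue (ball (0::'a) 1) / 2 ^ DIM('a) = measure lebesgue (ball (0::'a) (1/2))"
    using measure_lebesgue_scaleR_image[of "1/2" "ball (0::'a) 1"] by (simp add: power_one_over)
  also have "\<dots> \<le> measure lebesgue (randers_ball B)"
    using ball_subset_randers_ball[OF assms] lmeasurable_randers_ball[OF assms]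
    by (intro measure_mono_fmeasurable) auto
  finally show ?thesis .
qed

lemma measure_ball_pos: "0 < measure lebesgue (ball (0::'a::euclidean_space) 1)"
  by (simp add: content_ball_pos)

lemma measure_randers_ball_pos:
  assumes "norm (B::'a::euclidean_space) < 1"
  shows "0 < measure lebesgue (randers_ball B)"
  using measure_randers_ball_ge[OF assms] measure_ball_pos[where 'a='a]
  by (smt (verit) divide_pos_pos zero_less_power)

text \<open>The inequality between the norms places the unit ball of \<open>B\<close> in that of
  \<open>B'\<close> dilated by \<open>1 / r\<close>; dilation scales volume by the power
  \<open>DIM('a)\<close>.\<close>

lemma measure_randers_ball_le:
  fixes B B' :: "'a::euclidean_space"
  assumes "norm B' < 1" "r > 0"
    and "\<And>y. r * (norm y - inner B' y) \<le> norm y - inner B y"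
  shows "measure lebesgue (randers_ball B) * r ^ DIM('a) \<le> measure lebesgue (randers_ball B')"
proof -
  have sub: "randers_ball B \<subseteq> (*\<^sub>R) (1 / r) ` randers_ball B'"
  proof
    fix y assume "y \<in> randers_ball B"
    then have "r *\<^sub>R y \<in> randers_ball B'"
      using assms(2) assms(3)[of y] by (simp add: randers_ball_def algebra_simps)
    then show "y \<in> (*\<^sub>R) (1 / r) ` randers_ball B'"
      using assms(2) by (intro image_eqI[of _ _ "r *\<^sub>R y"]) auto
  qed
  have "randers_ball B \<in> sets lebesgue"
    by (simp add: open_randers_ball borel_open)
  then have "measure lebesgue (randers_ball B) \<le> measure lebesgue ((*\<^sub>R) (1 / r) ` randers_ball B')"
    using assms
    by (intro measure_mono_fmeasurable sub lmeasurable_open bounded_scaling open_scaling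
      bounded_randers_ball open_randers_ball) auto
  also have "\<dots> = measure lebesgue (randers_ball B') / r ^ DIM('a)"
    using assms(2) by (simp add: measure_lebesgue_scaleR_image power_one_over)
  finally show ?thesis using assms(2) by (simp add: le_divide_eq)
qed

text \<open>Moving the vector from \<open>B\<close> to \<open>f k\<close> changes the norm by a
  factor between \<open>1 - q k\<close> and \<open>1 + q k\<close>, where
  \<open>q k = norm (f k - B) / (1 - norm B)\<close>. The volumes are therefore squeezed between
  powers of these factors.\<close>

lemma tendsto_measure_randers_ball:
  fixes B :: "'a::euclidean_space"
  assumes B: "norm B < 1" and f: "(f \<longlongrightarrow> B) F"
  shows "((\<lambda>k. measure lebesgue (randers_ball (f k))) \<longlongrightarrow> measure lebesgue (randers_ball B)) F"
proof -
  let ?V = "\<lambda>B::'a. measure lebesgue (randers_ball B)"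
  define q where "q k = norm (f k - B) / (1 - norm B)" for k
  have "((\<lambda>k. norm (f k - B) / (1 - norm B)) \<longlongrightarrow> norm (B - B) / (1 - norm B)) F"
    using B by (intro tendsto_intros f) auto
  then have q0: "(q \<longlongrightarrow> 0) F" by (simp add: q_def[abs_def])
  have compare: "\<bar>(norm y - inner (f k) y) - (norm y - inner B y)\<bar> \<le> q k * (norm y - inner B y)" for k y
  proof -
    have "\<bar>(norm y - inner (f k) y) - (norm y - inner B y)\<bar> \<le> norm (f k - B) * norm y"
      using Cauchy_Schwarz_ineq2[of "f k - B" y] by (simp add: inner_diff_left abs_minus_commute)
    also have "\<dots> = q k * ((1 - norm B) * norm y)" using B by (simp add: q_def)
    also have "\<dots> \<le> q k * (norm y - inner B y)"
      using B randers_norm_ge[of B y] by (intro mult_left_mono) (auto simp: q_def)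
    finally show ?thesis .
  qed
  have nf: "\<forall>\<^sub>F k in F. norm (f k) < 1"
    using order_tendstoD(2)[OF tendsto_norm[OF f] B] .
  have q1: "\<forall>\<^sub>F k in F. q k < 1" using order_tendstoD(2)[OF q0, of 1] by simp
  have qpos: "0 \<le> q k" for k using B by (simp add: q_def)
  have lim: "((\<lambda>k. ?V B / (1 + q k) ^ DIM('a)) \<longlongrightarrow> ?V B / (1 + 0) ^ DIM('a)) F"
    "((\<lambda>k. ?V B / (1 - q k) ^ DIM('a)) \<longlongrightarrow> ?V B / (1 - 0) ^ DIM('a)) F"
    by (intro tendsto_intros q0; simp)+
  show ?thesis
  proof (rule real_tendsto_sandwich)
    show "\<forall>\<^sub>F k in F. ?V B / (1 + q k) ^ DIM('a) \<le> ?V (f k)"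
      using nf
    proof eventually_elim
      case (elim k)
      have "(1 / (1 + q k)) * (norm y - inner (f k) y) \<le> norm y - inner B y" for y
      proof -
        have "norm y - inner (f k) y \<le> (norm y - inner B y) * (1 + q k)"
          using compare[of y k] by (simp add: algebra_simps)
        then show ?thesis using qpos[of k] by (simp add: pos_divide_le_eq)
      qed
      from measure_randers_ball_le[OF elim _ this] show ?case
        using qpos[of k] by (simp add: power_one_over)
    qed
    show "\<forall>\<^sub>F k in F. ?V (f k) \<le> ?V B / (1 - q k) ^ DIM('a)"
      using q1
    proof eventually_elim
      case (elim k)
      have "(1 - q k) * (norm y - inner B y) \<le> norm y - inner (f k) y" for y
        using compare[of y k] by (simp add: algebra_simps)
      from measure_randers_ball_le[OF B _ this] show ?case
        using elim by (simp add: le_divide_eq)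
    qed
  qed (use lim in simp_all)
qed

text \<open>As \<epsilon> tends to 0 the drift vector at x converges to \<theta> x/|x|. At the
  origin \<open>sgn 0 = 0\<close> matches \<open>drift_vec\<close>, which vanishes there for every
  \<epsilon>.\<close>

definition limit_density :: "real \<Rightarrow> 'a::euclidean_space \<Rightarrow> real" where
  "limit_density lam x = measure lebesgue (ball (0::'a) 1) / measure lebesgue (randers_ball (theta lam *\<^sub>R sgn x))"

context
  fixes lam :: real
  assumes lam: "lam > 1"
begin

lemma norm_drift_vec_less:
  assumes "\<epsilon> > 0"
  shows "norm (drift_vec lam \<epsilon> x) < 1"
  using norm_drift_vec[OF assms, of lam x] drift_bounds[OF lam assms, of "norm x"] theta_bounds[OF lam]
  by simp

lemma BH_density_bounds:
  fixes x :: "'a::euclidean_space"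
  assumes "\<epsilon> > 0"
  shows "0 < BH_density (Feps lam \<epsilon>) x" "BH_density (Feps lam \<epsilon>) x \<le> 2 ^ DIM('a)"
proof -
  let ?a = "measure lebesgue (ball (0::'a) 1)" and ?V = "measure lebesgue (randers_ball (drift_vec lam \<epsilon> x))"
  have V: "0 < ?V" by (intro measure_randers_ball_pos norm_drift_vec_less assms)
  show "0 < BH_density (Feps lam \<epsilon>) x"
    unfolding BH_density_eq by (intro divide_pos_pos measure_ball_pos V)
  have "?a / 2 ^ DIM('a) \<le> ?V" by (intro measure_randers_ball_ge norm_drift_vec_less assms)
  then have "?a \<le> 2 ^ DIM('a) * ?V" by (simp only: pos_divide_le_eq zero_less_power zero_less_numeral mult.commute)
  then show "BH_density (Feps lam \<epsilon>) x \<le> 2 ^ DIM('a)"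
    unfolding BH_density_eq using V by (simp only: pos_divide_le_eq)
qed

lemma continuous_on_BH_density:
  assumes "\<epsilon> > 0"
  shows "continuous_on UNIV (BH_density (Feps lam \<epsilon>) :: 'a::euclidean_space \<Rightarrow> real)"
proof -
  have "continuous_on UNIV (drift_vec lam \<epsilon> :: 'a \<Rightarrow> 'a)"
    unfolding drift_vec_def using assms
    by (intro continuous_intros) (metis add_nonneg_pos less_irrefl norm_ge_zero power_eq_0_iff)
  then have *: "(drift_vec lam \<epsilon> \<longlongrightarrow> drift_vec lam \<epsilon> x) (at x)" for x :: 'a
    by (simp add: continuous_on_def)
  have "((\<lambda>x. BH_density (Feps lam \<epsilon>) x) \<longlongrightarrow> BH_density (Feps lam \<epsilon>) x) (at x)" for x :: 'a
    unfolding BH_density_eq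
    using measure_randers_ball_pos[OF norm_drift_vec_less[OF assms], of x] norm_drift_vec_less[OF assms]
    by (intro tendsto_divide tendsto_const tendsto_measure_randers_ball *) auto
  then show ?thesis by (simp add: continuous_on_def)
qed

lemma norm_theta_sgn_less: "norm (theta lam *\<^sub>R sgn x) < 1"
  using theta_bounds[OF lam] by (simp add: norm_sgn)

lemma limit_density_pos: "0 < limit_density lam x"
  unfolding limit_density_def
  by (intro divide_pos_pos measure_ball_pos measure_randers_ball_pos norm_theta_sgn_less)

text \<open>Homogeneity of degree 0 is the property on which polar integration against this density
  is based.\<close>

lemma limit_density_scaleR:
  "c > 0 \<Longrightarrow> limit_density lam (c *\<^sub>R x) = limit_density lam x"
  by (simp add: limit_density_def sgn_scaleR)

lemma tendsto_BH_density:
  assumes "\<epsilon> \<longlonglongrightarrow> 0"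
    and "\<And>k. \<epsilon> k > 0"
  shows "(\<lambda>k. BH_density (Feps lam (\<epsilon> k)) x) \<longlonglongrightarrow> limit_density lam x"
proof -
  have "(\<lambda>k. drift_vec lam (\<epsilon> k) x) \<longlonglongrightarrow> theta lam *\<^sub>R sgn x"
  proof (cases "x = 0")
    case False
    then have "(\<lambda>k. drift_vec lam (\<epsilon> k) x) \<longlonglongrightarrow> (theta lam * (norm x + 2 * 0) / (norm x + 0)\<^sup>2) *\<^sub>R x"
      unfolding drift_vec_def by (intro tendsto_intros assms) auto
    moreover have "(theta lam * (norm x + 2 * 0) / (norm x + 0)\<^sup>2) *\<^sub>R x = theta lam *\<^sub>R sgn x"
      using False by (simp add: sgn_div_norm power2_eq_square divide_inverse)
    ultimately show ?thesis by simp
  qed (simp add: drift_vec_def)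
  then show ?thesis
    unfolding BH_density_eq limit_density_def
    using measure_randers_ball_pos[OF norm_theta_sgn_less, of x] norm_theta_sgn_less[of x]
    by (intro tendsto_intros tendsto_measure_randers_ball) auto
qed

lemma borel_measurable_limit_density: "limit_density lam \<in> borel_measurable borel"
proof (rule borel_measurable_LIMSEQ_metric)
  show "BH_density (Feps lam (inverse (real (Suc k)))) \<in> borel_measurable borel" for k
    by (rule borel_measurable_continuous_onI[OF continuous_on_BH_density]) simp
  show "(\<lambda>k. BH_density (Feps lam (inverse (real (Suc k)))) x) \<longlonglongrightarrow> limit_density lam x" for x :: 'a
    by (rule tendsto_BH_density[OF LIMSEQ_inverse_real_of_nat]) simp
qed

end

section \<open>Smooth radial test functions\<close>

text \<open>\<open>flat 0\<close> is the classical smooth function exp(-1/t); the powers of 1/t are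
  included so that derivatives are again combinations of members of the family.\<close>

definition flat :: "nat \<Rightarrow> real \<Rightarrow> real" where
  "flat j t = (if t > 0 then (1 / t) ^ j * exp (- (1 / t)) else 0)"

lemma power_le_exp:
  fixes u :: real
  assumes "u \<ge> 0" "n > 0"
  shows "u ^ n \<le> real n ^ n * exp u"
proof -
  have "u / real n \<le> exp (u / real n)" using exp_ge_add_one_self[of "u / real n"] by linarith
  then have "(u / real n) ^ n \<le> exp (u / real n) ^ n" using assms by (intro power_mono) auto
  also have "\<dots> = exp u" using assms by (simp flip: exp_of_nat_mult)
  finally show ?thesis using assms by (simp add: power_divide divide_le_eq mult.commute)
qed

text \<open>The estimate of \<open>u ^ n\<close> by \<open>exp u\<close> is taken at u = 1/t with
  exponent \<open>j + 2\<close>. The two spare powers leave a factor \<open>t\<^sup>2\<close>, which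
  makes the derivative at 0 vanish.\<close>

lemma flat_bounds: "0 \<le> flat j t" "flat j t \<le> real (j + 2) ^ (j + 2) * t\<^sup>2"
proof -
  show "0 \<le> flat j t" by (simp add: flat_def)
  show "flat j t \<le> real (j + 2) ^ (j + 2) * t\<^sup>2"
  proof (cases "t > 0")
    case True
    have "(1 / t) ^ (j + 2) \<le> real (j + 2) ^ (j + 2) * exp (1 / t)"
      using True by (intro power_le_exp) auto
    then have "(1 / t) ^ (j + 2) * (t\<^sup>2 * exp (- (1 / t)))
        \<le> real (j + 2) ^ (j + 2) * exp (1 / t) * (t\<^sup>2 * exp (- (1 / t)))"
      by (intro mult_right_mono) auto
    moreover have "(1 / t) ^ (j + 2) * (t\<^sup>2 * exp (- (1 / t))) = flat j t"
      using True by (simp add: flat_def power_add power_divide power2_eq_square)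
    moreover have "real (j + 2) ^ (j + 2) * exp (1 / t) * (t\<^sup>2 * exp (- (1 / t))) = real (j + 2) ^ (j + 2) * t\<^sup>2"
      using True by (simp add: exp_minus)
    ultimately show ?thesis by (simp only:)
  qed (simp add: flat_def)
qed

lemma flat_deriv:
  "(flat j has_real_derivative flat (j + 2) t - real j * flat (j + 1) t) (at t)"
proof (cases t "0 :: real" rule: linorder_cases)
  case less
  have "((\<lambda>_. 0) has_real_derivative flat (j + 2) t - real j * flat (j + 1) t) (at t)"
    using less by (simp add: flat_def)
  then show ?thesis
    by (rule has_field_derivative_transform_within_open[where S = "{..<0}"]) (use less in \<open>auto simp: flat_def\<close>)
next
  case greater
  have "((\<lambda>t. (1 / t) ^ j * exp (- (1 / t))) has_real_derivative flat (j + 2) t - real j * flat (j + 1) t) (at t)"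
    using greater
    by (auto intro!: derivative_eq_intros simp: flat_def)
      (cases j; simp add: field_simps power2_eq_square)
  then show ?thesis
    by (rule has_field_derivative_transform_within_open[where S = "{0<..}"]) (use greater in \<open>auto simp: flat_def\<close>)
next
  case equal
  have "((\<lambda>h. flat j h / h) \<longlongrightarrow> 0) (at 0)"
  proof (rule Lim_null_comparison)
    show "\<forall>\<^sub>F h in at 0. norm (flat j h / h) \<le> real (j + 2) ^ (j + 2) * \<bar>h\<bar>"
    proof (rule always_eventually, rule allI)
      fix h :: real
      have "flat j h \<le> real (j + 2) ^ (j + 2) * \<bar>h\<bar> * \<bar>h\<bar>"
        using flat_bounds(2)[of j h] by (simp add: power2_eq_square mult.assoc)
      then show "norm (flat j h / h) \<le> real (j + 2) ^ (j + 2) * \<bar>h\<bar>"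
        using flat_bounds(1)[of j h] by (cases "h = 0") (auto simp: divide_le_eq)
    qed
    have "((\<lambda>h::real. real (j + 2) ^ (j + 2) * \<bar>h\<bar>) \<longlongrightarrow> real (j + 2) ^ (j + 2) * \<bar>0\<bar>) (at 0)"
      by (intro tendsto_intros)
    then show "((\<lambda>h::real. real (j + 2) ^ (j + 2) * \<bar>h\<bar>) \<longlongrightarrow> 0) (at 0)" by simp
  qed
  then show ?thesis using equal by (simp add: DERIV_def flat_def)
qed

text \<open>A class of functions closed under directional derivatives, so that all its members are smooth.\<close>

inductive radial_flat :: "('a::euclidean_space \<Rightarrow> real) \<Rightarrow> bool" where
  const: "radial_flat (\<lambda>x. c)"
| coord: "radial_flat (\<lambda>x. inner x i)"
| flat: "radial_flat (\<lambda>x. flat j (a * inner x x + b))"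
| add: "radial_flat f \<Longrightarrow> radial_flat g \<Longrightarrow> radial_flat (\<lambda>x. f x + g x)"
| mult: "radial_flat f \<Longrightarrow> radial_flat g \<Longrightarrow> radial_flat (\<lambda>x. f x * g x)"

lemma radial_flat_has_derivative:
  assumes "radial_flat f"
  shows "\<exists>f'. (\<forall>x. (f has_derivative f' x) (at x)) \<and> (\<forall>e. radial_flat (\<lambda>x. f' x e))"
  using assms
proof induction
  case (const c)
  then show ?case by (intro exI[of _ "\<lambda>_ _. 0"]) (auto intro: radial_flat.const)
next
  case (coord i)
  then show ?case
    by (intro exI[of _ "\<lambda>_ e. inner e i"]) (auto intro!: radial_flat.const derivative_eq_intros)
next
  case (flat j a b)
  let ?d = "\<lambda>x. flat (j + 2) (a * inner x x + b) + (- real j) * flat (j + 1) (a * inner x x + b)"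
  have "((\<lambda>x. flat j (a * inner x x + b)) has_derivative (\<lambda>e. ?d x * (2 * a * inner x e))) (at x)" for x :: 'a
  proof -
    have "((\<lambda>x. a * inner x x + b) has_derivative (\<lambda>e. 2 * a * inner x e)) (at x)"
      by (auto intro!: derivative_eq_intros simp: inner_commute algebra_simps)
    from has_derivative_compose[OF this flat_deriv[unfolded has_field_derivative_def, of j]]
    show ?thesis by simp
  qed
  moreover have "radial_flat (\<lambda>x. ?d x * (2 * a * inner x e))" for e :: 'a
    by (intro radial_flat.intros)
  ultimately show ?case by (intro exI[of _ "\<lambda>x e. ?d x * (2 * a * inner x e)"]) blast
next
  case (add f g)
  then obtain f' g' where "\<forall>x. (f has_derivative f' x) (at x)" "\<forall>e. radial_flat (\<lambda>x. f' x e)"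
    "\<forall>x. (g has_derivative g' x) (at x)" "\<forall>e. radial_flat (\<lambda>x. g' x e)" by blast
  then show ?case
    by (intro exI[of _ "\<lambda>x e. f' x e + g' x e"])
      (auto intro: radial_flat.add intro!: derivative_eq_intros)
next
  case (mult f g)
  then obtain f' g' where "\<forall>x. (f has_derivative f' x) (at x)" "\<forall>e. radial_flat (\<lambda>x. f' x e)"
    "\<forall>x. (g has_derivative g' x) (at x)" "\<forall>e. radial_flat (\<lambda>x. g' x e)" by blast
  with mult show ?case
    by (intro exI[of _ "\<lambda>x e. f x * g' x e + f' x e * g x"])
      (auto intro!: radial_flat.add radial_flat.mult has_derivative_mult)
qed

lemma radial_flat_imp_smooth:
  assumes "radial_flat u"
  shows "smooth_fun u"
proof -
  have iter: "radial_flat (iter_pd es u)" for es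
  proof (induction es)
    case (Cons e es)
    then obtain f' where f': "\<forall>x. (iter_pd es u has_derivative f' x) (at x)" "\<forall>e. radial_flat (\<lambda>x. f' x e)"
      using radial_flat_has_derivative by blast
    then have "iter_pd (e # es) u = (\<lambda>x. f' x e)" by (metis frechet_derivative_at iter_pd.simps(2))
    then show ?case using f' by simp
  qed (use assms in simp)
  have "iter_pd es u differentiable_on UNIV" for es
    using radial_flat_has_derivative[OF iter[of es]]
    by (auto simp: differentiable_on_def differentiable_def)
  then show ?thesis by (simp add: smooth_fun_def)
qed

lemma radial_flat_sum:
  assumes "finite I" "\<And>i. i \<in> I \<Longrightarrow> radial_flat (f i)"
  shows "radial_flat (\<lambda>x. \<Sum>i\<in>I. f i x)"
  using assms by (induction I) (auto intro: radial_flat.intros)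

text \<open>Expanding \<open>inner x x\<close> as a sum of squared coordinates keeps the argument
  inside the class, which is closed under sums and products.\<close>

lemma radial_flat_polynomial:
  assumes "real_polynomial_function q"
  shows "radial_flat (\<lambda>x. q (c * inner x x))"
  using assms
proof induction
  case (linear h)
  have "h t = h 1 * t" for t using linear_scale[OF bounded_linear.linear[OF linear], of t 1] by (simp add: mult.commute)
  then have "(\<lambda>x::'a. h (c * inner x x)) = (\<lambda>x. h 1 * (c * (\<Sum>i\<in>Basis. inner x i * inner x i)))"
    by (metis euclidean_inner)
  then show ?case by (auto intro!: radial_flat.const radial_flat.mult radial_flat_sum radial_flat.coord)
qed (auto intro: radial_flat.intros)

definition cutoff :: "real \<Rightarrow> real \<Rightarrow> real \<Rightarrow> real" where
  "cutoff a b s = flat 0 (s - a) * flat 0 (b - s)"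

text \<open>The derivative of \<open>flat 0\<close> is \<open>flat 2\<close>, because the
  \<open>flat 1\<close> term carries the coefficient j = 0.\<close>

definition cutoff_deriv :: "real \<Rightarrow> real \<Rightarrow> real \<Rightarrow> real" where
  "cutoff_deriv a b s = flat 2 (s - a) * flat 0 (b - s) - flat 0 (s - a) * flat 2 (b - s)"

lemma cutoff_has_deriv: "(cutoff a b has_real_derivative cutoff_deriv a b s) (at s)"
  unfolding cutoff_def cutoff_deriv_def
  by (auto intro!: derivative_eq_intros DERIV_chain2[OF flat_deriv] simp: numeral_2_eq_2)

lemma cutoff_outside:
  assumes "s \<notin> {a<..<b}"
  shows "cutoff a b s = 0" "cutoff_deriv a b s = 0"
  using assms by (auto simp: cutoff_def cutoff_deriv_def flat_def)

lemma cutoff_pos: "s \<in> {a<..<b} \<Longrightarrow> 0 < cutoff a b s"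
  by (simp add: cutoff_def flat_def)

lemma cutoff_bounds: "0 \<le> cutoff a b s" "cutoff a b s \<le> 1"
  by (auto simp: cutoff_def flat_def intro!: mult_le_one)

lemma continuous_flat: "continuous_on A (flat j)"
  using DERIV_isCont[OF flat_deriv] by (simp add: continuous_at_imp_continuous_on)

lemma continuous_cutoff: "continuous_on A (cutoff a b)" "continuous_on A (cutoff_deriv a b)"
  unfolding cutoff_def cutoff_deriv_def
  by (intro continuous_intros continuous_on_compose2[OF continuous_flat]; auto)+

lemma smooth_radial_cutoff:
  assumes "real_polynomial_function q"
  shows "smooth_fun (\<lambda>x::'a::euclidean_space. cutoff a b (c * inner x x) * q (c * inner x x))"
proof (rule radial_flat_imp_smooth)
  have "radial_flat (\<lambda>x::'a. flat 0 (c * inner x x + (- a)) * flat 0 ((- c) * inner x x + b) * q (c * inner x x))"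
    by (intro radial_flat.mult radial_flat.flat radial_flat_polynomial assms)
  then show "radial_flat (\<lambda>x::'a. cutoff a b (c * inner x x) * q (c * inner x x))"
    by (simp add: cutoff_def)
qed

lemma polynomial_antiderivative:
  fixes P :: "real \<Rightarrow> real"
  assumes "real_polynomial_function P"
  obtains q where "real_polynomial_function q" "\<And>s. (q has_real_derivative P s) (at s)" "q a = 0"
proof -
  obtain c n where P: "P = (\<lambda>x. \<Sum>i\<le>n. c i * x ^ i)"
    using assms real_polynomial_function_iff_sum by metis
  define q0 where "q0 x = (\<Sum>i\<le>n. c i / real (Suc i) * x ^ Suc i)" for x
  have "real_polynomial_function q0" unfolding q0_def
    by (intro real_polynomial_function_sum real_polynomial_function.intros(4) real_polynomial_function.intros(2)
        real_polynomial_function_power) auto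
  then have poly: "real_polynomial_function (\<lambda>x. q0 x + (- q0 a))"
    by (intro real_polynomial_function.intros(3) real_polynomial_function.intros(2))
  have deriv: "((\<lambda>x. c i / real (Suc i) * x ^ Suc i) has_real_derivative c i * s ^ i) (at s)" for i s
  proof -
    have "((\<lambda>x. c i / real (Suc i) * x ^ Suc i) has_real_derivative c i / real (Suc i) * (real (Suc i) * s ^ i)) (at s)"
      by (rule DERIV_cmult) (use DERIV_pow[of "Suc i" s] in simp)
    then show ?thesis by simp
  qed
  have "(q0 has_real_derivative P s) (at s)" for s
    unfolding q0_def P by (intro DERIV_sum deriv)
  then have "((\<lambda>x. q0 x + (- q0 a)) has_real_derivative P s) (at s)" for s
    by (auto intro!: derivative_eq_intros)
  then show ?thesis using poly by (intro that[of "\<lambda>x. q0 x + (- q0 a)"]) auto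
qed

text \<open>
  \<open>P k\<close> is a Weierstrass approximation of the difference quotient of \<open>g\<close> with step \<open>1 / (k + 1)\<close>,
  which is continuous although \<open>g'\<close> need not be.
\<close>

lemma polynomial_approximation_C0_deriv:
  fixes g g' :: "real \<Rightarrow> real"
  assumes ab: "a < b" and S: "finite S" and cont: "continuous_on UNIV g"
    and deriv: "\<And>s. s \<notin> S \<Longrightarrow> (g has_real_derivative g' s) (at s)"
    and bound: "\<And>s. s \<notin> S \<Longrightarrow> \<bar>g' s\<bar> \<le> L" and L: "0 \<le> L"
    and ga: "g a = 0"
  obtains q P where "\<And>k::nat. real_polynomial_function (q k)"
    "\<And>k. real_polynomial_function (P k)"
    "\<And>k s. (q k has_real_derivative P k s) (at s)"
    "\<And>k s. s \<in> {a..b} \<Longrightarrow> \<bar>P k s\<bar> \<le> L + 1"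
    "\<And>k s. s \<in> {a..b} \<Longrightarrow> \<bar>q k s\<bar> \<le> (L + 1) * (b - a)"
    "\<And>s. s \<in> {a..b} \<Longrightarrow> (\<lambda>k. q k s) \<longlonglongrightarrow> g s"
    "\<And>s. s \<in> {a..b} - S \<Longrightarrow> (\<lambda>k. P k s) \<longlonglongrightarrow> g' s"
proof -
  define \<delta> where "\<delta> k = inverse (real (Suc k))" for k
  have \<delta>: "0 < \<delta> k" "\<delta> k \<le> 1" for k by (auto simp: \<delta>_def inverse_le_1_iff)
  have \<delta>0: "\<delta> \<longlonglongrightarrow> 0" unfolding \<delta>_def[abs_def] by (rule LIMSEQ_inverse_real_of_nat)
  have lip: "\<bar>g y - g x\<bar> \<le> L * (y - x)" if "x \<le> y" for x y
  proof -
    have "(g' has_integral g y - g x) {x..y}"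
      by (rule fundamental_theorem_of_calculus_interior_strong[OF S that])
        (use deriv cont in \<open>auto simp: has_real_derivative_iff_has_vector_derivative[symmetric] intro: continuous_on_subset\<close>)
    then have "norm (g y - g x) \<le> L * measure lborel (cbox x y)"
      by (intro has_integral_bound_spike_finite[OF L S]) (use bound in auto)
    then show ?thesis using that by simp
  qed
  define h where "h k s = (g (s + \<delta> k) - g s) / \<delta> k" for k s
  have hb: "\<bar>h k s\<bar> \<le> L" for k s
    using lip[of s "s + \<delta> k"] \<delta>[of k] by (simp add: h_def divide_le_eq)
  have hlim: "(\<lambda>k. h k s) \<longlonglongrightarrow> g' s" if "s \<notin> S" for s
  proof -
    have "filterlim \<delta> (at 0) sequentially"
      using \<delta>0 \<delta>(1) by (intro filterlim_atI) (auto intro!: always_eventually simp: less_imp_neq[THEN not_sym])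
    then show ?thesis
      using filterlim_compose[OF deriv[OF that, unfolded DERIV_def]] unfolding h_def by blast
  qed
  have hcont: "continuous_on {a..b} (h k)" for k
    unfolding h_def using \<delta>(1)[of k]
    by (intro continuous_intros continuous_on_compose2[OF cont]) auto
  have "\<exists>P. real_polynomial_function P \<and> (\<forall>s\<in>{a..b}. \<bar>h k s - P s\<bar> < \<delta> k)" for k
    using Stone_Weierstrass_real_polynomial_function[OF compact_Icc hcont \<delta>(1)] by metis
  then obtain P where P: "\<And>k. real_polynomial_function (P k)"
    "\<And>k s. s \<in> {a..b} \<Longrightarrow> \<bar>h k s - P k s\<bar> < \<delta> k" by metis
  have "\<exists>q. real_polynomial_function q \<and> (\<forall>s. (q has_real_derivative P k s) (at s)) \<and> q a = 0" for k
    using polynomial_antiderivative[OF P(1)] by metis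
  then obtain q where q: "\<And>k. real_polynomial_function (q k)"
    "\<And>k s. (q k has_real_derivative P k s) (at s)" "\<And>k. q k a = 0" by metis
  have Pb: "\<bar>P k s\<bar> \<le> L + 1" if "s \<in> {a..b}" for k s
    using hb[of k s] P(2)[OF that, of k] \<delta>(2)[of k] by linarith
  have Plim: "(\<lambda>k. P k s) \<longlonglongrightarrow> g' s" if "s \<in> {a..b} - S" for s
  proof -
    have "(\<lambda>k. h k s - P k s) \<longlonglongrightarrow> 0"
      by (rule Lim_null_comparison[OF _ \<delta>0]) (use P(2)[of s] that in \<open>auto intro!: always_eventually less_imp_le\<close>)
    from tendsto_diff[OF hlim[of s] this] that show ?thesis by simp
  qed
  have qint: "(P k has_integral q k s) {a..s}" if "s \<in> {a..b}" for k s
    using fundamental_theorem_of_calculus[of a s "q k" "P k"] q that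
    by (auto simp: has_real_derivative_iff_has_vector_derivative has_vector_derivative_at_within)
  have qb: "\<bar>q k s\<bar> \<le> (L + 1) * (b - a)" if s: "s \<in> {a..b}" for k s
  proof -
    have "norm (q k s) \<le> (L + 1) * measure lborel (cbox a s)"
      using qint[OF s] L Pb s by (intro has_integral_bound) auto
    also have "\<dots> \<le> (L + 1) * (b - a)" using s L by (intro mult_left_mono) auto
    finally show ?thesis by simp
  qed
  have qlim: "(\<lambda>k. q k s) \<longlonglongrightarrow> g s" if s: "s \<in> {a..b}" for s
  proof -
    \<comment> \<open>Convergence of \<open>P k\<close> is known only off the finite set
      \<open>S\<close>, whereas dominated convergence asks for it at every point; both sequence and
      limit are reset to 0 on \<open>S\<close>.\<close>
    define P0 where "P0 k t = (if t \<in> S then 0 else P k t)" for k t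
    define g0 where "g0 t = (if t \<in> S then 0 else g' t)" for t
    have neg: "negligible S" using S by (rule negligible_finite)
    have P0: "(P0 k has_integral q k s) {a..s}" for k
      by (rule has_integral_spike[OF neg _ qint[OF s]]) (auto simp: P0_def)
    have "(g' has_integral g s - g a) {a..s}"
      by (rule fundamental_theorem_of_calculus_interior_strong[OF S])
        (use deriv cont s in \<open>auto simp: has_real_derivative_iff_has_vector_derivative[symmetric] intro: continuous_on_subset\<close>)
    then have g0: "(g0 has_integral g s) {a..s}"
      using ga by (intro has_integral_spike[OF neg, of _ g0 g']) (auto simp: g0_def)
    have "(\<lambda>k. integral {a..s} (P0 k)) \<longlonglongrightarrow> integral {a..s} g0"
    proof (rule dominated_convergence(2))
      show "P0 k integrable_on {a..s}" for k using P0 by blast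
      show "(\<lambda>_. L + 1) integrable_on {a..s}" by (rule integrable_const_ivl)
      show "norm (P0 k t) \<le> L + 1" if "t \<in> {a..s}" for k t
        using Pb[of t k] that s L by (auto simp: P0_def)
      show "(\<lambda>k. P0 k t) \<longlonglongrightarrow> g0 t" if "t \<in> {a..s}" for t
        using Plim[of t] that s by (auto simp: P0_def g0_def)
    qed
    then show ?thesis using integral_unique[OF P0] integral_unique[OF g0] by simp
  qed
  show ?thesis by (rule that[OF q(1) P(1) q(2) Pb qb qlim Plim])
qed

text \<open>Approximating \<open>f / cutoff a' b'\<close> by polynomials avoids a cutoff with a plateau.\<close>

lemma smooth_cutoff_approximation:
  fixes f f' :: "real \<Rightarrow> real"
  assumes ord: "a' < a" "a < b" "b < b'" and S: "finite S" and cont: "continuous_on UNIV f"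
    and deriv: "\<And>s. s \<notin> S \<Longrightarrow> (f has_real_derivative f' s) (at s)"
    and bound: "\<And>s. s \<notin> S \<Longrightarrow> \<bar>f' s\<bar> \<le> M"
    and out: "\<And>s. s \<notin> {a..b} \<Longrightarrow> f s = 0" "\<And>s. s \<notin> {a..b} \<Longrightarrow> f' s = 0"
  obtains q \<eta>' B where "\<And>k::nat. real_polynomial_function (q k)"
    "\<And>k s. ((\<lambda>s. cutoff a' b' s * q k s) has_real_derivative \<eta>' k s) (at s)"
    "\<And>k s. \<bar>cutoff a' b' s * q k s\<bar> \<le> B"
    "\<And>k s. \<bar>\<eta>' k s\<bar> \<le> B"
    "\<And>k. continuous_on UNIV (\<eta>' k)"
    "\<And>k s. s \<notin> {a'..b'} \<Longrightarrow> \<eta>' k s = 0"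
    "\<And>s. (\<lambda>k. cutoff a' b' s * q k s) \<longlonglongrightarrow> f s"
    "\<And>s. s \<notin> S \<Longrightarrow> (\<lambda>k. \<eta>' k s) \<longlonglongrightarrow> f' s"
proof -
  let ?\<chi> = "cutoff a' b'" and ?\<chi>' = "cutoff_deriv a' b'"
  \<comment> \<open>Where the cutoff vanishes, \<open>f\<close> vanishes too and division by 0
    returns 0, so \<open>g\<close> is 0 off \<open>[a, b]\<close> and no separate case is built
    in.\<close>
  define g where "g s = f s / ?\<chi> s" for s
  define g' where "g' s = (f' s * ?\<chi> s - f s * ?\<chi>' s) / (?\<chi> s * ?\<chi> s)" for s
  have \<chi>pos: "0 < ?\<chi> s" if "s \<in> {a..b}" for s using that ord by (intro cutoff_pos) auto
  obtain s0 where "s0 \<in> {a..b}" "\<And>s. s \<in> {a..b} \<Longrightarrow> ?\<chi> s0 \<le> ?\<chi> s"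
    using continuous_attains_inf[of "{a..b}" ?\<chi>] ord continuous_cutoff(1) by (metis atLeastatMost_empty_iff2 compact_Icc less_imp_le)
  then obtain c where c: "0 < c" "\<And>s. s \<in> {a..b} \<Longrightarrow> c \<le> ?\<chi> s" using \<chi>pos by blast
  have "compact (?\<chi>' ` {a'..b'})" "compact (f ` {a..b})"
    using continuous_cutoff cont by (auto intro!: compact_continuous_image intro: continuous_on_subset)
  then have "bounded (?\<chi>' ` {a'..b'})" "bounded (f ` {a..b})" by (auto intro: compact_imp_bounded)
  then obtain X F where "\<forall>y\<in>?\<chi>' ` {a'..b'}. norm y \<le> X" "\<forall>y\<in>f ` {a..b}. norm y \<le> F"
    unfolding bounded_iff by metis
  then have XF: "\<And>s. s \<in> {a'..b'} \<Longrightarrow> \<bar>?\<chi>' s\<bar> \<le> X" "\<And>s. s \<in> {a..b} \<Longrightarrow> \<bar>f s\<bar> \<le> F" by simp_all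
  have X: "0 \<le> X" using XF(1)[of a'] ord by auto
  have F: "0 \<le> F" using XF(2)[of a] ord by auto
  \<comment> \<open>The quotient rule gives this bound: the numerator is at most
    \<open>\<bar>M\<bar> + F * X\<close> because the cutoff is at most 1, and \<open>c\<close> is
    its positive minimum on \<open>[a, b]\<close>.\<close>
  define L where "L = (\<bar>M\<bar> + F * X) / c\<^sup>2"
  have L: "0 \<le> L" using X F by (simp add: L_def)
  have g'b: "\<bar>g' s\<bar> \<le> L" if "s \<notin> S" for s
  proof (cases "s \<in> {a..b}")
    case True
    have "\<bar>f' s * ?\<chi> s - f s * ?\<chi>' s\<bar> \<le> \<bar>f' s\<bar> * ?\<chi> s + \<bar>f s\<bar> * \<bar>?\<chi>' s\<bar>"
      by (rule order_trans[OF abs_triangle_ineq4]) (simp add: abs_mult cutoff_bounds)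
    also have "\<dots> \<le> \<bar>M\<bar> * 1 + F * X"
      using bound[OF that] XF(1)[of s] XF(2)[of s] True ord cutoff_bounds[of a' b' s] F
      by (intro add_mono mult_mono) auto
    finally have "\<bar>f' s * ?\<chi> s - f s * ?\<chi>' s\<bar> \<le> \<bar>M\<bar> + F * X" by simp
    moreover have "c\<^sup>2 \<le> ?\<chi> s * ?\<chi> s" unfolding power2_eq_square
      using c(2)[OF True] c(1) by (intro mult_mono) auto
    ultimately show ?thesis
      unfolding g'_def L_def abs_divide using c(1) X F by (intro frac_le) auto
  next
    case False then show ?thesis using out L by (simp add: g'_def)
  qed
  have gcont: "isCont g s" and gderiv: "s \<notin> S \<Longrightarrow> (g has_real_derivative g' s) (at s)" for s
  proof -
    \<comment> \<open>Two overlapping open sets cover the line: on one the denominator is nonzero,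
      on the other \<open>g\<close> is identically 0.\<close>
    consider "s \<in> {a'<..<b'}" | "s \<in> - {a..b}" using ord by fastforce
    then have "isCont g s \<and> (s \<notin> S \<longrightarrow> (g has_real_derivative g' s) (at s))"
    proof cases
      case 1
      then have "?\<chi> s \<noteq> 0" using cutoff_pos[of s a' b'] by auto
      moreover have "isCont f s" using cont by (simp add: continuous_on_eq_continuous_at)
      ultimately show ?thesis unfolding g_def[abs_def] g'_def
        using DERIV_isCont[OF cutoff_has_deriv] deriv
        by (auto intro!: continuous_divide derivative_eq_intros cutoff_has_deriv)
    next
      case 2
      have "(g has_real_derivative 0) (at s)"
        by (rule has_field_derivative_transform_within_open[of "\<lambda>_. 0" _ _ "- {a..b}"])
          (use 2 out in \<open>auto simp: g_def\<close>)
      moreover have "g' s = 0" using 2 out by (simp add: g'_def)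
      ultimately show ?thesis using DERIV_isCont by auto
    qed
    then show "isCont g s" "s \<notin> S \<Longrightarrow> (g has_real_derivative g' s) (at s)" by auto
  qed
  have ga: "g a' = 0" using ord out by (simp add: g_def)
  have ab': "a' < b'" using ord by simp
  have contg: "continuous_on UNIV g" using gcont by (simp add: continuous_at_imp_continuous_on)
  obtain q P where q: "\<And>k::nat. real_polynomial_function (q k)"
    and P: "\<And>k. real_polynomial_function (P k)"
    and q': "\<And>k s. (q k has_real_derivative P k s) (at s)"
    "\<And>k s. s \<in> {a'..b'} \<Longrightarrow> \<bar>P k s\<bar> \<le> L + 1"
    "\<And>k s. s \<in> {a'..b'} \<Longrightarrow> \<bar>q k s\<bar> \<le> (L + 1) * (b' - a')"
    "\<And>s. s \<in> {a'..b'} \<Longrightarrow> (\<lambda>k. q k s) \<longlonglongrightarrow> g s"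
    "\<And>s. s \<in> {a'..b'} - S \<Longrightarrow> (\<lambda>k. P k s) \<longlonglongrightarrow> g' s"
    by (rule polynomial_approximation_C0_deriv[OF ab' S contg gderiv g'b L ga]) blast+
  define B where "B = (L + 1) * (b' - a') + X * ((L + 1) * (b' - a')) + (L + 1)"
  define \<eta>' where "\<eta>' k s = ?\<chi>' s * q k s + P k s * ?\<chi> s" for k s
  have \<chi>0: "?\<chi> s = 0" "?\<chi>' s = 0" if "s \<notin> {a'..b'}" for s
    using that by (auto intro!: cutoff_outside)
  have Bpos: "0 \<le> (L + 1) * (b' - a')" using L ord by simp
  show ?thesis
  proof (rule that[of q \<eta>' B, OF q(1)])
    show "((\<lambda>s. ?\<chi> s * q k s) has_real_derivative \<eta>' k s) (at s)" for k s
      unfolding \<eta>'_def by (rule DERIV_mult[OF cutoff_has_deriv q'(1)])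
    show "continuous_on UNIV (\<eta>' k)" for k
      unfolding \<eta>'_def
      by (intro continuous_intros continuous_cutoff continuous_on_polymonial_function)
        (use q(1) P in \<open>simp_all add: real_polynomial_function_eq\<close>)
    show zero: "\<eta>' k s = 0" if "s \<notin> {a'..b'}" for k s
      using that by (simp add: \<eta>'_def \<chi>0)
    show "\<bar>?\<chi> s * q k s\<bar> \<le> B" for k s
    proof (cases "s \<in> {a'..b'}")
      case True
      have "\<bar>?\<chi> s\<bar> * \<bar>q k s\<bar> \<le> 1 * ((L + 1) * (b' - a'))"
        using cutoff_bounds[of a' b' s] q'(3)[OF True] by (intro mult_mono) auto
      then show ?thesis using X L Bpos by (simp add: B_def abs_mult add_increasing2)
    next
      case False then show ?thesis using X L Bpos by (simp add: B_def \<chi>0)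
    qed
    show "\<bar>\<eta>' k s\<bar> \<le> B" for k s
    proof (cases "s \<in> {a'..b'}")
      case True
      have "\<bar>\<eta>' k s\<bar> \<le> \<bar>?\<chi>' s\<bar> * \<bar>q k s\<bar> + \<bar>P k s\<bar> * \<bar>?\<chi> s\<bar>"
        unfolding \<eta>'_def by (rule order_trans[OF abs_triangle_ineq]) (simp add: abs_mult)
      also have "\<dots> \<le> X * ((L + 1) * (b' - a')) + (L + 1) * 1"
        using cutoff_bounds[of a' b' s] q'(2,3)[OF True] XF(1)[OF True] X L
        by (intro add_mono mult_mono) auto
      finally show ?thesis using Bpos by (simp add: B_def)
    next
      case False then show ?thesis using X L Bpos by (simp add: B_def zero)
    qed
    show "(\<lambda>k. ?\<chi> s * q k s) \<longlonglongrightarrow> f s" for s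
    proof (cases "s \<in> {a'<..<b'}")
      case True
      then have "(\<lambda>k. ?\<chi> s * q k s) \<longlonglongrightarrow> ?\<chi> s * g s" by (intro tendsto_intros q'(4)) auto
      then show ?thesis using cutoff_pos[OF True] by (simp add: g_def)
    next
      case False
      then have "s \<notin> {a..b}" using ord by auto
      then show ?thesis using False out by (simp add: cutoff_outside)
    qed
    show "(\<lambda>k. \<eta>' k s) \<longlonglongrightarrow> f' s" if "s \<notin> S" for s
    proof (cases "s \<in> {a'<..<b'}")
      case True
      then have "(\<lambda>k. \<eta>' k s) \<longlonglongrightarrow> ?\<chi>' s * g s + g' s * ?\<chi> s"
        unfolding \<eta>'_def using that by (intro tendsto_intros q'(4,5)) auto
      moreover have "?\<chi>' s * g s + g' s * ?\<chi> s = f' s"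
        using cutoff_pos[OF True] by (simp add: g_def g'_def field_simps)
      ultimately show ?thesis by simp
    next
      case False
      then have "s \<notin> {a..b}" using ord by auto
      then show ?thesis using False out by (simp add: cutoff_outside \<eta>'_def)
    qed
  qed
qed

section \<open>Dual metric and radial integration\<close>

text \<open>Handles the points where the gradient vanishes, among them the origin, where the radial
  estimate does not apply.\<close>

lemma dual_metric_zero:
  "dual_metric (F :: 'a::euclidean_space \<Rightarrow> 'a \<Rightarrow> real) x (\<lambda>y. 0) = 0"
proof -
  obtain y :: 'a where "y \<noteq> 0" using nonzero_Basis SOME_Basis by blast
  then have "{(0::real) / F x y |y. y \<noteq> 0} = {0}" by auto
  then show ?thesis unfolding dual_metric_def by simp
qed

text \<open>With t = <x,y>/|x| the quotient is \<kappa> t / (|y| - b t) and |t| <= |y|; the extreme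
  values t = |y| and t = -|y| give the two entries of the maximum. The upper estimate bounds the
  energy from above, and nonnegativity makes raising to the power p monotone.\<close>

lemma dual_metric_radial_bounds:
  fixes x :: "'a::euclidean_space" and \<kappa> :: real
  assumes lam: "lam > 1" and \<epsilon>: "\<epsilon> > 0" and x: "x \<noteq> 0"
  defines "\<xi> \<equiv> \<lambda>y. \<kappa> * (inner x y / norm x)" and "b \<equiv> drift lam \<epsilon> (norm x)"
  shows "0 \<le> dual_metric (Feps lam \<epsilon>) x \<xi>"
    and "dual_metric (Feps lam \<epsilon>) x \<xi> \<le> max (\<kappa> / (1 - b)) (- \<kappa> / (1 + b))"
proof -
  let ?\<Phi> = "max (\<kappa> / (1 - b)) (- \<kappa> / (1 + b))"
  have b: "0 \<le> b" "b < 1"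
    using drift_bounds[OF lam \<epsilon>, of "norm x"] theta_bounds[OF lam] by (auto simp: b_def)
  have le: "\<xi> y / Feps lam \<epsilon> x y \<le> ?\<Phi>" if "y \<noteq> 0" for y
  proof -
    define t where "t = inner x y / norm x"
    have t: "\<bar>t\<bar> \<le> norm y"
      using Cauchy_Schwarz_ineq2[of x y] x by (simp add: t_def divide_le_eq mult.commute)
    have F: "Feps lam \<epsilon> x y = norm y - b * t"
      using x by (simp add: Feps_eq_drift t_def b_def)
    have "0 < (1 - theta lam) * norm y" using theta_bounds[OF lam] that by simp
    then have pos: "0 < norm y - b * t" using Feps_bounds(3)[OF lam \<epsilon>, of y x] F by linarith
    have "\<kappa> * t \<le> ?\<Phi> * (norm y - b * t)"
    proof (cases "\<kappa> \<ge> 0")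
      case True
      have "\<kappa> * t = \<kappa> / (1 - b) * ((1 - b) * t)" using b by simp
      also have "\<dots> \<le> \<kappa> / (1 - b) * (norm y - b * t)"
        using True b t by (intro mult_left_mono) (auto simp: algebra_simps)
      also have "\<dots> \<le> ?\<Phi> * (norm y - b * t)" using pos by (intro mult_right_mono) auto
      finally show ?thesis .
    next
      case False
      have "\<kappa> * t = - \<kappa> / (1 + b) * (- (1 + b) * t)" using b by (simp add: field_simps)
      also have "\<dots> \<le> - \<kappa> / (1 + b) * (norm y - b * t)"
        using False b t by (intro mult_left_mono) (auto simp: algebra_simps divide_nonpos_pos)
      also have "\<dots> \<le> ?\<Phi> * (norm y - b * t)" using pos by (intro mult_right_mono) auto
      finally show ?thesis .
    qed
    then have "\<kappa> * t / (norm y - b * t) \<le> ?\<Phi>" using pos by (simp only: pos_divide_le_eq)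
    then show ?thesis by (simp only: \<xi>_def F t_def)
  qed
  let ?S = "{\<xi> y / Feps lam \<epsilon> x y |y. y \<noteq> 0}"
  have bdd: "bdd_above ?S" using le unfolding bdd_above_def by blast
  have up: "\<xi> y / Feps lam \<epsilon> x y \<le> Sup ?S" if "y \<noteq> 0" for y
    by (rule cSup_upper[OF _ bdd]) (use that in blast)
  have "\<xi> x / Feps lam \<epsilon> x x \<le> Sup ?S" "\<xi> (- x) / Feps lam \<epsilon> x (- x) \<le> Sup ?S"
    using x by (auto intro!: up)
  moreover have "0 \<le> \<xi> x / Feps lam \<epsilon> x x \<or> 0 \<le> \<xi> (- x) / Feps lam \<epsilon> x (- x)"
  proof -
    have "\<xi> (- x) = - \<xi> x" by (simp add: \<xi>_def)
    then have "0 \<le> \<xi> x \<or> 0 \<le> \<xi> (- x)" by linarith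
    then show ?thesis using divide_nonneg_nonneg[OF _ Feps_bounds(1)[OF lam \<epsilon>]] by metis
  qed
  ultimately show "0 \<le> dual_metric (Feps lam \<epsilon>) x \<xi>" unfolding dual_metric_def by linarith
  show "dual_metric (Feps lam \<epsilon>) x \<xi> \<le> ?\<Phi>"
    unfolding dual_metric_def
  proof (rule cSup_least)
    show "?S \<noteq> {}" using x by auto
    fix z assume "z \<in> ?S"
    then obtain y where "y \<noteq> 0" "z = \<xi> y / Feps lam \<epsilon> x y" by auto
    then show "z \<le> ?\<Phi>" using le by metis
  qed
qed

lemma nn_integral_lborel_scaleR:
  fixes f :: "'a::euclidean_space \<Rightarrow> ennreal"
  assumes f: "f \<in> borel_measurable borel" and c: "c > 0"
  shows "(\<integral>\<^sup>+x. f x \<partial>lborel) = ennreal (c ^ DIM('a)) * (\<integral>\<^sup>+x. f (c *\<^sub>R x) \<partial>lborel)"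
proof -
  have fc: "(\<lambda>x. f (c *\<^sub>R x)) \<in> borel_measurable borel"
    by (rule measurable_compose[OF _ f]) simp
  have "(\<integral>\<^sup>+x. f x \<partial>lborel) = (\<integral>\<^sup>+x. f x \<partial>density (distr lborel borel (\<lambda>x::'a. 0 + c *\<^sub>R x)) (\<lambda>_. \<bar>c\<bar> ^ DIM('a)))"
    using c by (subst lborel_affine[of c 0]) auto
  also have "\<dots> = (\<integral>\<^sup>+x. ennreal (c ^ DIM('a)) * f (c *\<^sub>R x) \<partial>lborel)"
    using f fc c by (simp add: nn_integral_density nn_integral_distr ennreal_power)
  also have "\<dots> = ennreal (c ^ DIM('a)) * (\<integral>\<^sup>+x. f (c *\<^sub>R x) \<partial>lborel)"
    using fc by (intro nn_integral_cmult) simp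
  finally show ?thesis .
qed

text \<open>Both sides are measures on the line whose value on \<open>{..a}\<close> is a multiple of \<open>a ^ n\<close>.\<close>

lemma nn_integral_radial:
  fixes \<psi> :: "'a::euclidean_space \<Rightarrow> real"
  assumes \<psi>: "\<psi> \<in> borel_measurable borel" and pos: "\<And>x. 0 < \<psi> x" and le: "\<And>x. \<psi> x \<le> K"
    and hom: "\<And>c x. c > 0 \<Longrightarrow> \<psi> (c *\<^sub>R x) = \<psi> x" and m: "m > 0"
  obtains C where "0 < C" "\<And>g. g \<in> borel_measurable borel \<Longrightarrow>
    (\<integral>\<^sup>+x. g (m * norm x) * ennreal (\<psi> x) \<partial>lborel)
      = ennreal C * (\<integral>\<^sup>+t. g t * ennreal (t ^ (DIM('a) - 1)) * indicator {0<..} t \<partial>lborel)"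
proof -
  define n where "n = DIM('a)"
  have n: "n > 0" by (simp add: n_def)
  define I where "I a = (\<integral>\<^sup>+x. ennreal (\<psi> x) * indicator {x. m * norm x \<le> a} x \<partial>lborel)" for a
  have meas: "{x::'a. m * norm x \<le> a} \<in> sets borel" for a
    by (intro borel_closed closed_Collect_le continuous_intros)
  have fm: "(\<lambda>x. ennreal (\<psi> x) * indicator {x. m * norm x \<le> a} x) \<in> borel_measurable borel" for a
    by (intro borel_measurable_times_ennreal borel_measurable_indicator meas
      measurable_compose[OF \<psi> measurable_ennreal])
  have cb: "{x::'a. m * norm x \<le> a} = cball 0 (a / m)" for a
    using m by (auto simp: le_divide_eq mult.commute)
  \<comment> \<open>Scaling by \<open>a\<close> produces the volume factor \<open>a ^ n\<close>, and
    \<open>\<psi>\<close> is unchanged by homogeneity. All sublevel integrals are thus determined by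
    \<open>I 1\<close>.\<close>
  have Isc: "I a = ennreal (a ^ n) * I 1" if a: "a > 0" for a
  proof -
    have "I a = ennreal (a ^ DIM('a)) * (\<integral>\<^sup>+x. ennreal (\<psi> (a *\<^sub>R x)) * indicator {x. m * norm x \<le> a} (a *\<^sub>R x) \<partial>lborel)"
      unfolding I_def by (rule nn_integral_lborel_scaleR[OF fm a])
    also have "(\<integral>\<^sup>+x. ennreal (\<psi> (a *\<^sub>R x)) * indicator {x. m * norm x \<le> a} (a *\<^sub>R x) \<partial>lborel) = I 1"
      unfolding I_def using a by (intro nn_integral_cong) (auto simp: hom indicator_def mult.left_commute)
    finally show ?thesis by (simp add: n_def)
  qed
  have K: "0 < K" using pos[of 0] le[of 0] by simp
  have "I 1 \<le> (\<integral>\<^sup>+x. ennreal K * indicator (cball 0 (1 / m)) x \<partial>(lborel::'a measure))"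
    unfolding I_def cb using le K by (intro nn_integral_mono mult_right_mono ennreal_leI) auto
  also have "\<dots> = ennreal K * emeasure lborel (cball (0::'a) (1 / m))"
    by (simp add: nn_integral_cmult_indicator)
  also have "\<dots> < \<infinity>" using emeasure_lborel_cball_finite[of "0::'a" "1 / m"] by (auto simp: ennreal_mult_less_top)
  finally have Ifin: "I 1 < \<infinity>" .
  have nz: "ennreal (\<psi> x) \<noteq> 0" for x using pos[of x] by (simp add: ennreal_eq_0_iff not_le)
  have "I 1 \<noteq> 0"
  proof
    assume "I 1 = 0"
    then have "AE x in lborel. ennreal (\<psi> x) * indicator {x. m * norm x \<le> 1} x = 0"
      unfolding I_def using \<psi> meas by (subst (asm) nn_integral_0_iff_AE) auto
    then have "AE x in lborel. x \<notin> {x::'a. m * norm x \<le> 1}"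
      by eventually_elim (use nz in \<open>auto simp: indicator_def split: if_splits\<close>)
    then have "emeasure lborel {x::'a. m * norm x \<le> 1} = 0"
      using meas by (subst (asm) AE_iff_measurable[OF _ refl]) auto
    then have "measure lborel (cball (0::'a) (1 / m)) = 0" by (simp add: cb measure_def)
    then show False using content_cball_pos[of "1 / m" "0::'a"] m by simp
  qed
  define C0 where "C0 = enn2real (I 1)"
  have C0: "I 1 = ennreal C0" "0 < C0"
    using Ifin \<open>I 1 \<noteq> 0\<close> by (auto simp: C0_def enn2real_positive_iff less_top zero_less_iff_neq_zero)
  \<comment> \<open>The factor \<open>n\<close> comes from differentiating
    \<open>C0 * a ^ n\<close>, the mass of the half-line up to \<open>a\<close>.\<close>
  define C where "C = real n * C0"
  have C: "0 < C" using C0 n by (simp add: C_def)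
  define \<mu> where "\<mu> = distr (density lborel (\<lambda>x. ennreal (\<psi> x))) borel (\<lambda>x. m * norm x)"
  define \<nu> where "\<nu> = density lborel (\<lambda>t. ennreal C * (ennreal (t ^ (n - 1)) * indicator {0<..} t))"
  have \<mu>a: "emeasure \<mu> {..a} = I a" for a
  proof -
    have "emeasure \<mu> {..a} = emeasure (density lborel (\<lambda>x. ennreal (\<psi> x))) {x. m * norm x \<le> a}"
      unfolding \<mu>_def by (subst emeasure_distr) (auto simp: vimage_def)
    also have "\<dots> = I a" unfolding I_def using \<psi> meas by (subst emeasure_density) auto
    finally show ?thesis .
  qed
  have \<nu>a: "emeasure \<nu> {..a} = I a" for a
  proof (cases "a > 0")
    case True
    have "emeasure \<nu> {..a} = (\<integral>\<^sup>+t. ennreal C * (ennreal (t ^ (n - 1)) * indicator {0<..} t) * indicator {..a} t \<partial>lborel)"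
      unfolding \<nu>_def by (subst emeasure_density) auto
    also have "\<dots> = (\<integral>\<^sup>+t. ennreal (C * t ^ (n - 1)) * indicator {0..a} t \<partial>lborel)"
    proof (rule nn_integral_cong_AE)
      have "AE t::real in lborel. t \<noteq> 0" by (rule AE_lborel_singleton)
      then show "AE t in lborel. ennreal C * (ennreal (t ^ (n - 1)) * indicator {0<..} t) * indicator {..a} t
          = ennreal (C * t ^ (n - 1)) * indicator {0..a} t"
        by eventually_elim (use C in \<open>auto simp: indicator_def ennreal_mult\<close>)
    qed
    also have "\<dots> = ennreal (C0 * a ^ n - C0 * 0 ^ n)"
    proof (rule nn_integral_FTC_Icc)
      show "DERIV (\<lambda>t. C0 * t ^ n) t :> C * t ^ (n - 1)" for t
        by (auto intro!: derivative_eq_intros simp: C_def)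
    qed (use C True in auto)
    also have "\<dots> = I a" using n True C0 by (simp add: Isc[OF True] zero_power mult.commute flip: ennreal_mult)
    finally show ?thesis .
  next
    case False
    \<comment> \<open>For a <= 0 the sublevel set is at most the origin, which is null.\<close>
    have "x = 0" if "m * norm x \<le> a" for x :: 'a
    proof -
      have "m * norm x \<le> 0" using that False by linarith
      then show ?thesis using m by (simp add: mult_le_0_iff)
    qed
    then have "I a \<le> (\<integral>\<^sup>+x. ennreal K * indicator {0} x \<partial>(lborel::'a measure))"
      unfolding I_def using le by (intro nn_integral_mono) (auto simp: indicator_def ennreal_leI)
    then have "I a = 0" by (simp add: nn_integral_cmult_indicator)
    moreover have "emeasure \<nu> {..a} = (\<integral>\<^sup>+t. ennreal C * (ennreal (t ^ (n - 1)) * indicator {0<..} t) * indicator {..a} t \<partial>lborel)"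
      unfolding \<nu>_def by (subst emeasure_density) auto
    moreover have "\<dots> = (\<integral>\<^sup>+t. 0 \<partial>(lborel :: real measure))"
      using False by (intro nn_integral_cong) (auto simp: indicator_def)
    ultimately show ?thesis by simp
  qed
  have "\<mu> = \<nu>"
  proof (rule measure_eqI_generator_eq[where E = "range atMost" and A = "\<lambda>i. {..real i}" and \<Omega> = UNIV])
    show "Int_stable (range atMost :: real set set)"
      by (rule Int_stableI) (auto simp: Int_atMost)
    show "sets \<mu> = sigma_sets UNIV (range atMost)" "sets \<nu> = sigma_sets UNIV (range atMost)"
      by (simp_all add: \<mu>_def \<nu>_def borel_eq_atMost)
    show "(\<Union>i. {..real i}) = UNIV" using real_arch_simple by auto
    show "emeasure \<mu> {..real i} \<noteq> \<infinity>" for i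
    proof (cases "i = 0")
      case True
      have "I 0 \<le> I 1" unfolding I_def by (intro nn_integral_mono) (auto simp: indicator_def)
      then show ?thesis using Ifin True \<mu>a[of 0] by auto
    next
      case False then show ?thesis by (simp add: \<mu>a Isc[of "real i"] C0(1) ennreal_mult_eq_top_iff)
    qed
  qed (auto simp: \<mu>a \<nu>a)
  show ?thesis
  proof (rule that[OF C])
    fix g :: "real \<Rightarrow> ennreal" assume g: "g \<in> borel_measurable borel"
    have gt: "(\<lambda>t. g t * ennreal (t ^ (n - 1)) * indicator {0<..} t) \<in> borel_measurable borel"
      by (intro borel_measurable_times_ennreal borel_measurable_indicator g
          measurable_compose[OF _ measurable_ennreal] borel_measurable_power) auto
    have "(\<integral>\<^sup>+t. g t \<partial>\<mu>) = (\<integral>\<^sup>+x. g (m * norm x) * ennreal (\<psi> x) \<partial>lborel)"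
      unfolding \<mu>_def using g \<psi> by (simp add: nn_integral_distr nn_integral_density mult.commute)
    moreover have "(\<integral>\<^sup>+t. g t \<partial>\<nu>) = (\<integral>\<^sup>+t. ennreal C * (g t * ennreal (t ^ (n - 1)) * indicator {0<..} t) \<partial>lborel)"
      unfolding \<nu>_def using g by (simp add: nn_integral_density mult_ac)
    moreover have "\<dots> = ennreal C * (\<integral>\<^sup>+t. g t * ennreal (t ^ (n - 1)) * indicator {0<..} t \<partial>lborel)"
      using gt by (intro nn_integral_cmult) simp
    ultimately show "(\<integral>\<^sup>+x. g (m * norm x) * ennreal (\<psi> x) \<partial>lborel)
      = ennreal C * (\<integral>\<^sup>+t. g t * ennreal (t ^ (DIM('a) - 1)) * indicator {0<..} t \<partial>lborel)"
      using \<open>\<mu> = \<nu>\<close> by (simp add: n_def)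
  qed
qed

text \<open>The deviation from (1 - \<theta>) r is \<theta> r \<epsilon> / (r + \<epsilon>), between
  0 and \<epsilon>. This additive error controls where supports lie relative to the level sets of
  the distance.\<close>

lemma radial_dist_bounds:
  assumes lam: "lam > 1" and \<epsilon>: "\<epsilon> > 0" and r: "r \<ge> 0"
  shows "(1 - theta lam) * r \<le> radial_dist lam \<epsilon> r" "radial_dist lam \<epsilon> r \<le> (1 - theta lam) * r + \<epsilon>"
proof -
  have eq: "radial_dist lam \<epsilon> r = (1 - theta lam) * r + theta lam * (r * \<epsilon> / (r + \<epsilon>))"
    using \<epsilon> r by (simp add: radial_dist_def field_simps power2_eq_square)
  have "r * \<epsilon> / (r + \<epsilon>) \<le> \<epsilon>" using \<epsilon> r by (simp add: divide_le_eq algebra_simps)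
  then have "theta lam * (r * \<epsilon> / (r + \<epsilon>)) \<le> 1 * \<epsilon>"
    using theta_bounds[OF lam] \<epsilon> r by (intro mult_mono) auto
  moreover have "0 \<le> theta lam * (r * \<epsilon> / (r + \<epsilon>))" using theta_bounds[OF lam] \<epsilon> r by simp
  ultimately show "(1 - theta lam) * r \<le> radial_dist lam \<epsilon> r" "radial_dist lam \<epsilon> r \<le> (1 - theta lam) * r + \<epsilon>"
    unfolding eq by auto
qed

lemma radial_cutoff_test_function:
  assumes lam: "lam > 1" and \<epsilon>: "\<epsilon> > 0" and q: "real_polynomial_function q"
    and b: "0 \<le> b" and R: "ereal (sqrt b + \<epsilon>) < R"
  defines "m \<equiv> 1 - theta lam"
  shows "(\<lambda>x::'a::euclidean_space. cutoff a b (m\<^sup>2 * inner x x) * q (m\<^sup>2 * inner x x))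
    \<in> test_functions (Omega_eps lam \<epsilon> R)"
proof -
  let ?u = "\<lambda>x::'a. cutoff a b (m\<^sup>2 * inner x x) * q (m\<^sup>2 * inner x x)"
  have m: "m > 0" using theta_bounds[OF lam] by (simp add: m_def)
  have sub: "{x. ?u x \<noteq> 0} \<subseteq> cball 0 (sqrt b / m)"
  proof
    fix x assume "x \<in> {x. ?u x \<noteq> 0}"
    then have "cutoff a b (m\<^sup>2 * inner x x) \<noteq> 0" by simp
    then have "m\<^sup>2 * inner x x \<in> {a<..<b}" using cutoff_outside(1) by blast
    then have "m\<^sup>2 * inner x x \<le> b" by simp
    then have "(m * norm x)\<^sup>2 \<le> b" by (simp add: power_mult_distrib power2_norm_eq_inner)
    then have "m * norm x \<le> sqrt b" by (rule real_le_rsqrt)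
    then show "x \<in> cball 0 (sqrt b / m)" using m by (simp add: le_divide_eq mult.commute)
  qed
  then have cl: "closure {x. ?u x \<noteq> 0} \<subseteq> cball 0 (sqrt b / m)" by (rule closure_minimal) simp
  moreover have "cball (0::'a) (sqrt b / m) \<subseteq> Omega_eps lam \<epsilon> R"
  proof
    fix x :: 'a assume "x \<in> cball 0 (sqrt b / m)"
    then have "m * norm x \<le> sqrt b" using m by (simp add: le_divide_eq mult.commute)
    then have "rho_eps lam \<epsilon> x \<le> sqrt b + \<epsilon>"
      using radial_dist_bounds(2)[OF lam \<epsilon> norm_ge_zero, of x] by (simp add: rho_eps_eq[OF lam \<epsilon>] m_def)
    then show "x \<in> Omega_eps lam \<epsilon> R"
      using R order.strict_trans1[of "ereal (rho_eps lam \<epsilon> x)" "ereal (sqrt b + \<epsilon>)" R] by (simp add: Omega_eps_def)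
  qed
  moreover have "compact (closure {x. ?u x \<noteq> 0})"
    using bounded_subset[OF bounded_cball sub] by (simp add: compact_closure)
  ultimately show ?thesis
    unfolding test_functions_def using smooth_radial_cutoff[OF q, where c = "m\<^sup>2"] by blast
qed

lemma bounded_support_dominated_convergence:
  fixes s :: "nat \<Rightarrow> 'a::euclidean_space \<Rightarrow> real"
  assumes meas: "\<And>k. s k \<in> borel_measurable borel" "f \<in> borel_measurable borel"
    and lim: "AE x in lborel. (\<lambda>k. s k x) \<longlonglongrightarrow> f x"
    and bound: "\<And>k x. \<bar>s k x\<bar> \<le> D" and out: "\<And>k x. x \<notin> cball 0 r \<Longrightarrow> s k x = 0"
  shows "integrable lborel (s k)" "integrable lborel f"
    "(\<lambda>k. integral\<^sup>L lborel (s k)) \<longlonglongrightarrow> integral\<^sup>L lborel f"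
proof -
  let ?w = "\<lambda>x::'a. D * indicator (cball 0 r) x"
  have w: "integrable lborel ?w"
    using emeasure_lborel_cball_finite[of "0::'a" r] by (intro integrable_mult_right integrable_real_indicator) auto
  have le: "AE x in lborel. norm (s k x) \<le> ?w x" for k
    using bound out by (intro AE_I2) (auto simp: indicator_def)
  have m: "\<And>k. s k \<in> borel_measurable lborel" "f \<in> borel_measurable lborel" using meas by auto
  note dc = integral_dominated_convergence[OF m(2) m(1) w lim le]
    integrable_dominated_convergence[OF m(2) m(1) w lim le] integrable_dominated_convergence2[OF m(2) m(1) w lim le]
  show "(\<lambda>k. integral\<^sup>L lborel (s k)) \<longlonglongrightarrow> integral\<^sup>L lborel f" "integrable lborel f" "integrable lborel (s k)"
    using dc by auto
qed

lemma AE_norm_notin_finite: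
  assumes "finite T"
  shows "AE x::'a::euclidean_space in lborel. norm x \<notin> T"
proof -
  have "AE x::'a in lborel. norm x \<noteq> t" for t
  proof -
    have "sphere (0::'a) t \<in> null_sets lborel"
      using negligible_sphere[of "0::'a" t]
      by (simp add: negligible_iff_null_sets null_sets_completion_iff)
    then show ?thesis by (rule AE_not_in[THEN AE_mp]) (auto intro!: AE_I2)
  qed
  then have "AE x::'a in lborel. \<forall>t\<in>T. norm x \<noteq> t" using assms by (simp add: AE_finite_all)
  then show ?thesis by eventually_elim auto
qed

lemma nn_integral_BH_measure:
  fixes g :: "'a::euclidean_space \<Rightarrow> ennreal"
  assumes lam: "lam > 1" and \<epsilon>: "\<epsilon> > 0" and g: "g \<in> borel_measurable borel"
  shows "(\<integral>\<^sup>+x. g x \<partial>BH_measure (Feps lam \<epsilon>)) = (\<integral>\<^sup>+x. g x * ennreal (BH_density (Feps lam \<epsilon>) x) \<partial>lborel)"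
proof -
  have \<sigma>: "(\<lambda>x::'a. ennreal (BH_density (Feps lam \<epsilon>) x)) \<in> borel_measurable borel"
    using borel_measurable_continuous_onI[OF continuous_on_BH_density[OF lam \<epsilon>]] by measurable
  have "(\<integral>\<^sup>+x. g x \<partial>BH_measure (Feps lam \<epsilon>)) = (\<integral>\<^sup>+x. ennreal (BH_density (Feps lam \<epsilon>) x) * g x \<partial>lebesgue)"
    unfolding BH_measure_def using \<sigma> g
    by (intro nn_integral_density measurable_completion) auto
  also have "\<dots> = (\<integral>\<^sup>+x. ennreal (BH_density (Feps lam \<epsilon>) x) * g x \<partial>lborel)"
    using \<sigma> g by (intro nn_integral_completion) measurable
  finally show ?thesis by (simp add: mult.commute)
qed

section \<open>Reduction to a one-dimensional inequality\<close>

lemma tendsto_drift: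
  assumes "\<epsilon> \<longlonglongrightarrow> 0" "r > 0"
  shows "(\<lambda>k. drift lam (\<epsilon> k) r) \<longlonglongrightarrow> theta lam"
proof -
  have "(\<lambda>k. drift lam (\<epsilon> k) r) \<longlonglongrightarrow> theta lam * r * (r + 2 * 0) / (r + 0)\<^sup>2"
    unfolding drift_def using assms by (intro tendsto_intros) auto
  then show ?thesis using assms(2) by (simp add: power2_eq_square)
qed

lemma tendsto_radial_dist:
  assumes "\<epsilon> \<longlonglongrightarrow> 0" "r > 0"
  shows "(\<lambda>k. radial_dist lam (\<epsilon> k) r) \<longlonglongrightarrow> (1 - theta lam) * r"
proof -
  have "(\<lambda>k. radial_dist lam (\<epsilon> k) r) \<longlonglongrightarrow> r - theta lam * r\<^sup>2 / (r + 0)"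
    unfolding radial_dist_def using assms by (intro tendsto_intros) auto
  then show ?thesis using assms(2) by (simp add: power2_eq_square algebra_simps)
qed

text \<open>The weights are given only on the open interval. Freezing them outside a compact
  subinterval yields bounded continuous functions on the line, so measurability and domination
  become global.\<close>

lemma continuous_clamped_bounded:
  fixes w :: "real \<Rightarrow> real"
  assumes "continuous_on {lo..hi} w" "lo \<le> hi"
  obtains B where "0 \<le> B" "\<And>t. \<bar>w (max lo (min hi t))\<bar> \<le> B"
    "continuous_on UNIV (\<lambda>t. w (max lo (min hi t)))"
proof -
  have "bounded (w ` {lo..hi})"
    using assms(1) by (intro compact_imp_bounded compact_continuous_image) auto
  then obtain B where B: "\<forall>y\<in>w ` {lo..hi}. norm y \<le> B" unfolding bounded_iff by metis
  have le: "\<bar>w (max lo (min hi t))\<bar> \<le> B" for t using B assms(2) by simp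
  show ?thesis
  proof (rule that[of B])
    show "0 \<le> B" using le[of 0] by linarith
    show "continuous_on UNIV (\<lambda>t. w (max lo (min hi t)))"
      by (rule continuous_on_compose2[OF assms(1)]) (use assms(2) in \<open>auto intro!: continuous_intros\<close>)
  qed (rule le)
qed

text \<open>\<open>lam\<close> times the dual norm of a radial covector of slope \<open>\<kappa>\<close> at a point with drift \<open>b\<close>.\<close>

definition dual_speed :: "real \<Rightarrow> real \<Rightarrow> real \<Rightarrow> real" where
  "dual_speed lam b \<kappa> = lam * max (\<kappa> / (1 - b)) (- \<kappa> / (1 + b))"

lemma dual_speed_nonneg:
  assumes "lam > 1" "0 \<le> b" "b < 1"
  shows "0 \<le> dual_speed lam b \<kappa>"
  using assms by (cases "\<kappa> \<ge> 0") (auto simp: dual_speed_def le_max_iff_disj divide_nonpos_pos)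

lemma dual_speed_le:
  assumes "lam > 1" "0 \<le> b" "b \<le> \<beta>" "\<beta> < 1"
  shows "dual_speed lam b \<kappa> \<le> lam * (\<bar>\<kappa>\<bar> / (1 - \<beta>))"
proof -
  have "\<kappa> / (1 - b) \<le> \<bar>\<kappa>\<bar> / (1 - \<beta>)" using assms by (intro frac_le) auto
  moreover have "- \<kappa> / (1 + b) \<le> \<bar>\<kappa>\<bar> / (1 - \<beta>)" using assms by (intro frac_le) auto
  ultimately have "max (\<kappa> / (1 - b)) (- \<kappa> / (1 + b)) \<le> \<bar>\<kappa>\<bar> / (1 - \<beta>)" by (rule max.boundedI)
  then show ?thesis unfolding dual_speed_def using assms by (intro mult_left_mono) auto
qed

lemma dual_speed_zero [simp]: "dual_speed lam b 0 = 0"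
  by (simp add: dual_speed_def)

lemma theta_ratio: "lam > 1 \<Longrightarrow> lam * (1 - theta lam) = 1 + theta lam"
  by (simp add: theta_def field_simps)

text \<open>From \<lambda> (1 - \<theta>) = 1 + \<theta>. An increase of slope y costs \<lambda> y
  while a decrease costs exactly its size; this asymmetry is the source of sharpness for a
  decreasing profile.\<close>

lemma dual_speed_theta:
  assumes "lam > 1"
  shows "dual_speed lam (theta lam) ((1 - theta lam) * y) = max (lam * y) (- y)"
proof -
  have pos: "0 < 1 - theta lam" "0 < 1 + theta lam" using theta_bounds[OF assms] by auto
  have "lam * ((1 - theta lam) * y / (1 - theta lam)) = lam * y" using pos by simp
  moreover have "lam * (- ((1 - theta lam) * y) / (1 + theta lam)) = - y"
  proof -
    have "lam * (- ((1 - theta lam) * y) / (1 + theta lam)) = - (lam * (1 - theta lam)) * y / (1 + theta lam)"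
      by simp
    also have "\<dots> = - y"
      unfolding theta_ratio[OF assms] using pos(2)
      by (simp only: mult_minus_left minus_divide_left[symmetric] nonzero_mult_div_cancel_left less_imp_neq[THEN not_sym] not_False_eq_True)
    finally show ?thesis .
  qed
  moreover have "lam * max u v = max (lam * u) (lam * v)" for u v
    using assms by (simp add: max_mult_distrib_left)
  ultimately show ?thesis by (simp only: dual_speed_def)
qed

text \<open>
  The profile \<open>f\<close> is a function of the squared distance, so that composing it with the smooth
  function \<open>((1 - theta lam) * norm x)\<^sup>2\<close> causes no problem at the origin.
\<close>

lemma exists_violation_of_profile:
  fixes w W f f' :: "real \<Rightarrow> real" and R :: ereal
  assumes lam: "lam > 1" and p: "p > 0" and a: "0 < a" and ab: "a < b" and bR: "ereal (sqrt b) < R"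
    and w: "continuous_on (Jint R) w" and W: "continuous_on (Jint R) W"
    and wpos: "\<And>t. t \<in> Jint R \<Longrightarrow> 0 < w t" and Wpos: "\<And>t. t \<in> Jint R \<Longrightarrow> 0 < W t"
    and S: "finite S" and cont: "continuous_on UNIV f"
    and deriv: "\<And>s. s \<notin> S \<Longrightarrow> (f has_real_derivative f' s) (at s)"
    and bound: "\<And>s. s \<notin> S \<Longrightarrow> \<bar>f' s\<bar> \<le> M" and f'm: "f' \<in> borel_measurable borel"
    and out: "\<And>s. s \<notin> {a..b} \<Longrightarrow> f s = 0" "\<And>s. s \<notin> {a..b} \<Longrightarrow> f' s = 0"
    and c: "c > 0"
    and ineq: "(\<integral>\<^sup>+t. ennreal (w t * max (lam * (2 * t * f' (t\<^sup>2))) (- (2 * t * f' (t\<^sup>2))) powr p)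
          * ennreal (t ^ (DIM('a) - 1)) * indicator {0<..} t \<partial>lborel)
      < ennreal c * (\<integral>\<^sup>+t. ennreal (w t * W t * \<bar>f (t\<^sup>2)\<bar> powr p)
          * ennreal (t ^ (DIM('a) - 1)) * indicator {0<..} t \<partial>lborel)"
  shows "\<exists>\<epsilon>>0. \<exists>u \<in> test_functions (Omega_eps lam \<epsilon> R :: 'a::euclidean_space set).
     ennreal (lam powr p) *
       (\<integral>\<^sup>+ x \<in> Omega_eps lam \<epsilon> R.
          ennreal (w (rho_eps lam \<epsilon> x)
                   * dual_metric (Feps lam \<epsilon>) x (frechet_derivative u (at x)) powr p)
        \<partial>BH_measure (Feps lam \<epsilon>))
     < ennreal c *
       (\<integral>\<^sup>+ x \<in> Omega_eps lam \<epsilon> R.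
          ennreal (w (rho_eps lam \<epsilon> x) * W (rho_eps lam \<epsilon> x) * \<bar>u x\<bar> powr p)
        \<partial>BH_measure (Feps lam \<epsilon>))"
proof -

  \<comment> \<open>Parameters, clamped weights and integrands\<close>
  define m where "m = 1 - theta lam"
  have m: "0 < m" "m < 1" using theta_bounds[OF lam] by (auto simp: m_def)
  obtain hi where hi: "sqrt b < hi" "ereal hi < R" using ereal_dense2[OF bR] by auto
  \<comment> \<open>Half of the room between \<open>sqrt b\<close> and \<open>hi\<close> goes to
    widening the support to \<open>b' = \<beta>\<^sup>2\<close>, the other half absorbs the error
    \<epsilon> in the distance.\<close>
  define \<beta> where "\<beta> = (sqrt b + hi) / 2"
  have \<beta>: "sqrt b < \<beta>" "\<beta> < hi" using hi by (auto simp: \<beta>_def)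
  have b0: "0 < b" using a ab by simp
  have \<beta>pos: "0 < \<beta>" using \<beta> b0 by (smt (verit) real_sqrt_gt_zero)
  define a' b' where "a' = a / 2" and "b' = \<beta>\<^sup>2"
  define lo where "lo = sqrt a'"
  have a': "0 < a'" "a' < a" using a by (auto simp: a'_def)
  have bb': "b < b'" unfolding b'_def using \<beta> b0 by (metis less_imp_le real_sqrt_ge_zero real_sqrt_pow2 power_strict_mono zero_less_numeral)
  have sqb': "sqrt b' = \<beta>" using \<beta>pos by (simp add: b'_def)
  have lo: "0 < lo" "lo < hi"
  proof -
    show "0 < lo" using a' by (simp add: lo_def)
    have "lo < sqrt b" unfolding lo_def using a' ab by (intro real_sqrt_less_mono) simp
    then show "lo < hi" using hi by simp
  qed
  have KJ: "{lo..hi} \<subseteq> Jint R"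
    using lo hi by (auto simp: Jint_def intro: order.strict_trans1[of _ "ereal hi"])
  obtain q \<eta>' B where q: "\<And>k::nat. real_polynomial_function (q k)"
    and \<eta>d: "\<And>k s. ((\<lambda>s. cutoff a' b' s * q k s) has_real_derivative \<eta>' k s) (at s)"
    and \<eta>b: "\<And>k s. \<bar>cutoff a' b' s * q k s\<bar> \<le> B" and \<eta>'b: "\<And>k s. \<bar>\<eta>' k s\<bar> \<le> B"
    and \<eta>'c: "\<And>k. continuous_on UNIV (\<eta>' k)" and \<eta>'0: "\<And>k s. s \<notin> {a'..b'} \<Longrightarrow> \<eta>' k s = 0"
    and \<eta>lim: "\<And>s. (\<lambda>k. cutoff a' b' s * q k s) \<longlonglongrightarrow> f s"
    and \<eta>'lim: "\<And>s. s \<notin> S \<Longrightarrow> (\<lambda>k. \<eta>' k s) \<longlonglongrightarrow> f' s"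
    by (rule smooth_cutoff_approximation[OF a'(2) ab bb' S cont deriv bound out]) blast+
  define \<eta> where "\<eta> k s = cutoff a' b' s * q k s" for k s
  have \<eta>0: "\<eta> k s = 0" if "s \<notin> {a'..b'}" for k s
    using that unfolding \<eta>_def by (subst cutoff_outside) auto
  have \<eta>c: "continuous_on UNIV (\<eta> k)" for k
    using DERIV_isCont[OF \<eta>d[of k]] by (simp add: \<eta>_def[abs_def] continuous_on_eq_continuous_at)
  have B: "0 \<le> B" using \<eta>b[of 0 0] by linarith
  \<comment> \<open>On the supports of all approximations the distance stays in
    \<open>{lo..hi}\<close>, so clamping does not alter the integrals.\<close>
  define w1 where "w1 t = w (max lo (min hi t))" for t
  define W1 where "W1 t = W (max lo (min hi t))" for t
  obtain Bw where Bw: "0 \<le> Bw" "\<And>t. \<bar>w1 t\<bar> \<le> Bw" "continuous_on UNIV w1"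
    by (rule continuous_clamped_bounded[OF continuous_on_subset[OF w KJ] less_imp_le[OF lo(2)], folded w1_def]) blast+
  obtain BW where BW: "0 \<le> BW" "\<And>t. \<bar>W1 t\<bar> \<le> BW" "continuous_on UNIV W1"
    by (rule continuous_clamped_bounded[OF continuous_on_subset[OF W KJ] less_imp_le[OF lo(2)], folded W1_def]) blast+
  have w1m: "w1 \<in> borel_measurable borel" and W1m: "W1 \<in> borel_measurable borel"
    using Bw(3) BW(3) by (auto intro: borel_measurable_continuous_onI)
  have w1pos: "0 < w1 t" and W1pos: "0 < W1 t" for t
    using KJ lo(2) by (auto simp: w1_def W1_def intro!: wpos Wpos)
  have w1eq: "w1 t = w t" and W1eq: "W1 t = W t" if "t \<in> {lo..hi}" for t
    using that by (auto simp: w1_def W1_def)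
  define \<epsilon> where "\<epsilon> k = (hi - \<beta>) * inverse (real (Suc k))" for k
  have \<epsilon>: "0 < \<epsilon> k" "\<epsilon> k \<le> hi - \<beta>" for k using \<beta> by (auto simp: \<epsilon>_def mult_left_le inverse_le_1_iff)
  have "(\<lambda>k. (hi - \<beta>) * inverse (real (Suc k))) \<longlonglongrightarrow> (hi - \<beta>) * 0"
    by (intro tendsto_intros LIMSEQ_inverse_real_of_nat)
  then have \<epsilon>0: "\<epsilon> \<longlonglongrightarrow> 0" by (simp add: \<epsilon>_def[abs_def])
  define \<rho> where "\<rho> k x = radial_dist lam (\<epsilon> k) (norm x)" for k and x :: 'a
  define \<sigma> where "\<sigma> k x = BH_density (Feps lam (\<epsilon> k)) x" for k and x :: 'a
  define d where "d k x = drift lam (\<epsilon> k) (norm x)" for k and x :: 'a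
  define sq where "sq x = m\<^sup>2 * inner x x" for x :: 'a
  have sq: "sq x = (m * norm x)\<^sup>2" for x by (simp add: sq_def power_mult_distrib power2_norm_eq_inner)
  \<comment> \<open>The radial slope of the test function. With t = m |x| its limit is m times
    \<open>2 * t * f' (t\<^sup>2)\<close>, the derivative of \<open>f (t\<^sup>2)\<close> in
    t.\<close>
  define \<kappa> where "\<kappa> k x = 2 * m\<^sup>2 * norm x * \<eta>' k (sq x)" for k and x :: 'a
  define Ls where "Ls k x = w1 (\<rho> k x) * dual_speed lam (d k x) (\<kappa> k x) powr p * \<sigma> k x" for k x
  define Rs where "Rs k x = w1 (\<rho> k x) * W1 (\<rho> k x) * \<bar>\<eta> k (sq x)\<bar> powr p * \<sigma> k x" for k x
  define \<psi> where "\<psi> = (limit_density lam :: 'a \<Rightarrow> real)"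
  define gL where "gL t = w1 t * max (lam * (2 * t * f' (t\<^sup>2))) (- (2 * t * f' (t\<^sup>2))) powr p" for t
  define gR where "gR t = w1 t * W1 t * \<bar>f (t\<^sup>2)\<bar> powr p" for t
  define Li where "Li x = gL (m * norm x) * \<psi> x" for x
  define Ri where "Ri x = gR (m * norm x) * \<psi> x" for x
  have db: "0 \<le> d k x" "d k x \<le> theta lam" "d k x < 1" for k x
    using drift_bounds[OF lam \<epsilon>(1) norm_ge_zero, of k x] theta_bounds[OF lam] by (auto simp: d_def)
  have \<sigma>b: "0 < \<sigma> k x" "\<sigma> k x \<le> 2 ^ DIM('a)" for k x
    using BH_density_bounds[OF lam \<epsilon>(1), of k x] by (auto simp: \<sigma>_def)
  have \<psi>pos: "0 < \<psi> x" for x unfolding \<psi>_def by (rule limit_density_pos[OF lam])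
  have \<sigma>lim: "(\<lambda>k. \<sigma> k x) \<longlonglongrightarrow> \<psi> x" for x
    unfolding \<sigma>_def \<psi>_def by (rule tendsto_BH_density[OF lam \<epsilon>0 \<epsilon>(1)])
  have \<psi>le: "\<psi> x \<le> 2 ^ DIM('a)" for x
    by (rule LIMSEQ_le_const2[OF \<sigma>lim]) (use \<sigma>b in auto)
  have supp: "m * norm x \<in> {lo..\<beta>}" if "sq x \<in> {a'..b'}" for x
  proof -
    have "sqrt a' \<le> sqrt (sq x)" "sqrt (sq x) \<le> sqrt b'" using that by (auto intro: real_sqrt_le_mono)
    then show ?thesis using m by (simp add: sq lo_def sqb')
  qed
  have \<rho>K: "\<rho> k x \<in> {lo..hi}" if "sq x \<in> {a'..b'}" for k x
    using supp[OF that] radial_dist_bounds[OF lam \<epsilon>(1)[of k] norm_ge_zero, of x] \<epsilon>(2)[of k]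
    by (auto simp: \<rho>_def m_def)
  have far: "sq x \<notin> {a'..b'}" if "x \<notin> cball 0 (\<beta> / m)" for x
    using supp[of x] that m by (auto simp: field_simps)
  have \<rho>m: "\<rho> k \<in> borel_measurable borel" and dm: "d k \<in> borel_measurable borel" for k
    unfolding \<rho>_def radial_dist_def d_def drift_def by measurable
  have sqm: "sq \<in> borel_measurable borel" unfolding sq_def by measurable
  have \<eta>'m: "\<eta>' k \<in> borel_measurable borel" and \<eta>m: "\<eta> k \<in> borel_measurable borel" for k
    using \<eta>'c \<eta>c by (auto intro: borel_measurable_continuous_onI)
  have \<kappa>m: "\<kappa> k \<in> borel_measurable borel" for k
    unfolding \<kappa>_def using measurable_compose[OF sqm \<eta>'m] by measurable
  have \<sigma>m: "\<sigma> k \<in> borel_measurable borel" for k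
    unfolding \<sigma>_def by (intro borel_measurable_continuous_onI continuous_on_BH_density lam \<epsilon>)
  have \<psi>m: "\<psi> \<in> borel_measurable borel"
    unfolding \<psi>_def by (rule borel_measurable_limit_density[OF lam])
  have dsm: "(\<lambda>x. dual_speed lam (d k x) (\<kappa> k x)) \<in> borel_measurable borel" for k
    unfolding dual_speed_def using dm \<kappa>m by measurable
  have Lsm: "Ls k \<in> borel_measurable borel" for k
    unfolding Ls_def using measurable_compose[OF \<rho>m w1m] dsm \<sigma>m by measurable
  have Rsm: "Rs k \<in> borel_measurable borel" for k
    unfolding Rs_def
    using measurable_compose[OF \<rho>m w1m] measurable_compose[OF \<rho>m W1m] measurable_compose[OF sqm \<eta>m] \<sigma>m
    by measurable
  have fm: "f \<in> borel_measurable borel" using cont by (rule borel_measurable_continuous_onI)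
  have sqr: "(\<lambda>t::real. t\<^sup>2) \<in> borel_measurable borel" by measurable
  have gLm: "gL \<in> borel_measurable borel"
    unfolding gL_def using measurable_compose[OF sqr f'm] w1m by measurable
  have gRm: "gR \<in> borel_measurable borel"
    unfolding gR_def using measurable_compose[OF sqr fm] w1m W1m by measurable
  have mn: "(\<lambda>x::'a. m * norm x) \<in> borel_measurable borel" by measurable
  have Lim: "Li \<in> borel_measurable borel" and Rim: "Ri \<in> borel_measurable borel"
    unfolding Li_def Ri_def using measurable_compose[OF mn gLm] measurable_compose[OF mn gRm] \<psi>m by measurable

  \<comment> \<open>Pointwise limits of the integrands\<close>
  have limits: "(\<lambda>k. Ls k x) \<longlonglongrightarrow> Li x" "(\<lambda>k. Rs k x) \<longlonglongrightarrow> Ri x" if x: "x \<noteq> 0" "sq x \<notin> S" for x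
  proof -
    have nx: "0 < norm x" using x by simp
    have \<rho>l: "(\<lambda>k. \<rho> k x) \<longlonglongrightarrow> m * norm x"
      unfolding \<rho>_def m_def by (rule tendsto_radial_dist[OF \<epsilon>0 nx])
    have wl: "(\<lambda>k. w1 (\<rho> k x)) \<longlonglongrightarrow> w1 (m * norm x)" "(\<lambda>k. W1 (\<rho> k x)) \<longlonglongrightarrow> W1 (m * norm x)"
      by (rule continuous_on_tendsto_compose[OF Bw(3) \<rho>l] continuous_on_tendsto_compose[OF BW(3) \<rho>l]; simp)+
    have dl: "(\<lambda>k. d k x) \<longlonglongrightarrow> theta lam" unfolding d_def by (rule tendsto_drift[OF \<epsilon>0 nx])
    have "(\<lambda>k. \<kappa> k x) \<longlonglongrightarrow> 2 * m\<^sup>2 * norm x * f' (sq x)"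
      unfolding \<kappa>_def by (rule tendsto_mult[OF tendsto_const \<eta>'lim[OF x(2)]])
    moreover have "2 * m\<^sup>2 * norm x * f' (sq x) = (1 - theta lam) * (2 * (m * norm x) * f' ((m * norm x)\<^sup>2))"
      unfolding sq m_def[symmetric] by (simp add: power2_eq_square)
    ultimately have \<kappa>l: "(\<lambda>k. \<kappa> k x) \<longlonglongrightarrow> (1 - theta lam) * (2 * (m * norm x) * f' ((m * norm x)\<^sup>2))"
      by (simp only:)
    have "(\<lambda>k. dual_speed lam (d k x) (\<kappa> k x))
        \<longlonglongrightarrow> dual_speed lam (theta lam) ((1 - theta lam) * (2 * (m * norm x) * f' ((m * norm x)\<^sup>2)))"
      unfolding dual_speed_def using theta_bounds[OF lam] by (intro tendsto_intros dl \<kappa>l) auto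
    \<comment> \<open>The limit of the base may be 0, so continuity of the power uses p > 0 and
      nonnegativity of the bases.\<close>
    then have sp: "(\<lambda>k. dual_speed lam (d k x) (\<kappa> k x) powr p)
      \<longlonglongrightarrow> max (lam * (2 * (m * norm x) * f' ((m * norm x)\<^sup>2))) (- (2 * (m * norm x) * f' ((m * norm x)\<^sup>2))) powr p"
      unfolding dual_speed_theta[OF lam]
      by (rule tendsto_powr'[OF _ tendsto_const]) (intro disjI2 conjI p always_eventually allI dual_speed_nonneg[OF lam db(1,3)])
    show "(\<lambda>k. Ls k x) \<longlonglongrightarrow> Li x"
      unfolding Ls_def Li_def gL_def by (rule tendsto_mult[OF tendsto_mult[OF wl(1) sp] \<sigma>lim])
    have "(\<lambda>k. \<bar>\<eta> k (sq x)\<bar>) \<longlonglongrightarrow> \<bar>f (sq x)\<bar>" unfolding \<eta>_def by (rule tendsto_rabs[OF \<eta>lim])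
    then have rp: "(\<lambda>k. \<bar>\<eta> k (sq x)\<bar> powr p) \<longlonglongrightarrow> \<bar>f (sq x)\<bar> powr p"
      by (rule tendsto_powr'[OF _ tendsto_const]) (intro disjI2 conjI p always_eventually allI abs_ge_zero)
    show "(\<lambda>k. Rs k x) \<longlonglongrightarrow> Ri x"
      unfolding Rs_def Ri_def gR_def sq[symmetric]
      by (rule tendsto_mult[OF tendsto_mult[OF tendsto_mult[OF wl] rp] \<sigma>lim])
  qed
  \<comment> \<open>The breakpoints of the profile correspond to finitely many spheres, which are
    null sets, as is the origin.\<close>
  have "AE x::'a in lborel. norm x \<notin> (\<lambda>s. sqrt s / m) ` S \<union> {0}"
    using S by (intro AE_norm_notin_finite) simp
  then have ae: "AE x::'a in lborel. x \<noteq> 0 \<and> sq x \<notin> S"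
  proof eventually_elim
    case (elim x)
    have "norm x = sqrt (sq x) / m" using m by (simp add: sq)
    with elim show ?case by auto
  qed

  \<comment> \<open>Domination and convergence of the integrals\<close>
  define D where "D = Bw * (lam * (2 * m\<^sup>2 * (\<beta> / m) * B / m)) powr p * 2 ^ DIM('a)"
  \<comment> \<open>The factors of \<open>D\<close> bound the weight, the dual speed and the
    density. Inside the speed, the slope is at most \<open>2 * m\<^sup>2 * (\<beta> / m) * B\<close>
    and the last division by \<open>m\<close> is the one by 1 - \<theta>.\<close>
  have Lsb: "\<bar>Ls k x\<bar> \<le> D" for k x
  proof (cases "x \<in> cball 0 (\<beta> / m)")
    case True
    have "\<bar>\<kappa> k x\<bar> \<le> 2 * m\<^sup>2 * (\<beta> / m) * B"
      unfolding \<kappa>_def abs_mult using True \<eta>'b B m \<beta>pos by (intro mult_mono) auto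
    then have "dual_speed lam (d k x) (\<kappa> k x) \<le> lam * (2 * m\<^sup>2 * (\<beta> / m) * B / m)"
      using dual_speed_le[OF lam db(1,2) theta_bounds(2)[OF lam], of k x "\<kappa> k x"] lam m
      by (smt (verit) divide_right_mono mult_left_mono m_def)
    then have "dual_speed lam (d k x) (\<kappa> k x) powr p \<le> (lam * (2 * m\<^sup>2 * (\<beta> / m) * B / m)) powr p"
      using dual_speed_nonneg[OF lam db(1,3)] p by (intro powr_mono2) auto
    then show ?thesis
      unfolding Ls_def D_def abs_mult using Bw \<sigma>b(2)[of k x] \<sigma>b(1)[of k x] by (intro mult_mono) auto
  next
    case False
    then show ?thesis using far[OF False] Bw p by (simp add: Ls_def \<kappa>_def \<eta>'0 D_def)
  qed
  have Rsb: "\<bar>Rs k x\<bar> \<le> Bw * BW * B powr p * 2 ^ DIM('a)" for k x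
    unfolding Rs_def abs_mult
    using Bw BW \<sigma>b(2)[of k x] \<sigma>b(1)[of k x] \<eta>b[of "sq x" k] p
    by (intro mult_mono) (auto simp: \<eta>_def intro!: powr_mono2)
  have Ls0: "Ls k x = 0" and Rs0: "Rs k x = 0" if "x \<notin> cball 0 (\<beta> / m)" for k x
    using far[OF that] by (auto simp: Ls_def Rs_def \<kappa>_def \<eta>'0 \<eta>0)
  have aeL: "AE x in lborel. (\<lambda>k. Ls k x) \<longlonglongrightarrow> Li x" and aeR: "AE x in lborel. (\<lambda>k. Rs k x) \<longlonglongrightarrow> Ri x"
    by (rule AE_mp[OF ae], rule AE_I2, use limits in blast)+
  note dL = bounded_support_dominated_convergence[OF Lsm Lim aeL Lsb Ls0]
  note dR = bounded_support_dominated_convergence[OF Rsm Rim aeR Rsb Rs0]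
  have Ls_nn: "0 \<le> Ls k x" and Rs_nn: "0 \<le> Rs k x" for k x
    using w1pos W1pos \<sigma>b(1)[of k x] by (auto simp: Ls_def Rs_def less_imp_le)
  have w1nn: "0 \<le> w1 t" and W1nn: "0 \<le> W1 t" for t using w1pos W1pos by (auto intro: less_imp_le)
  have gLpos: "0 \<le> gL t" for t
    unfolding gL_def by (rule mult_nonneg_nonneg[OF w1nn powr_ge_zero])
  have gRpos: "0 \<le> gR t" for t
    unfolding gR_def by (rule mult_nonneg_nonneg[OF mult_nonneg_nonneg[OF w1nn W1nn] powr_ge_zero])
  have \<psi>nn: "0 \<le> \<psi> x" for x using \<psi>pos by (rule less_imp_le)
  have Li_nn: "0 \<le> Li x" and Ri_nn: "0 \<le> Ri x" for x
    unfolding Li_def Ri_def by (rule mult_nonneg_nonneg[OF gLpos \<psi>nn] mult_nonneg_nonneg[OF gRpos \<psi>nn])+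

  \<comment> \<open>Polar integration and the choice of the index\<close>
  have \<psi>hom: "\<psi> (r *\<^sub>R x) = \<psi> x" if "r > 0" for r x
    unfolding \<psi>_def by (rule limit_density_scaleR[OF lam that])
  note radial = nn_integral_radial[OF \<psi>m \<psi>pos \<psi>le \<psi>hom m(1)]
  obtain C where C: "0 < C" "\<And>g. g \<in> borel_measurable borel \<Longrightarrow>
    (\<integral>\<^sup>+x. g (m * norm x) * ennreal (\<psi> x) \<partial>lborel)
      = ennreal C * (\<integral>\<^sup>+t. g t * ennreal (t ^ (DIM('a) - 1)) * indicator {0<..} t \<partial>lborel)"
  proof (rule radial)
    fix C assume C: "0 < C" and *: "\<And>g. g \<in> borel_measurable borel \<Longrightarrow>
      (\<integral>\<^sup>+x. g (m * norm x) * ennreal (\<psi> x) \<partial>lborel)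
        = ennreal C * (\<integral>\<^sup>+t. g t * ennreal (t ^ (DIM('a) - 1)) * indicator {0<..} t \<partial>lborel)"
    show thesis by (rule that[OF C *])
  qed
  have mid: "t \<in> {lo..hi}" if "t > 0" "t\<^sup>2 \<in> {a..b}" for t
  proof -
    have "sqrt a' \<le> t" using that a' by (intro real_le_lsqrt) auto
    moreover have "t \<le> sqrt b" using that by (intro real_le_rsqrt) auto
    ultimately show ?thesis using hi by (simp add: lo_def)
  qed
  define hL where "hL t = w t * max (lam * (2 * t * f' (t\<^sup>2))) (- (2 * t * f' (t\<^sup>2))) powr p" for t
  define hR where "hR t = w t * W t * \<bar>f (t\<^sup>2)\<bar> powr p" for t
  \<comment> \<open>Clamped and original weights agree where the profile lives; elsewhere the
    profile and its derivative are 0, so both integrands vanish.\<close>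
  have gh: "gL t = hL t \<and> gR t = hR t" if "t > 0" for t
  proof (cases "t\<^sup>2 \<in> {a..b}")
    case True
    show ?thesis
      unfolding gL_def gR_def hL_def hR_def w1eq[OF mid[OF that True]] W1eq[OF mid[OF that True]] by blast
  next
    case False
    show ?thesis
      unfolding gL_def gR_def hL_def hR_def out(1)[OF False] out(2)[OF False] using p by simp
  qed
  have gLeq: "ennreal (gL t) * ennreal (t ^ (DIM('a) - 1)) * indicator {0<..} t
      = ennreal (hL t) * ennreal (t ^ (DIM('a) - 1)) * indicator {0<..} t"
    and gReq: "ennreal (gR t) * ennreal (t ^ (DIM('a) - 1)) * indicator {0<..} t
      = ennreal (hR t) * ennreal (t ^ (DIM('a) - 1)) * indicator {0<..} t" for t
    using gh[of t] by (auto simp: indicator_def)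
  note CL = C(2)[OF measurable_compose[OF gLm measurable_ennreal]]
    and CR = C(2)[OF measurable_compose[OF gRm measurable_ennreal]]
  have "ennreal (integral\<^sup>L lborel Li) = (\<integral>\<^sup>+x. ennreal (Li x) \<partial>lborel)"
    using dL(2) Li_nn by (intro nn_integral_eq_integral[symmetric]) auto
  also have "\<dots> = (\<integral>\<^sup>+x. ennreal (gL (m * norm x)) * ennreal (\<psi> x) \<partial>lborel)"
    unfolding Li_def by (simp only: ennreal_mult[OF gLpos \<psi>nn])
  also have "\<dots> = ennreal C * (\<integral>\<^sup>+t. ennreal (gL t) * ennreal (t ^ (DIM('a) - 1)) * indicator {0<..} t \<partial>lborel)"
    by (rule CL)
  \<comment> \<open>The same positive constant \<open>C\<close> multiplies both sides, so the
    one-dimensional inequality transfers unchanged.\<close>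
  also have "\<dots> < ennreal C * (ennreal c * (\<integral>\<^sup>+t. ennreal (gR t) * ennreal (t ^ (DIM('a) - 1)) * indicator {0<..} t \<partial>lborel))"
    unfolding gLeq gReq
    by (intro ennreal_mult_strict_left_mono ineq[folded hL_def hR_def]) (use C(1) in auto)
  also have "\<dots> = ennreal c * (\<integral>\<^sup>+x. ennreal (gR (m * norm x)) * ennreal (\<psi> x) \<partial>lborel)"
    unfolding CR by (rule mult.left_commute)
  also have "\<dots> = ennreal c * (\<integral>\<^sup>+x. ennreal (Ri x) \<partial>lborel)"
    unfolding Ri_def by (simp only: ennreal_mult[OF gRpos \<psi>nn])
  also have "\<dots> = ennreal c * ennreal (integral\<^sup>L lborel Ri)"
    using dR(2) Ri_nn by (subst nn_integral_eq_integral) auto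
  also have "\<dots> = ennreal (c * integral\<^sup>L lborel Ri)"
    using c Ri_nn by (simp add: ennreal_mult)
  finally have "integral\<^sup>L lborel Li < c * integral\<^sup>L lborel Ri"
    using Li_nn by (simp add: ennreal_less_iff)
  then have "0 < c * integral\<^sup>L lborel Ri - integral\<^sup>L lborel Li" by simp
  moreover have "(\<lambda>k. c * integral\<^sup>L lborel (Rs k) - integral\<^sup>L lborel (Ls k))
      \<longlonglongrightarrow> c * integral\<^sup>L lborel Ri - integral\<^sup>L lborel Li"
    by (intro tendsto_intros dL(3) dR(3))
  ultimately have "\<forall>\<^sub>F k in sequentially. 0 < c * integral\<^sup>L lborel (Rs k) - integral\<^sup>L lborel (Ls k)"
    by (rule order_tendstoD(1)[rotated])
  then obtain k where k: "integral\<^sup>L lborel (Ls k) < c * integral\<^sup>L lborel (Rs k)"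
    by (auto simp: eventually_sequentially)

  \<comment> \<open>Comparison with the Finsler integrals\<close>
  let ?\<Omega> = "Omega_eps lam (\<epsilon> k) R :: 'a set"
  define u where "u x = \<eta> k (sq x)" for x
  have u: "u \<in> test_functions ?\<Omega>"
  proof -
    have "ereal (sqrt b' + \<epsilon> k) < R"
      using order.strict_trans1[OF _ hi(2)] \<epsilon>(2)[of k] by (simp add: sqb')
    then show ?thesis
      using radial_cutoff_test_function[OF lam \<epsilon>(1) q, where b = b' and R = R and a = a'] by (simp add: u_def[abs_def] \<eta>_def sq_def m_def b'_def)
  qed
  have du: "frechet_derivative u (at x) = (\<lambda>y. \<kappa> k x * (inner x y / norm x))" for x
  proof -
    have "(sq has_derivative (\<lambda>y. 2 * m\<^sup>2 * inner x y)) (at x)"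
      unfolding sq_def[abs_def] by (auto intro!: derivative_eq_intros simp: inner_commute)
    from has_derivative_compose[OF this \<eta>d[of k "sq x", folded \<eta>_def, unfolded has_field_derivative_def]]
    have "(u has_derivative (\<lambda>y. \<eta>' k (sq x) * (2 * m\<^sup>2 * inner x y))) (at x)"
      unfolding u_def[abs_def] by simp
    then have "frechet_derivative u (at x) = (\<lambda>y. \<eta>' k (sq x) * (2 * m\<^sup>2 * inner x y))"
      by (rule frechet_derivative_at[symmetric])
    also have "\<dots> = (\<lambda>y. \<kappa> k x * (inner x y / norm x))" by (auto simp: \<kappa>_def)
    finally show ?thesis .
  qed
  have \<rho>eq: "rho_eps lam (\<epsilon> k) x = \<rho> k x" for x :: 'a by (simp add: \<rho>_def rho_eps_eq[OF lam \<epsilon>(1)])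
  have left: "ennreal (lam powr p) *
       (\<integral>\<^sup>+ x \<in> ?\<Omega>. ennreal (w (rho_eps lam (\<epsilon> k) x)
                   * dual_metric (Feps lam (\<epsilon> k)) x (frechet_derivative u (at x)) powr p)
        \<partial>BH_measure (Feps lam (\<epsilon> k))) \<le> ennreal (integral\<^sup>L lborel (Ls k))"
  proof -
    let ?g = "\<lambda>x. w1 (\<rho> k x) * dual_speed lam (d k x) (\<kappa> k x) powr p"
    have scaled: "(\<lambda>x. ennreal (?g x / lam powr p)) \<in> borel_measurable borel"
      using measurable_compose[OF \<rho>m w1m] dsm by measurable
    have pt: "ennreal (w (rho_eps lam (\<epsilon> k) x) * dual_metric (Feps lam (\<epsilon> k)) x (frechet_derivative u (at x)) powr p) * indicator ?\<Omega> x
        \<le> ennreal (?g x / lam powr p)" for x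
    proof (cases "\<kappa> k x = 0")
      \<comment> \<open>Here \<open>x\<close> may be the origin or lie off the support, where
        \<open>w\<close> and \<open>w1\<close> can differ; the differential is 0 and settles
        both.\<close>
      case True
      then show ?thesis using p by (simp add: du dual_metric_zero)
    next
      case False
      then have "sq x \<in> {a'..b'}" and x0: "x \<noteq> 0" using \<eta>'0[of "sq x" k] by (auto simp: \<kappa>_def)
      then have weq: "w (\<rho> k x) = w1 (\<rho> k x)" using w1eq[OF \<rho>K] by simp
      let ?F = "dual_metric (Feps lam (\<epsilon> k)) x (frechet_derivative u (at x))"
      have F: "0 \<le> ?F" "?F \<le> dual_speed lam (d k x) (\<kappa> k x) / lam"
        unfolding du using dual_metric_radial_bounds[OF lam \<epsilon>(1)[of k] x0, of "\<kappa> k x"] lam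
        by (auto simp: dual_speed_def d_def)
      have "?F powr p \<le> (dual_speed lam (d k x) (\<kappa> k x) / lam) powr p"
        using F p by (intro powr_mono2) auto
      also have "\<dots> = dual_speed lam (d k x) (\<kappa> k x) powr p / lam powr p"
        by (rule powr_divide)
      finally have "w (rho_eps lam (\<epsilon> k) x) * ?F powr p \<le> ?g x / lam powr p"
        unfolding \<rho>eq weq times_divide_eq_right[symmetric] using w1pos[of "\<rho> k x"] by (intro mult_left_mono) auto
      then show ?thesis by (auto simp: indicator_def intro: ennreal_leI)
    qed
    have "ennreal (lam powr p) *
       (\<integral>\<^sup>+ x \<in> ?\<Omega>. ennreal (w (rho_eps lam (\<epsilon> k) x)
                   * dual_metric (Feps lam (\<epsilon> k)) x (frechet_derivative u (at x)) powr p)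
        \<partial>BH_measure (Feps lam (\<epsilon> k)))
      \<le> ennreal (lam powr p) * (\<integral>\<^sup>+ x. ennreal (?g x / lam powr p) \<partial>BH_measure (Feps lam (\<epsilon> k)))"
      by (intro mult_left_mono nn_integral_mono pt) auto
    also have "\<dots> = ennreal (lam powr p) * (\<integral>\<^sup>+ x. ennreal (?g x / lam powr p) * ennreal (\<sigma> k x) \<partial>lborel)"
      unfolding \<sigma>_def by (subst nn_integral_BH_measure[OF lam \<epsilon>(1) scaled]) simp
    also have "\<dots> = (\<integral>\<^sup>+ x. ennreal (lam powr p) * (ennreal (?g x / lam powr p) * ennreal (\<sigma> k x)) \<partial>lborel)"
    proof (rule nn_integral_cmult[symmetric])
      show "(\<lambda>x. ennreal (?g x / lam powr p) * ennreal (\<sigma> k x)) \<in> borel_measurable lborel"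
        using scaled \<sigma>m[of k] by simp
    qed
    also have "\<dots> = (\<integral>\<^sup>+ x. ennreal (Ls k x) \<partial>lborel)"
    proof (rule nn_integral_cong)
      fix x
      have nn: "0 \<le> ?g x / lam powr p" "0 \<le> \<sigma> k x" "0 \<le> lam powr p"
        using w1nn[of "\<rho> k x"] \<sigma>b(1)[of k x] by auto
      have "ennreal (lam powr p) * (ennreal (?g x / lam powr p) * ennreal (\<sigma> k x))
          = ennreal (lam powr p * (?g x / lam powr p * \<sigma> k x))"
        by (simp only: ennreal_mult[OF nn(3) mult_nonneg_nonneg[OF nn(1,2)]] ennreal_mult[OF nn(1,2)])
      also have "lam powr p * (?g x / lam powr p * \<sigma> k x) = Ls k x" using lam by (simp add: Ls_def)
      finally show "ennreal (lam powr p) * (ennreal (?g x / lam powr p) * ennreal (\<sigma> k x)) = ennreal (Ls k x)" .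
    qed
    also have "\<dots> = ennreal (integral\<^sup>L lborel (Ls k))"
      using dL(1) Ls_nn by (intro nn_integral_eq_integral) auto
    finally show ?thesis .
  qed
  have right: "ennreal (integral\<^sup>L lborel (Rs k)) =
      (\<integral>\<^sup>+ x \<in> ?\<Omega>. ennreal (w (rho_eps lam (\<epsilon> k) x) * W (rho_eps lam (\<epsilon> k) x) * \<bar>u x\<bar> powr p)
        \<partial>BH_measure (Feps lam (\<epsilon> k)))"
  proof -
    let ?g = "\<lambda>x. w1 (\<rho> k x) * W1 (\<rho> k x) * \<bar>u x\<bar> powr p"
    have gm: "(\<lambda>x. ennreal (?g x)) \<in> borel_measurable borel"
      unfolding u_def
      using measurable_compose[OF \<rho>m w1m] measurable_compose[OF \<rho>m W1m] measurable_compose[OF sqm \<eta>m]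
      by measurable
    have "(\<integral>\<^sup>+ x \<in> ?\<Omega>. ennreal (w (rho_eps lam (\<epsilon> k) x) * W (rho_eps lam (\<epsilon> k) x) * \<bar>u x\<bar> powr p)
        \<partial>BH_measure (Feps lam (\<epsilon> k))) = (\<integral>\<^sup>+ x. ennreal (?g x) \<partial>BH_measure (Feps lam (\<epsilon> k)))"
    proof (rule nn_integral_cong)
      fix x
      show "ennreal (w (rho_eps lam (\<epsilon> k) x) * W (rho_eps lam (\<epsilon> k) x) * \<bar>u x\<bar> powr p) * indicator ?\<Omega> x = ennreal (?g x)"
      proof (cases "u x = 0")
        case True then show ?thesis using p by simp
      next
        case False
        then have "sq x \<in> {a'..b'}" using \<eta>0[of "sq x" k] by (auto simp: u_def)
        then have "w (\<rho> k x) = w1 (\<rho> k x)" "W (\<rho> k x) = W1 (\<rho> k x)" using w1eq[OF \<rho>K] W1eq[OF \<rho>K] by auto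
        moreover have "x \<in> ?\<Omega>"
          using False u closure_subset[of "{x. u x \<noteq> 0}"] by (auto simp: test_functions_def)
        ultimately show ?thesis by (simp add: \<rho>eq)
      qed
    qed
    also have "\<dots> = (\<integral>\<^sup>+ x. ennreal (?g x) * ennreal (\<sigma> k x) \<partial>lborel)"
      unfolding \<sigma>_def by (rule nn_integral_BH_measure[OF lam \<epsilon>(1) gm])
    also have "\<dots> = (\<integral>\<^sup>+ x. ennreal (Rs k x) \<partial>lborel)"
      using w1pos W1pos \<sigma>b(1) by (intro nn_integral_cong) (simp add: Rs_def u_def less_imp_le flip: ennreal_mult)
    also have "\<dots> = ennreal (integral\<^sup>L lborel (Rs k))"
      using dR(1) Rs_nn by (intro nn_integral_eq_integral) auto
    finally show ?thesis by simp
  qed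
  have "ennreal (integral\<^sup>L lborel (Ls k)) < ennreal (c * integral\<^sup>L lborel (Rs k))"
    using k Ls_nn by (simp add: ennreal_less_iff)
  then have "ennreal (integral\<^sup>L lborel (Ls k)) < ennreal c * ennreal (integral\<^sup>L lborel (Rs k))"
    using c Rs_nn by (simp add: ennreal_mult)
  with left show ?thesis
    unfolding right using u \<epsilon>(1) by (meson order.strict_trans1)
qed

section \<open>The extremal profile\<close>

lemma C1_on_continuous:
  assumes "C1_on T f" "S \<subseteq> T"
  shows "continuous_on S f" "continuous_on S (deriv f)"
proof -
  have "isCont f t" if "t \<in> T" for t
    using assms(1) that by (simp add: C1_on_def field_differentiable_imp_continuous_at)
  then show "continuous_on S f" using assms(2) by (intro continuous_at_imp_continuous_on) blast
  show "continuous_on S (deriv f)" using assms by (metis C1_on_def continuous_on_subset)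
qed

lemma nn_integral_Icc_continuous:
  fixes h :: "real \<Rightarrow> real"
  assumes "continuous_on {a..b} h" "\<And>t. t \<in> {a..b} \<Longrightarrow> 0 \<le> h t"
  shows "(\<integral>\<^sup>+t. ennreal (h t) * indicator {a..b} t \<partial>lborel) = ennreal (integral {a..b} h)"
  by (rule nn_integral_has_integral_lebesgue'[OF assms(2) integrable_integral[OF integrable_continuous_real[OF assms(1)]]])

lemma borel_measurable_ennreal_Icc:
  fixes h :: "real \<Rightarrow> real"
  assumes "continuous_on {a..b} h"
  shows "(\<lambda>t. ennreal (h t) * indicator {a..b} t) \<in> borel_measurable borel"
proof -
  have "(\<lambda>t. ennreal (indicator {a..b} t *\<^sub>R h t)) \<in> borel_measurable borel"
    using borel_measurable_continuous_on_indicator[OF _ assms] by (intro measurable_compose[OF _ measurable_ennreal]) auto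
  moreover have "(\<lambda>t. ennreal (indicator {a..b} t *\<^sub>R h t)) = (\<lambda>t. ennreal (h t) * indicator {a..b} t)"
    by (auto simp: indicator_def)
  ultimately show ?thesis by simp
qed

lemma integral_pos_continuous:
  fixes h :: "real \<Rightarrow> real"
  assumes "continuous_on {a..b} h" "\<And>t. t \<in> {a..b} \<Longrightarrow> 0 < h t" "a < b"
  shows "0 < integral {a..b} h"
proof -
  have "{a<..<b} \<noteq> {}" using assms(3) by simp
  then have "integral {a..b} (\<lambda>_. 0) < integral {a..b} h"
    by (rule integral_less_real[OF continuous_on_const assms(1)]) (use assms(2) in simp)
  then show ?thesis by simp
qed

text \<open>The clamp freezes \<open>v\<close> at its endpoint values outside
  \<open>{t2..t3}\<close>. For ordered breakpoints at most one of the two ramp factors differs from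
  1 at any point, so the outer pieces are linear; the product form gives continuity at once.\<close>

definition trapezoid :: "(real \<Rightarrow> real) \<Rightarrow> real \<Rightarrow> real \<Rightarrow> real \<Rightarrow> real \<Rightarrow> real \<Rightarrow> real" where
  "trapezoid v t1 t2 t3 t4 t = v (max t2 (min t3 t))
    * max 0 (min 1 ((t - t1) / (t2 - t1))) * max 0 (min 1 ((t4 - t) / (t4 - t3)))"

text \<open>For t2 <= t3 the clamp inside \<open>deriv v\<close> is inert on its branch. It turns
  the expression into a bounded continuous function on the whole line, from which boundedness and
  Borel measurability follow. The values at the breakpoints are a convention.\<close>

definition trapezoid_deriv :: "(real \<Rightarrow> real) \<Rightarrow> real \<Rightarrow> real \<Rightarrow> real \<Rightarrow> real \<Rightarrow> real \<Rightarrow> real" where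
  "trapezoid_deriv v t1 t2 t3 t4 t =
    (if t \<le> t1 then 0 else if t \<le> t2 then v t2 / (t2 - t1)
     else if t \<le> t3 then deriv v (max t2 (min t3 t))
     else if t \<le> t4 then - (v t3 / (t4 - t3)) else 0)"

lemma ramp_eq:
  fixes x h :: real
  assumes "h > 0"
  shows "x \<le> 0 \<Longrightarrow> max 0 (min 1 (x / h)) = 0" "x \<ge> h \<Longrightarrow> max 0 (min 1 (x / h)) = 1"
    "0 \<le> x \<Longrightarrow> x \<le> h \<Longrightarrow> max 0 (min 1 (x / h)) = x / h"
proof -
  show "max 0 (min 1 (x / h)) = 0" if "x \<le> 0" using divide_nonpos_pos[OF that assms] by simp
  have "1 \<le> x / h" if "x \<ge> h" using assms that by (simp add: le_divide_eq)
  then show "max 0 (min 1 (x / h)) = 1" if "x \<ge> h" using that by simp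
  have "0 \<le> x / h \<and> x / h \<le> 1" if "0 \<le> x" "x \<le> h" using assms that by (simp add: divide_le_eq)
  then show "max 0 (min 1 (x / h)) = x / h" if "0 \<le> x" "x \<le> h" using that by simp
qed

lemma trapezoid_outside:
  assumes "t1 < t2" "t3 < t4" "t \<notin> {t1<..<t4}"
  shows "trapezoid v t1 t2 t3 t4 t = 0"
proof (cases "t \<le> t1")
  case True
  then have "max 0 (min 1 ((t - t1) / (t2 - t1))) = 0" using assms by (intro ramp_eq(1)) auto
  then show ?thesis unfolding trapezoid_def by (simp only: mult_zero_left mult_zero_right)
next
  case False
  then have "max 0 (min 1 ((t4 - t) / (t4 - t3))) = 0" using assms by (intro ramp_eq(1)) auto
  then show ?thesis unfolding trapezoid_def by (simp only: mult_zero_left mult_zero_right)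
qed

lemma trapezoid_middle:
  assumes "t1 < t2" "t3 < t4" "t \<in> {t2..t3}"
  shows "trapezoid v t1 t2 t3 t4 t = v t"
proof -
  have "max t2 (min t3 t) = t" using assms by auto
  moreover have "max 0 (min 1 ((t - t1) / (t2 - t1))) = 1" "max 0 (min 1 ((t4 - t) / (t4 - t3))) = 1"
    using assms by (intro ramp_eq(2); simp)+
  ultimately show ?thesis by (simp only: trapezoid_def mult_1_right)
qed

lemma trapezoid_has_deriv:
  assumes ord: "t1 < t2" "t2 < t3" "t3 < t4"
    and v: "\<And>t. t \<in> {t2..t3} \<Longrightarrow> v field_differentiable (at t)"
    and t: "t \<notin> {t1, t2, t3, t4}"
  shows "(trapezoid v t1 t2 t3 t4 has_real_derivative trapezoid_deriv v t1 t2 t3 t4 t) (at t)"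
proof -
  let ?\<phi> = "trapezoid v t1 t2 t3 t4" and ?\<phi>' = "trapezoid_deriv v t1 t2 t3 t4 t"
  consider "t \<in> {..<t1}" | "t \<in> {t1<..<t2}" | "t \<in> {t2<..<t3}" | "t \<in> {t3<..<t4}" | "t \<in> {t4<..}"
    using t ord by fastforce
  then show ?thesis
  proof cases
    case 1
    have "((\<lambda>_. 0) has_real_derivative ?\<phi>') (at t)"
      using 1 by (simp add: trapezoid_deriv_def)
    moreover have "0 = ?\<phi> y" if "y \<in> {..<t1}" for y
      using that ord by (intro trapezoid_outside[symmetric]) auto
    ultimately show ?thesis by (rule has_field_derivative_transform_within_open[OF _ open_lessThan 1])
  next
    case 2
    have "((\<lambda>t. v t2 * ((t - t1) / (t2 - t1))) has_real_derivative ?\<phi>') (at t)"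
      using 2 ord by (auto intro!: derivative_eq_intros simp: trapezoid_deriv_def)
    moreover have "v t2 * ((y - t1) / (t2 - t1)) = ?\<phi> y" if "y \<in> {t1<..<t2}" for y
    proof -
      have "max t2 (min t3 y) = t2" using that ord by auto
      moreover have "max 0 (min 1 ((y - t1) / (t2 - t1))) = (y - t1) / (t2 - t1)"
        using that ord by (intro ramp_eq(3)) auto
      moreover have "max 0 (min 1 ((t4 - y) / (t4 - t3))) = 1"
        using that ord by (intro ramp_eq(2)) auto
      ultimately show ?thesis by (simp only: trapezoid_def mult_1_right)
    qed
    ultimately show ?thesis by (rule has_field_derivative_transform_within_open[OF _ open_greaterThanLessThan 2])
  next
    case 3
    have "(v has_real_derivative ?\<phi>') (at t)"
      using 3 ord v[of t] by (auto simp: trapezoid_deriv_def field_differentiable_derivI)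
    moreover have "v y = ?\<phi> y" if "y \<in> {t2<..<t3}" for y
      using that ord by (intro trapezoid_middle[symmetric]) auto
    ultimately show ?thesis by (rule has_field_derivative_transform_within_open[OF _ open_greaterThanLessThan 3])
  next
    case 4
    have "((\<lambda>t. v t3 * ((t4 - t) / (t4 - t3))) has_real_derivative ?\<phi>') (at t)"
      using 4 ord by (auto intro!: derivative_eq_intros simp: trapezoid_deriv_def)
    moreover have "v t3 * ((t4 - y) / (t4 - t3)) = ?\<phi> y" if "y \<in> {t3<..<t4}" for y
    proof -
      have "max t2 (min t3 y) = t3" using that ord by auto
      moreover have "max 0 (min 1 ((t4 - y) / (t4 - t3))) = (t4 - y) / (t4 - t3)"
        using that ord by (intro ramp_eq(3)) auto
      moreover have "max 0 (min 1 ((y - t1) / (t2 - t1))) = 1"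
        using that ord by (intro ramp_eq(2)) auto
      ultimately show ?thesis by (simp only: trapezoid_def mult_1_right)
    qed
    ultimately show ?thesis by (rule has_field_derivative_transform_within_open[OF _ open_greaterThanLessThan 4])
  next
    case 5
    have "((\<lambda>_. 0) has_real_derivative ?\<phi>') (at t)"
      using 5 ord by (simp add: trapezoid_deriv_def)
    moreover have "0 = ?\<phi> y" if "y \<in> {t4<..}" for y
      using that ord by (intro trapezoid_outside[symmetric]) auto
    ultimately show ?thesis by (rule has_field_derivative_transform_within_open[OF _ open_greaterThan 5])
  qed
qed

text \<open>Divided by the integral over the middle interval, the energy has three parts: the rising
  ramp pays \<lambda>^p, the falling ramp pays 1, and the middle part is at most the supremum
  because |v'|^p = \<open>G t powr (p / (p - 1)) * v t powr p\<close>. The hypothesis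
  \<open>less\<close> charges \<lambda>^p to both ramps, which only overestimates the falling
  one.\<close>

lemma exists_violation_of_breakpoints:
  fixes w W G v :: "real \<Rightarrow> real" and R :: ereal
  assumes lam: "lam > 1" and p: "p > 1" and c: "c > 0"
    and t1: "0 < t1" and ord: "t1 < t2" "t2 < t3" "t3 < t4" and t4: "ereal t4 < R"
    and w: "continuous_on (Jint R) w" and W: "continuous_on (Jint R) W" and G: "continuous_on (Jint R) G"
    and wpos: "\<And>t. t \<in> Jint R \<Longrightarrow> 0 < w t" and Wpos: "\<And>t. t \<in> Jint R \<Longrightarrow> 0 < W t"
    and Gpos: "\<And>t. t \<in> Jint R \<Longrightarrow> 0 < G t"
    and v: "C1_on (Jint R) v" and vpos: "\<And>t. t \<in> Jint R \<Longrightarrow> 0 < v t"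
    and v_eq: "\<And>t. t \<in> Jint R \<Longrightarrow> - deriv v t / v t = G t powr (1 / (p - 1))"
    and less: "lam powr p *
        (v t2 powr p * radI DIM('a) w t1 t2
           / ((t2 - t1) powr p * radI DIM('a) (\<lambda>t. w t * W t * v t powr p) t2 t3)
       + v t3 powr p * radI DIM('a) w t3 t4
           / ((t4 - t3) powr p * radI DIM('a) (\<lambda>t. w t * W t * v t powr p) t2 t3))
       + Sup ((\<lambda>t. G t powr (p / (p - 1)) / W t) ` {t2..t3}) < c"
  shows "\<exists>\<epsilon>>0. \<exists>u \<in> test_functions (Omega_eps lam \<epsilon> R :: 'a::euclidean_space set).
     ennreal (lam powr p) *
       (\<integral>\<^sup>+ x \<in> Omega_eps lam \<epsilon> R.
          ennreal (w (rho_eps lam \<epsilon> x)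
                   * dual_metric (Feps lam \<epsilon>) x (frechet_derivative u (at x)) powr p)
        \<partial>BH_measure (Feps lam \<epsilon>))
     < ennreal c *
       (\<integral>\<^sup>+ x \<in> Omega_eps lam \<epsilon> R.
          ennreal (w (rho_eps lam \<epsilon> x) * W (rho_eps lam \<epsilon> x) * \<bar>u x\<bar> powr p)
        \<partial>BH_measure (Feps lam \<epsilon>))"
proof -
  define n where "n = DIM('a)"
  let ?\<phi> = "trapezoid v t1 t2 t3 t4" and ?\<phi>' = "trapezoid_deriv v t1 t2 t3 t4"
  \<comment> \<open>The profile is passed on as a function of s = t^2. On negative s the function
    \<open>sqrt\<close> takes negative values, below \<open>t1\<close>, so \<open>f\<close> is 0
    there.\<close>
  define f where "f s = ?\<phi> (sqrt s)" for s
  define f' where "f' s = ?\<phi>' (sqrt s) / (2 * sqrt s)" for s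
  define \<alpha> where "\<alpha> = v t2 / (t2 - t1)"
  define \<beta> where "\<beta> = v t3 / (t4 - t3)"
  define Sg where "Sg = Sup ((\<lambda>t. G t powr (p / (p - 1)) / W t) ` {t2..t3})"
  define J where "J = radI n (\<lambda>t. w t * W t * v t powr p) t2 t3"
  define I1 where "I1 = radI n w t1 t2"
  define I2 where "I2 = radI n w t3 t4"
  have KJ: "{t1..t4} \<subseteq> Jint R"
    using t1 t4 by (auto simp: Jint_def intro: order.strict_trans1[of _ "ereal t4"])
  have K: "{t1..t2} \<subseteq> Jint R" "{t2..t3} \<subseteq> Jint R" "{t3..t4} \<subseteq> Jint R"
    using KJ ord by (auto intro: subsetD[OF KJ])
  have tJ: "t2 \<in> Jint R" "t3 \<in> Jint R" using ord by (auto intro: subsetD[OF KJ])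
  have \<alpha>\<beta>: "0 < \<alpha>" "0 < \<beta>"
    using vpos[OF tJ(1)] vpos[OF tJ(2)] ord by (auto simp: \<alpha>_def \<beta>_def)
  have dv: "continuous_on {t2..t3} (deriv v)" and vc: "continuous_on {t2..t3} v"
    using C1_on_continuous[OF v K(2)] by auto
  have vd: "v field_differentiable (at t)" if "t \<in> {t2..t3}" for t
    using v that K(2) by (auto simp: C1_on_def)
  obtain Mv where Mv: "0 \<le> Mv" "\<And>t. \<bar>deriv v (max t2 (min t3 t))\<bar> \<le> Mv"
      "continuous_on UNIV (\<lambda>t. deriv v (max t2 (min t3 t)))"
    by (rule continuous_clamped_bounded[OF dv less_imp_le[OF ord(2)]]) (rule that)
  have Bv: "continuous_on UNIV (\<lambda>t. v (max t2 (min t3 t)))"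
    by (rule continuous_clamped_bounded[OF vc less_imp_le[OF ord(2)]])
  have \<phi>'b: "\<bar>?\<phi>' t\<bar> \<le> Mv + \<alpha> + \<beta>" for t
    using Mv(1) Mv(2)[of t] \<alpha>\<beta> unfolding trapezoid_deriv_def \<alpha>_def[symmetric] \<beta>_def[symmetric]
    by (auto simp del: max_def min_def)
  have \<phi>cont: "continuous_on UNIV ?\<phi>"
    unfolding trapezoid_def using Bv ord by (intro continuous_intros) auto
  have "?\<phi>' \<in> borel_measurable borel"
    unfolding trapezoid_deriv_def using borel_measurable_continuous_onI[OF Mv(3)] by measurable
  then have f'm: "f' \<in> borel_measurable borel"
    unfolding f'_def by (intro borel_measurable_divide measurable_compose[OF _ \<open>?\<phi>' \<in> borel_measurable borel\<close>]) auto
  have fcont: "continuous_on UNIV f"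
    unfolding f_def by (intro continuous_on_compose2[OF \<phi>cont] continuous_intros) auto
  have zero: "?\<phi> t = 0" if "t \<notin> {t1<..<t4}" for t
    by (rule trapezoid_outside[OF ord(1,3) that])
  have zero': "?\<phi>' t = 0" if "t \<notin> {t1..t4}" for t
    using that ord by (auto simp: trapezoid_deriv_def)
  have sqrt_in: "sqrt s \<in> {t1..t4} \<longleftrightarrow> s \<in> {t1\<^sup>2..t4\<^sup>2}" for s
  proof -
    have "t1 \<le> sqrt s \<longleftrightarrow> t1\<^sup>2 \<le> s" "sqrt s \<le> t4 \<longleftrightarrow> s \<le> t4\<^sup>2"
      using real_sqrt_le_iff[of "t1\<^sup>2" s] real_sqrt_le_iff[of s "t4\<^sup>2"] t1 ord by auto
    then show ?thesis by simp
  qed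
  have fderiv: "(f has_real_derivative f' s) (at s)" if s: "s \<notin> {t1\<^sup>2, t2\<^sup>2, t3\<^sup>2, t4\<^sup>2}" for s
  proof (cases "s < t1\<^sup>2")
    case True
    have small: "sqrt y < t1" if "y < t1\<^sup>2" for y using that t1 by (intro real_less_lsqrt) auto
    have "?\<phi>' (sqrt s) = 0" using small[OF True] by (intro zero') auto
    then have d0: "((\<lambda>_. 0) has_real_derivative f' s) (at s)" by (simp add: f'_def)
    have "s \<in> {..<t1\<^sup>2}" using True by simp
    from d0 open_lessThan this show ?thesis
    proof (rule has_field_derivative_transform_within_open)
      show "0 = f y" if "y \<in> {..<t1\<^sup>2}" for y
        unfolding f_def using small[of y] that by (intro zero[symmetric]) auto
    qed
  next
    case False
    have "0 < t1\<^sup>2" using t1 by simp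
    with False have s0: "0 < s" by linarith
    have "sqrt s \<notin> {t1, t2, t3, t4}" using s s0 by auto
    from DERIV_chain2[OF trapezoid_has_deriv[OF ord vd this] DERIV_real_sqrt[OF s0]]
    have "(f has_real_derivative ?\<phi>' (sqrt s) * (inverse (sqrt s) / 2)) (at s)"
      unfolding f_def[abs_def] .
    moreover have "?\<phi>' (sqrt s) * (inverse (sqrt s) / 2) = f' s"
      unfolding f'_def using s0 by (simp add: field_simps)
    ultimately show ?thesis by (simp only:)
  qed
  \<comment> \<open>The factor \<open>1 / (2 * sqrt s)\<close> is harmless: the derivative vanishes
    where \<open>sqrt s < t1\<close>, and elsewhere the factor is at most
    \<open>1 / (2 * t1)\<close>.\<close>
  have f'b: "\<bar>f' s\<bar> \<le> (Mv + \<alpha> + \<beta>) / (2 * t1)" for s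
  proof (cases "sqrt s < t1")
    case True
    then have "?\<phi>' (sqrt s) = 0" by (intro zero') auto
    then show ?thesis using Mv(1) \<alpha>\<beta> t1 by (simp add: f'_def)
  next
    case False
    then show ?thesis unfolding f'_def abs_divide using \<phi>'b[of "sqrt s"] t1 Mv(1) \<alpha>\<beta>
      by (intro frac_le) auto
  qed
  have f0: "f s = 0" and f'0: "f' s = 0" if "s \<notin> {t1\<^sup>2..t4\<^sup>2}" for s
  proof -
    have "sqrt s \<notin> {t1..t4}" using that sqrt_in by blast
    then show "f s = 0" "f' s = 0"
      using zero[of "sqrt s"] zero'[of "sqrt s"] by (auto simp: f_def f'_def)
  qed
  have fsq: "f (t\<^sup>2) = ?\<phi> t" "2 * t * f' (t\<^sup>2) = ?\<phi>' t" if "t > 0" for t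
    using that by (auto simp: f_def f'_def)
  have Sg: "G t powr (p / (p - 1)) \<le> Sg * W t" if t: "t \<in> {t2..t3}" for t
  proof -
    have "continuous_on {t2..t3} (\<lambda>t. G t powr (p / (p - 1)) / W t)"
      using K(2) Gpos Wpos by (intro continuous_intros continuous_on_subset[OF G] continuous_on_subset[OF W])
        (auto simp: less_imp_neq[THEN not_sym] subset_eq)
    then have "compact ((\<lambda>t. G t powr (p / (p - 1)) / W t) ` {t2..t3})"
      by (intro compact_continuous_image compact_Icc)
    then have "bdd_above ((\<lambda>t. G t powr (p / (p - 1)) / W t) ` {t2..t3})"
      by (intro bounded_imp_bdd_above compact_imp_bounded)
    then have "G t powr (p / (p - 1)) / W t \<le> Sg"
      unfolding Sg_def using t by (intro cSup_upper imageI)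
    then show ?thesis using Wpos[of t] t K(2) by (auto simp: pos_divide_le_eq)
  qed
  have Sg0: "0 \<le> Sg"
    using Sg[of t2] Wpos[of t2] K(2) ord by (smt (verit) powr_ge_zero atLeastAtMost_iff mult_neg_pos subsetD)
  have wc: "continuous_on S w" if "S \<subseteq> Jint R" for S using w that by (rule continuous_on_subset)
  have pc: "continuous_on S (\<lambda>t. t ^ (n - 1))" for S :: "real set" by (intro continuous_intros)
  have Jc: "continuous_on {t2..t3} (\<lambda>t. w t * W t * v t powr p * t ^ (n - 1))"
    using vpos K(2) by (intro continuous_intros wc continuous_on_subset[OF W] vc K(2))
      (auto simp: less_imp_neq[THEN not_sym] subset_eq)
  have tpos: "0 < t" if "t \<in> Jint R" for t using that by (simp add: Jint_def)
  have Jp: "0 < w t * W t * v t powr p * t ^ (n - 1)" if "t \<in> {t2..t3}" for t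
  proof -
    have "t \<in> Jint R" using that K(2) by auto
    then show ?thesis using wpos[of t] Wpos[of t] vpos[of t] tpos[of t] by simp
  qed
  have wp: "0 \<le> w t * t ^ (n - 1)" if "t \<in> Jint R" for t
    using wpos[OF that] tpos[OF that] by simp
  have Jpos: "0 < J"
    unfolding J_def radI_def by (rule integral_pos_continuous[OF Jc Jp ord(2)])
  have Jnn: "(\<integral>\<^sup>+t. ennreal (w t * W t * v t powr p * t ^ (n - 1)) * indicator {t2..t3} t \<partial>lborel) = ennreal J"
    unfolding J_def radI_def by (rule nn_integral_Icc_continuous[OF Jc less_imp_le[OF Jp]])
  have I1nn: "(\<integral>\<^sup>+t. ennreal (w t * t ^ (n - 1)) * indicator {t1..t2} t \<partial>lborel) = ennreal I1"
    unfolding I1_def radI_def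
    by (rule nn_integral_Icc_continuous[OF continuous_on_mult[OF wc[OF K(1)] pc] wp[OF subsetD[OF K(1)]]])
  have I2nn: "(\<integral>\<^sup>+t. ennreal (w t * t ^ (n - 1)) * indicator {t3..t4} t \<partial>lborel) = ennreal I2"
    unfolding I2_def radI_def
    by (rule nn_integral_Icc_continuous[OF continuous_on_mult[OF wc[OF K(3)] pc] wp[OF subsetD[OF K(3)]]])
  define X where "X t = max (lam * ?\<phi>' t) (- ?\<phi>' t) powr p" for t
  define E1 where "E1 t = ennreal (lam powr p * \<alpha> powr p) * (ennreal (w t * t ^ (n - 1)) * indicator {t1..t2} t)" for t
  define E2 where "E2 t = ennreal Sg * (ennreal (w t * W t * v t powr p * t ^ (n - 1)) * indicator {t2..t3} t)" for t
  define E3 where "E3 t = ennreal (\<beta> powr p) * (ennreal (w t * t ^ (n - 1)) * indicator {t3..t4} t)" for t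
  \<comment> \<open>One dominating term per piece of the profile, so that the energy splits into
    three explicit integrals.\<close>
  have E: "ennreal (w t * X t) * ennreal (t ^ (n - 1)) * indicator {0<..} t \<le> E1 t + (E2 t + E3 t)" for t
  proof -
    consider "t \<le> t1" | "t1 < t" "t \<le> t2" | "t2 < t" "t \<le> t3" | "t3 < t" "t \<le> t4" | "t4 < t" by linarith
    then show ?thesis
    proof cases
      case 1
      then have "X t = 0" using p by (simp add: X_def trapezoid_deriv_def)
      then show ?thesis by simp
    next
      case 2
      then have tt: "t \<in> {t1..t2}" "0 < t" using t1 by auto
      have wt: "0 \<le> w t" using wpos[of t] K(1) tt by (auto intro: less_imp_le)
      have "?\<phi>' t = \<alpha>" using 2 by (simp add: trapezoid_deriv_def \<alpha>_def)
      moreover have "- \<alpha> \<le> lam * \<alpha>" using \<alpha>\<beta> lam by (smt (verit) mult_pos_pos)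
      ultimately have "X t = lam powr p * \<alpha> powr p"
        unfolding X_def using \<alpha>\<beta> lam by (simp add: max_absorb1 powr_mult)
      then have "ennreal (w t * X t) * ennreal (t ^ (n - 1)) * indicator {0<..} t = E1 t"
        using tt wt by (simp add: E1_def mult_ac flip: ennreal_mult)
      then show ?thesis by (simp add: add_increasing2)
    next
      case 3
      then have tt: "t \<in> {t2..t3}" "0 < t" using t1 ord by auto
      then have tR: "t \<in> Jint R" using K(2) by blast
      have nn: "0 \<le> w t" "0 \<le> W t" "0 \<le> v t" using wpos[OF tR] Wpos[OF tR] vpos[OF tR] by auto
      have "?\<phi>' t = deriv v t" using 3 ord by (simp add: trapezoid_deriv_def)
      moreover have "deriv v t = - (v t * G t powr (1 / (p - 1)))"
        using v_eq[OF tR] vpos[OF tR] by (simp add: field_simps)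
      ultimately have \<phi>t: "?\<phi>' t = - (v t * G t powr (1 / (p - 1)))" by simp
      have "0 \<le> v t * G t powr (1 / (p - 1))" using nn by simp
      \<comment> \<open>The decrease of \<open>v\<close> selects the entry of the maximum without
        \<lambda>. This is what keeps the middle quotient near 1.\<close>
      moreover have "lam * ?\<phi>' t \<le> 0" unfolding \<phi>t using lam nn by (simp add: mult_nonneg_nonneg)
      ultimately have "X t = (v t * G t powr (1 / (p - 1))) powr p"
        unfolding X_def using \<phi>t by (simp add: max_absorb2)
      also have "\<dots> = v t powr p * G t powr (p / (p - 1))"
        by (simp add: powr_mult powr_powr)
      also have "\<dots> \<le> v t powr p * (Sg * W t)" by (intro mult_left_mono Sg tt) auto
      finally have "w t * X t * t ^ (n - 1) \<le> w t * (v t powr p * (Sg * W t)) * t ^ (n - 1)"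
        using nn tt by (intro mult_right_mono mult_left_mono) auto
      then have "ennreal (w t * X t * t ^ (n - 1)) \<le> ennreal (Sg * (w t * W t * v t powr p * t ^ (n - 1)))"
        by (intro ennreal_leI) (simp add: mult_ac)
      also have "\<dots> = E2 t"
        using tt nn Sg0 by (simp add: E2_def ennreal_mult)
      finally have "ennreal (w t * X t) * ennreal (t ^ (n - 1)) * indicator {0<..} t \<le> E2 t"
        using tt nn by (simp add: ennreal_mult X_def)
      then show ?thesis by (simp add: add_increasing add_increasing2)
    next
      case 4
      then have tt: "t \<in> {t3..t4}" "0 < t" using t1 ord by auto
      have wt: "0 \<le> w t" using wpos[of t] K(3) tt by (auto intro: less_imp_le)
      have "?\<phi>' t = - \<beta>" using 4 ord by (simp add: trapezoid_deriv_def \<beta>_def)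
      moreover have "lam * - \<beta> \<le> \<beta>" using \<alpha>\<beta> lam by (smt (verit) mult_pos_neg)
      ultimately have "X t = \<beta> powr p"
        unfolding X_def by (simp add: max_absorb2)
      then have "ennreal (w t * X t) * ennreal (t ^ (n - 1)) * indicator {0<..} t = E3 t"
        using tt wt by (simp add: E3_def mult_ac flip: ennreal_mult)
      then show ?thesis by (simp add: add_increasing)
    next
      case 5
      then have "X t = 0" using p ord by (simp add: X_def trapezoid_deriv_def)
      then show ?thesis by simp
    qed
  qed
  have m1: "(\<lambda>t. ennreal (w t * t ^ (n - 1)) * indicator {t1..t2} t) \<in> borel_measurable lborel"
    and m3: "(\<lambda>t. ennreal (w t * t ^ (n - 1)) * indicator {t3..t4} t) \<in> borel_measurable lborel"
    using borel_measurable_ennreal_Icc[OF continuous_on_mult[OF wc[OF K(1)] pc]]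
      borel_measurable_ennreal_Icc[OF continuous_on_mult[OF wc[OF K(3)] pc]] by simp_all
  have m2: "(\<lambda>t. ennreal (w t * W t * v t powr p * t ^ (n - 1)) * indicator {t2..t3} t) \<in> borel_measurable lborel"
    using borel_measurable_ennreal_Icc[OF Jc] by simp
  have e1: "(\<integral>\<^sup>+t. E1 t \<partial>lborel) = ennreal (lam powr p * \<alpha> powr p) * ennreal I1"
    unfolding E1_def I1nn[symmetric] by (rule nn_integral_cmult[OF m1])
  have e2: "(\<integral>\<^sup>+t. E2 t \<partial>lborel) = ennreal Sg * ennreal J"
    unfolding E2_def Jnn[symmetric] by (rule nn_integral_cmult[OF m2])
  have e3: "(\<integral>\<^sup>+t. E3 t \<partial>lborel) = ennreal (\<beta> powr p) * ennreal I2"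
    unfolding E3_def I2nn[symmetric] by (rule nn_integral_cmult[OF m3])
  have E1m: "E1 \<in> borel_measurable lborel" unfolding E1_def by (intro borel_measurable_times_ennreal m1) simp
  have E2m: "E2 \<in> borel_measurable lborel" unfolding E2_def by (intro borel_measurable_times_ennreal m2) simp
  have E3m: "E3 \<in> borel_measurable lborel" unfolding E3_def by (intro borel_measurable_times_ennreal m3) simp
  have Inn: "0 \<le> I1" "0 \<le> I2"
    unfolding I1_def I2_def radI_def
    by (intro integral_nonneg integrable_continuous_real continuous_on_mult wc pc K wp; use K in blast)+
  have key: "lam powr p * \<alpha> powr p * I1 + (Sg * J + \<beta> powr p * I2) < c * J"
  proof -
    have "v t2 powr p * I1 / ((t2 - t1) powr p * J) = \<alpha> powr p * I1 / J"
      "v t3 powr p * I2 / ((t4 - t3) powr p * J) = \<beta> powr p * I2 / J"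
      by (simp_all add: \<alpha>_def \<beta>_def powr_divide)
    then have "lam powr p * (\<alpha> powr p * I1 / J + \<beta> powr p * I2 / J) + Sg < c"
      using less unfolding n_def[symmetric] I1_def[symmetric] I2_def[symmetric] J_def[symmetric] Sg_def[symmetric] by simp
    then have "(lam powr p * (\<alpha> powr p * I1 / J + \<beta> powr p * I2 / J) + Sg) * J < c * J"
      using Jpos by (rule mult_strict_right_mono)
    then have "lam powr p * (\<alpha> powr p * I1 + \<beta> powr p * I2) + Sg * J < c * J"
      using Jpos by (simp add: distrib_right add_divide_distrib[symmetric])
    \<comment> \<open>Since \<lambda>^p >= 1, the charge to the falling ramp in \<open>less\<close>
      covers its actual cost.\<close>
    moreover have "1 * (\<beta> powr p * I2) \<le> lam powr p * (\<beta> powr p * I2)"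
      using lam p Inn by (intro mult_right_mono ge_one_powr_ge_zero) auto
    ultimately show ?thesis by (simp add: distrib_left mult.assoc)
  qed
  \<comment> \<open>Only the middle interval is kept; the ramps contribute nonnegatively to this
    side.\<close>
  have lower: "ennreal J \<le> (\<integral>\<^sup>+t. ennreal (w t * W t * \<bar>f (t\<^sup>2)\<bar> powr p)
      * ennreal (t ^ (n - 1)) * indicator {0<..} t \<partial>lborel)"
    unfolding Jnn[symmetric]
  proof (rule nn_integral_mono)
    fix t
    show "ennreal (w t * W t * v t powr p * t ^ (n - 1)) * indicator {t2..t3} t
      \<le> ennreal (w t * W t * \<bar>f (t\<^sup>2)\<bar> powr p) * ennreal (t ^ (n - 1)) * indicator {0<..} t"
    proof (cases "t \<in> {t2..t3}")
      case True
      then have t0: "0 < t" using t1 ord by auto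
      have tR: "t \<in> Jint R" using True K(2) by blast
      have nn: "0 \<le> w t" "0 \<le> W t" "0 \<le> v t" using wpos[OF tR] Wpos[OF tR] vpos[OF tR] by auto
      have "f (t\<^sup>2) = v t" using fsq(1)[OF t0] trapezoid_middle[OF ord(1,3) True] by simp
      then show ?thesis using True t0 nn by (simp flip: ennreal_mult)
    qed simp
  qed
  have "(\<integral>\<^sup>+t. ennreal (w t * max (lam * (2 * t * f' (t\<^sup>2))) (- (2 * t * f' (t\<^sup>2))) powr p)
          * ennreal (t ^ (n - 1)) * indicator {0<..} t \<partial>lborel)
      = (\<integral>\<^sup>+t. ennreal (w t * X t) * ennreal (t ^ (n - 1)) * indicator {0<..} t \<partial>lborel)"
  proof (rule nn_integral_cong)
    fix t
    show "ennreal (w t * max (lam * (2 * t * f' (t\<^sup>2))) (- (2 * t * f' (t\<^sup>2))) powr p)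
          * ennreal (t ^ (n - 1)) * indicator {0<..} t
        = ennreal (w t * X t) * ennreal (t ^ (n - 1)) * indicator {0<..} t"
    proof (cases "t > 0")
      case True
      show ?thesis unfolding fsq(2)[OF True] X_def ..
    next
      case False
      then have "indicator {0<..} t = (0::ennreal)" by simp
      then show ?thesis by (simp only: mult_zero_right)
    qed
  qed
  also have "\<dots> \<le> (\<integral>\<^sup>+t. E1 t + (E2 t + E3 t) \<partial>lborel)" by (rule nn_integral_mono) (rule E)
  also have "\<dots> = (\<integral>\<^sup>+t. E1 t \<partial>lborel) + ((\<integral>\<^sup>+t. E2 t \<partial>lborel) + (\<integral>\<^sup>+t. E3 t \<partial>lborel))"
    using E1m E2m E3m by (simp add: nn_integral_add)
  also have "\<dots> = ennreal (lam powr p * \<alpha> powr p * I1 + (Sg * J + \<beta> powr p * I2))"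
    unfolding e1 e2 e3 using Inn Sg0 Jpos by (simp flip: ennreal_mult ennreal_plus)
  also have "\<dots> < ennreal (c * J)" using key Inn Sg0 Jpos by (intro ennreal_lessI) (auto intro: mult_pos_pos c)
  also have "\<dots> = ennreal c * ennreal J" using c Jpos by (simp add: ennreal_mult)
  also have "\<dots> \<le> ennreal c * (\<integral>\<^sup>+t. ennreal (w t * W t * \<bar>f (t\<^sup>2)\<bar> powr p)
      * ennreal (t ^ (n - 1)) * indicator {0<..} t \<partial>lborel)"
    by (intro mult_left_mono lower) simp
  finally have ineq: "(\<integral>\<^sup>+t. ennreal (w t * max (lam * (2 * t * f' (t\<^sup>2))) (- (2 * t * f' (t\<^sup>2))) powr p)
          * ennreal (t ^ (n - 1)) * indicator {0<..} t \<partial>lborel)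
      < ennreal c * (\<integral>\<^sup>+t. ennreal (w t * W t * \<bar>f (t\<^sup>2)\<bar> powr p)
      * ennreal (t ^ (n - 1)) * indicator {0<..} t \<partial>lborel)" .
  have t14: "t1\<^sup>2 < t4\<^sup>2" "0 < t1\<^sup>2" "sqrt (t4\<^sup>2) = t4" using t1 ord by (auto intro: power_strict_mono)
  have p0: "p > 0" using p by simp
  have fin: "finite {t1\<^sup>2, t2\<^sup>2, t3\<^sup>2, t4\<^sup>2}" by simp
  show ?thesis
    by (rule exists_violation_of_profile[OF lam p0 t14(2,1) _ w W wpos Wpos fin fcont fderiv f'b f'm f0 f'0 c
      ineq[unfolded n_def]]) (use t4 t14 in auto)
qed

theorem theorem4p3:
  fixes lam p \<delta>0 :: real and R :: ereal
    and L W w G v t1 t2 t3 t4 :: "real \<Rightarrow> real"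
    and dummy :: "'a::euclidean_space itself"
  assumes n2: "DIM('a) \<ge> 2"
    and lam: "lam > 1"
    and p: "p > 1"
    and R: "R > 0"
    and L_cont: "continuous_on (Jint R) L" and L_pos: "\<forall>t\<in>Jint R. L t > 0"
    and L_le: "\<forall>t\<in>Jint R. L t \<le> (real DIM('a) - 1) / t"
    and W_cont: "continuous_on (Jint R) W" and W_pos: "\<forall>t\<in>Jint R. W t > 0"
    and w_C1: "C1_on (Jint R) w" and w_pos: "\<forall>t\<in>Jint R. w t > 0"
    and G_C1: "C1_on (Jint R) G" and G_pos: "\<forall>t\<in>Jint R. G t > 0"
    and G_eq: "\<forall>t\<in>Jint R. deriv (\<lambda>s. G s * w s) t + G t * w t * L t
                  - (p - 1) * G t powr (p / (p - 1)) * w t = W t * w t"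
    and v_C1: "C1_on (Jint R) v" and v_pos: "\<forall>t\<in>Jint R. v t > 0"
    and v_eq: "\<forall>t\<in>Jint R. - deriv v t / v t = G t powr (1 / (p - 1))"
    and \<delta>0: "\<delta>0 > 0"
    and t_cont: "continuous_on {\<delta>0<..} t1" "continuous_on {\<delta>0<..} t2"
                "continuous_on {\<delta>0<..} t3" "continuous_on {\<delta>0<..} t4"
    and t_lim: "\<exists>l::ereal. ((\<lambda>\<delta>. ereal (t1 \<delta>)) \<longlongrightarrow> l) at_top"
               "\<exists>l::ereal. ((\<lambda>\<delta>. ereal (t2 \<delta>)) \<longlongrightarrow> l) at_top"
               "\<exists>l::ereal. ((\<lambda>\<delta>. ereal (t3 \<delta>)) \<longlongrightarrow> l) at_top"
               "\<exists>l::ereal. ((\<lambda>\<delta>. ereal (t4 \<delta>)) \<longlongrightarrow> l) at_top"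
    and t_ord: "\<forall>\<delta>>\<delta>0. 0 < t1 \<delta> \<and> t1 \<delta> < t2 \<delta> \<and> t2 \<delta> < t3 \<delta> \<and> t3 \<delta> < t4 \<delta>
                       \<and> ereal (t4 \<delta>) < R"
    and lim1: "((\<lambda>\<delta>.
         v (t2 \<delta>) powr p * radI DIM('a) w (t1 \<delta>) (t2 \<delta>)
           / ((t2 \<delta> - t1 \<delta>) powr p
              * radI DIM('a) (\<lambda>t. w t * W t * v t powr p) (t2 \<delta>) (t3 \<delta>))
       + v (t3 \<delta>) powr p * radI DIM('a) w (t3 \<delta>) (t4 \<delta>)
           / ((t4 \<delta> - t3 \<delta>) powr p
              * radI DIM('a) (\<lambda>t. w t * W t * v t powr p) (t2 \<delta>) (t3 \<delta>)))
       \<longlongrightarrow> 0) at_top"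
    and lim2: "((\<lambda>\<delta>. Sup ((\<lambda>t. G t powr (p / (p - 1)) / W t) ` {t2 \<delta>..t3 \<delta>})) \<longlongrightarrow> 1) at_top"
  shows "\<forall>c>1. \<exists>\<epsilon>>0. \<exists>u \<in> test_functions (Omega_eps lam \<epsilon> R :: 'a set).
     ennreal (lam powr p) *
       (\<integral>\<^sup>+ x \<in> Omega_eps lam \<epsilon> R.
          ennreal (w (rho_eps lam \<epsilon> x)
                   * dual_metric (Feps lam \<epsilon>) x (frechet_derivative u (at x)) powr p)
        \<partial>BH_measure (Feps lam \<epsilon>))
     < ennreal c *
       (\<integral>\<^sup>+ x \<in> Omega_eps lam \<epsilon> R.
          ennreal (w (rho_eps lam \<epsilon> x) * W (rho_eps lam \<epsilon> x) * \<bar>u x\<bar> powr p)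
        \<partial>BH_measure (Feps lam \<epsilon>))"
proof (intro allI impI)
  fix c :: real assume c: "c > 1"
  define s where "s \<delta> =
         v (t2 \<delta>) powr p * radI DIM('a) w (t1 \<delta>) (t2 \<delta>)
           / ((t2 \<delta> - t1 \<delta>) powr p
              * radI DIM('a) (\<lambda>t. w t * W t * v t powr p) (t2 \<delta>) (t3 \<delta>))
       + v (t3 \<delta>) powr p * radI DIM('a) w (t3 \<delta>) (t4 \<delta>)
           / ((t4 \<delta> - t3 \<delta>) powr p
              * radI DIM('a) (\<lambda>t. w t * W t * v t powr p) (t2 \<delta>) (t3 \<delta>))" for \<delta>
  define S where "S \<delta> = Sup ((\<lambda>t. G t powr (p / (p - 1)) / W t) ` {t2 \<delta>..t3 \<delta>})" for \<delta>
  \<comment> \<open>The fixed factor \<lambda>^p does not disturb the vanishing ramp quotients, so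
    the whole bound tends to 1 and falls below c. A single sufficiently large
    \<open>\<delta>\<close> then provides the breakpoints.\<close>
  have "((\<lambda>\<delta>. lam powr p * s \<delta> + S \<delta>) \<longlongrightarrow> lam powr p * 0 + 1) at_top"
    by (intro tendsto_add tendsto_mult tendsto_const) (use lim1 lim2 in \<open>simp_all add: s_def S_def\<close>)
  then have "\<forall>\<^sub>F \<delta> in at_top. lam powr p * s \<delta> + S \<delta> < c"
    using c by (intro order_tendstoD(2)) auto
  then have "\<forall>\<^sub>F \<delta> in at_top. lam powr p * s \<delta> + S \<delta> < c \<and> \<delta>0 < \<delta>"
    by (intro eventually_conj eventually_gt_at_top)
  then obtain \<delta> where \<delta>: "lam powr p * s \<delta> + S \<delta> < c" "\<delta>0 < \<delta>"
    by (auto dest: eventually_happens)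
  have ord: "0 < t1 \<delta>" "t1 \<delta> < t2 \<delta>" "t2 \<delta> < t3 \<delta>" "t3 \<delta> < t4 \<delta>" "ereal (t4 \<delta>) < R"
    using t_ord \<delta>(2) by auto
  have pos: "\<And>t. t \<in> Jint R \<Longrightarrow> 0 < w t" "\<And>t. t \<in> Jint R \<Longrightarrow> 0 < W t"
    "\<And>t. t \<in> Jint R \<Longrightarrow> 0 < G t" "\<And>t. t \<in> Jint R \<Longrightarrow> 0 < v t"
    "\<And>t. t \<in> Jint R \<Longrightarrow> - deriv v t / v t = G t powr (1 / (p - 1))"
    using w_pos W_pos G_pos v_pos v_eq by auto
  have c0: "c > 0" using c by simp
  show "\<exists>\<epsilon>>0. \<exists>u \<in> test_functions (Omega_eps lam \<epsilon> R :: 'a set).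
     ennreal (lam powr p) *
       (\<integral>\<^sup>+ x \<in> Omega_eps lam \<epsilon> R.
          ennreal (w (rho_eps lam \<epsilon> x)
                   * dual_metric (Feps lam \<epsilon>) x (frechet_derivative u (at x)) powr p)
        \<partial>BH_measure (Feps lam \<epsilon>))
     < ennreal c *
       (\<integral>\<^sup>+ x \<in> Omega_eps lam \<epsilon> R.
          ennreal (w (rho_eps lam \<epsilon> x) * W (rho_eps lam \<epsilon> x) * \<bar>u x\<bar> powr p)
        \<partial>BH_measure (Feps lam \<epsilon>))"
    by (rule exists_violation_of_breakpoints[OF lam p c0 ord
      C1_on_continuous(1)[OF w_C1 order_refl] W_cont C1_on_continuous(1)[OF G_C1 order_refl]
      pos(1-3) v_C1 pos(4,5) \<delta>(1)[unfolded s_def S_def]])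
qed

end
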